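(* Let $z\in\mathbb R^d$ and let $(Z_n)_{n\ge1}$ be an i.i.d. sequence of $\mathbb R^d$-valued random vectors. Let $\mathcal F$ be a pointwise measurable class of real Borel functions on $\mathbb R^d$ with envelope $F(y)=\sup_{f\in\mathcal F}|f(y)|$. Let $(h_n)_{n\ge1}$ be a non random sequence of non negative numbers such that $h_n\to0$ and $nh_n^d\to\infty$. Assume that the support $S$ of $F$ is bounded, and that $Z_1$ admits a version of Lebesgue density $\mathbf f$ on a neighborhood of $z$ that is continuous at $z$ and such that $\mathbf f(z)>0$. Let $\mathbf P_0$ be the uniform distribution on $S$, and assume that $\mathbf P_0(F^2)<\infty$ and that $J_{[]}(\infty,\mathcal F,\mathbf P_0)<\infty$. Then $$\frac{1}{\sqrt{\lambda(S)\mathbf f(z)}}\,T_{n,h_n}(\cdot)\longrightarrow\mathbb W_{\mathbf P_0}(\cdot)\quad\text{weakly in }\ell^\infty(\mathcal F)\text{ as }n\to\infty.$$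
   Context: $\lambda$ is Lebesgue measure on $\mathbb R^d$; it is implicit that $\lambda(S)>0$, so that the uniform distribution $\mathbf P_0$ on $S$ makes sense. For a measure $Q$, $Q(f)=\int f\,dQ$ and $\|f\|_{Q,2}=(Q(f^2))^{1/2}$. $\mathcal F$ is pointwise measurable if there is a countable $\mathcal F_0\subset\mathcal F$ such that every $f\in\mathcal F$ is the pointwise limit of a sequence in $\mathcal F_0$. The local empirical process at $z$ is (for all $n$ large enough) $$T_{n,h_n}(f)=\frac1{\sqrt{nh_n^d}}\sum_{i=1}^n\Big[f\big(h_n^{-1}(Z_i-z)\big)-\mathbb E\big(f(h_n^{-1}(Z_i-z))\big)\Big],\quad f\in\mathcal F.$$ The bracket $[f^-,f^+]$ between two real Borel functions is the set of Borel functions $f$ with $f^-\le f\le f^+$ everywhere. $N_{[]}(\varepsilon,\mathcal F,\|\cdot\|_{Q,2})$ is the minimal number of brackets with $\|f^+-f^-\|_{Q,2}$ less than $\varepsilon$ needed to cover $\mathcal F$, and $J_{[]}(\delta,\mathcal F,Q)=\int_0^\delta\sqrt{\log N_{[]}(\varepsilon,\mathcal F,\|\cdot\|_{Q,2})}\,d\varepsilon$ for $\delta\in(0,\infty]$. $\ell^\infty(\mathcal F)$ is the space of bounded real functions on $\mathcal F$ with the supremum norm; weak convergence is in the sense of Hoffmann-Jørgensen. $\mathbb W_{\mathbf P_0}$ is the $L^2(\mathbf P_0)$-isonormal Gaussian process indexed by $\mathcal F$ ($\mathbf P_0$-Brownian motion): the tight centered Gaussian random element of $\ell^\infty(\mathcal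 F)$ with covariance $\operatorname{Cov}(\mathbb W_{\mathbf P_0}(f),\mathbb W_{\mathbf P_0}(g))=\mathbf P_0(fg)$. *)

theory Defs
  imports "HOL-Probability.Probability"
begin

section \<open>Classes of functions\<close>

definition pointwise_measurable :: "('a \<Rightarrow> real) set \<Rightarrow> bool" where
  "pointwise_measurable \<F> \<longleftrightarrow>
     (\<exists>\<F>\<^sub>0. countable \<F>\<^sub>0 \<and> \<F>\<^sub>0 \<subseteq> \<F> \<and>
       (\<forall>f\<in>\<F>. \<exists>g :: nat \<Rightarrow> 'a \<Rightarrow> real.
          (\<forall>m. g m \<in> \<F>\<^sub>0) \<and> (\<forall>y. (\<lambda>m. g m y) \<longlonglongrightarrow> f y)))"

text \<open>The envelope is extended-valued, so that an infinite supremum is not given a junk value.\<close>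

definition envelope :: "('a \<Rightarrow> real) set \<Rightarrow> 'a \<Rightarrow> ennreal" where
  "envelope \<F> y = (SUP f\<in>\<F>. ennreal \<bar>f y\<bar>)"

text \<open>The support is the topological one, i.e. the closure of the set where the function
  does not vanish.\<close>

definition envelope_support :: "('a::topological_space \<Rightarrow> real) set \<Rightarrow> 'a set" where
  "envelope_support \<F> = closure {y. envelope \<F> y \<noteq> 0}"


section \<open>Bracketing\<close>

definition bracket :: "('a::topological_space \<Rightarrow> real) \<Rightarrow> ('a \<Rightarrow> real) \<Rightarrow> ('a \<Rightarrow> real) set" where
  "bracket l u = {f \<in> borel_measurable borel. \<forall>y. l y \<le> f y \<and> f y \<le> u y}"

text \<open>The Bochner integral of a non-integrable function is 0; the integrability conjunct
  makes \<open>L2_norm_less\<close> false when the norm is infinite.\<close>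

definition L2_norm_less :: "'a measure \<Rightarrow> ('a \<Rightarrow> real) \<Rightarrow> real \<Rightarrow> bool" where
  "L2_norm_less Q f \<epsilon> \<longleftrightarrow>
     integrable Q (\<lambda>y. (f y)\<^sup>2) \<and> sqrt (\<integral>y. (f y)\<^sup>2 \<partial>Q) < \<epsilon>"

definition bracket_covers ::
  "real \<Rightarrow> ('a::topological_space \<Rightarrow> real) set \<Rightarrow> 'a measure \<Rightarrow> (('a \<Rightarrow> real) \<times> ('a \<Rightarrow> real)) set set" where
  "bracket_covers \<epsilon> \<F> Q =
     {B. finite B \<and>
         (\<forall>(l, u)\<in>B. l \<in> borel_measurable borel \<and> u \<in> borel_measurable borel \<and>
                     L2_norm_less Q (\<lambda>y. u y - l y) \<epsilon>) \<and>
         \<F> \<subseteq> (\<Union>(l, u)\<in>B. bracket l u)}"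

text \<open>The infimum of the empty set is \<open>\<infinity>\<close>.\<close>

definition bracketing_number ::
  "real \<Rightarrow> ('a::topological_space \<Rightarrow> real) set \<Rightarrow> 'a measure \<Rightarrow> enat" where
  "bracketing_number \<epsilon> \<F> Q = (INF B\<in>bracket_covers \<epsilon> \<F> Q. enat (card B))"

definition sqrt_log :: "enat \<Rightarrow> ennreal" where
  "sqrt_log N = (case N of enat k \<Rightarrow> ennreal (sqrt (ln (real k))) | \<infinity> \<Rightarrow> \<infinity>)"

definition bracketing_integral ::
  "ereal \<Rightarrow> ('a::topological_space \<Rightarrow> real) set \<Rightarrow> 'a measure \<Rightarrow> ennreal" where
  "bracketing_integral \<delta> \<F> Q =
     (\<integral>\<^sup>+\<epsilon>\<in>{\<epsilon>. 0 < \<epsilon> \<and> ereal \<epsilon> < \<delta>}. sqrt_log (bracketing_number \<epsilon> \<F> Q) \<partial>lborel)"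


section \<open>The local empirical process\<close>

definition has_density_on ::
  "'w measure \<Rightarrow> ('w \<Rightarrow> 'a::euclidean_space) \<Rightarrow> 'a set \<Rightarrow> ('a \<Rightarrow> real) \<Rightarrow> bool" where
  "has_density_on M X U p \<longleftrightarrow>
     p \<in> borel_measurable (restrict_space borel U) \<and> (\<forall>y\<in>U. 0 \<le> p y) \<and>
     (\<forall>B\<in>sets borel. B \<subseteq> U \<longrightarrow>
        emeasure (distr M borel X) B = (\<integral>\<^sup>+y\<in>B. ennreal (p y) \<partial>lborel))"

definition local_empirical_process ::
  "'w measure \<Rightarrow> (nat \<Rightarrow> 'w \<Rightarrow> real^'d) \<Rightarrow> real^'d \<Rightarrow> nat \<Rightarrow> real \<Rightarrow>
   'w \<Rightarrow> (real^'d \<Rightarrow> real) \<Rightarrow> real" where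
  "local_empirical_process M Z z n h \<omega> f =
     1 / sqrt (real n * h ^ CARD('d)) *
     (\<Sum>i=1..n. f (inverse h *\<^sub>R (Z i \<omega> - z)) - (\<integral>\<omega>'. f (inverse h *\<^sub>R (Z i \<omega>' - z)) \<partial>M))"


section \<open>Weak convergence in the space of bounded functions\<close>

text \<open>Elements of \<open>linfty \<F>\<close> are functions that are \<open>undefined\<close> outside \<open>\<F>\<close>
  and bounded on \<open>\<F>\<close>; the metric is the supremum distance over \<open>\<F>\<close>.\<close>

abbreviation linfty :: "'b set \<Rightarrow> ('b \<Rightarrow> real) metric" where
  "linfty \<F> \<equiv> funspace \<F> euclidean_metric"

definition borel_sigma :: "'b metric \<Rightarrow> 'b measure" where
  "borel_sigma D = sigma (mspace D) {U. openin (mtopology_of D) U}"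

text \<open>On a probability space and for bounded \<open>T\<close> (the only case used), it makes no difference
  whether the measurable majorants range over real-valued integrable functions or over
  extended-real-valued functions whose expectation exists.\<close>

definition outer_expectation :: "'w measure \<Rightarrow> ('w \<Rightarrow> real) \<Rightarrow> real" where
  "outer_expectation M T =
     Inf {integral\<^sup>L M U | U. integrable M U \<and> (\<forall>\<omega>\<in>space M. T \<omega> \<le> U \<omega>)}"

text \<open>Hoffmann-Jorgensen convergence of arbitrary (not necessarily measurable) maps \<open>X n\<close>
  to a Borel law \<open>L\<close>. The maps need to take values in the metric space for large \<open>n\<close> only.\<close>

definition HJ_weakly_converges ::
  "'w measure \<Rightarrow> (nat \<Rightarrow> 'w \<Rightarrow> 'b) \<Rightarrow> 'b metric \<Rightarrow> 'b measure \<Rightarrow> bool" where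
  "HJ_weakly_converges M X D L \<longleftrightarrow>
     (\<forall>\<^sub>F n in sequentially. \<forall>\<omega>\<in>space M. X n \<omega> \<in> mspace D) \<and>
     (\<forall>H. continuous_map (mtopology_of D) euclideanreal H \<and> bounded (H ` mspace D) \<longrightarrow>
        (\<lambda>n. outer_expectation M (\<lambda>\<omega>. H (X n \<omega>))) \<longlonglongrightarrow> (\<integral>x. H x \<partial>L))"


section \<open>The isonormal Gaussian process\<close>

definition tight_law :: "'b metric \<Rightarrow> 'b measure \<Rightarrow> bool" where
  "tight_law D L \<longleftrightarrow>
     (\<forall>\<epsilon>>0. \<exists>K. compactin (mtopology_of D) K \<and> measure L K \<ge> 1 - \<epsilon>)"

text \<open>Point masses count as Gaussian.\<close>

definition gaussian_law :: "real measure \<Rightarrow> bool" where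
  "gaussian_law N \<longleftrightarrow>
     (\<exists>m. N = return borel m) \<or>
     (\<exists>m \<sigma>. \<sigma> > 0 \<and> N = density lborel (\<lambda>x. ennreal (normal_density m \<sigma> x)))"

text \<open>The law of the tight centered Gaussian random element \<open>W\<close> of \<open>linfty \<F>\<close> with covariance
  \<open>P (f g)\<close>. Joint Gaussianity of the marginals is Gaussianity of all their finite linear
  combinations.\<close>

definition isonormal_gaussian_law ::
  "'a measure \<Rightarrow> ('a \<Rightarrow> real) set \<Rightarrow> (('a \<Rightarrow> real) \<Rightarrow> real) measure \<Rightarrow> bool" where
  "isonormal_gaussian_law P \<F> L \<longleftrightarrow>
     prob_space L \<and> space L = mspace (linfty \<F>) \<and> sets L = sets (borel_sigma (linfty \<F>)) \<and>
     tight_law (linfty \<F>) L \<and>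
     (\<forall>A c. finite A \<and> A \<subseteq> \<F> \<longrightarrow> gaussian_law (distr L borel (\<lambda>w. \<Sum>f\<in>A. c f * w f))) \<and>
     (\<forall>f\<in>\<F>. (\<integral>w. w f \<partial>L) = 0) \<and>
     (\<forall>f\<in>\<F>. \<forall>g\<in>\<F>. (\<integral>w. w f * w g \<partial>L) = (\<integral>y. f y * g y \<partial>P))"

end

theory Submission
  imports Defs
begin

text \<open>
  The theorem is a central limit theorem for row-wise independent sums, seen through a rescaling.
  Near \<open>z\<close> the density is almost constant, so a function \<open>g\<close> that vanishes outside the bounded set
  \<open>S\<close> satisfies \<open>E g ((Z - z) / h) \<approx> dens z \<lambda>(S) h\<^sup>d P\<^sub>0(g)\<close> (\<open>expectation_rescaled_density\<close>).  Hence only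
  about \<open>r = n h\<^sup>d\<close> of the \<open>n\<close> observations are visible to the class, which explains the normalisation
  by \<open>sqrt r\<close>; and the upper half of this estimate, with one constant for all rows, is the only
  thing about their laws that the stochastic bounds use (assumption \<open>dominated\<close> of the locale
  \<open>independent_row\<close>).  In particular brackets that are small in \<open>L\<^sup>2(P\<^sub>0)\<close> are small in every row.

  \<^emph>\<open>Reduction to finitely many functions.\<close>  The brackets at the scales \<open>2\<^sup>-\<^sup>q\<close> are intersected to nested
  partitions of the class, in which every function \<open>f\<close> has a representative \<open>proj q f\<close> and a width
  \<open>width q f \<ge> \<bar>f - proj q f\<bar>\<close> with \<open>L\<^sup>2\<close> norm at most \<open>2\<^sup>-\<^sup>q\<close>; finiteness of the bracketing integral implies
  that the sum of \<open>2\<^sup>-\<^sup>q sqrt (ln N\<^sub>q)\<close> converges (\<open>bracketing_chain_exists\<close>).  Chaining along these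
  partitions bounds the distance of the process to its values at the representatives of level \<open>q\<close>,
  uniformly over the class and by a measurable variable whose mean is small for large \<open>q\<close> and \<open>n\<close>
  (\<open>chaining_bound\<close>).  As the variables have second moments only, a link of the chain is truncated at
  a threshold adapted to its level; a function is left at the first level at which its width exceeds
  the threshold, and this width then has a small mean (Ossiander's argument).

  \<^emph>\<open>The limit.\<close>  Countably many representatives suffice to describe the class, so the limit is built
  from a Gaussian sequence with the covariance of these representatives, obtained from independent
  standard normal variables by Gram-Schmidt orthogonalisation in \<open>L\<^sup>2(P\<^sub>0)\<close>.  The same chaining, now
  without truncation, shows that this sequence converges uniformly along the partitions
  (\<open>path_limit\<close>); its limit has a tight Gaussian law (\<open>isonormal_law\<close>).

  \<^emph>\<open>Comparison.\<close>  For a bounded Lipschitz function \<open>H\<close> on the space of bounded functions, process and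
  limit may both be replaced by their values at the representatives of a fixed level, where \<open>H\<close>
  becomes a function of finitely many real variables.  There the convergence follows from that of
  characteristic functions (\<open>row_clt\<close>, \<open>fidi_convergence\<close>).  Lipschitz functions are enough because
  a bounded continuous function is a monotone limit of such functions from both sides
  (\<open>HJ_weakly_converges_lipschitzI\<close>).
\<close>

section \<open>Hoffmann-Jorgensen convergence\<close>

lemma outer_expectation_le:
  assumes "prob_space M" "integrable M U" "\<And>\<omega>. \<omega> \<in> space M \<Longrightarrow> T \<omega> \<le> U \<omega>"
    and "\<And>\<omega>. \<omega> \<in> space M \<Longrightarrow> c \<le> T \<omega>"
  shows "outer_expectation M T \<le> integral\<^sup>L M U"
  unfolding outer_expectation_def
proof (rule cInf_lower)
  interpret prob_space M by fact
  show "bdd_below {integral\<^sup>L M U | U. integrable M U \<and> (\<forall>\<omega>\<in>space M. T \<omega> \<le> U \<omega>)}"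
  proof (rule bdd_belowI[of _ c], safe)
    fix V assume V: "integrable M V" "\<forall>\<omega>\<in>space M. T \<omega> \<le> V \<omega>"
    have "(\<integral>\<omega>. c \<partial>M) \<le> integral\<^sup>L M V"
      using V assms(4) by (intro integral_mono) (auto intro: order_trans)
    then show "c \<le> integral\<^sup>L M V" by (simp add: prob_space)
  qed
qed (use assms in auto)

lemma outer_expectation_ge:
  assumes "prob_space M" "integrable M V" "\<And>\<omega>. \<omega> \<in> space M \<Longrightarrow> V \<omega> \<le> T \<omega>"
    and "\<And>\<omega>. \<omega> \<in> space M \<Longrightarrow> T \<omega> \<le> c"
  shows "integral\<^sup>L M V \<le> outer_expectation M T"
  unfolding outer_expectation_def
proof (rule cInf_greatest)
  interpret prob_space M by fact
  show "{integral\<^sup>L M U | U. integrable M U \<and> (\<forall>\<omega>\<in>space M. T \<omega> \<le> U \<omega>)} \<noteq> {}"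
    using assms(4) by (auto intro!: exI[of _ "\<lambda>_. c"])
  fix x assume "x \<in> {integral\<^sup>L M U | U. integrable M U \<and> (\<forall>\<omega>\<in>space M. T \<omega> \<le> U \<omega>)}"
  then obtain U where U: "x = integral\<^sup>L M U" "integrable M U" "\<forall>\<omega>\<in>space M. T \<omega> \<le> U \<omega>" by auto
  show "integral\<^sup>L M V \<le> x"
    unfolding U(1) using U assms(2,3) by (intro integral_mono) (auto intro: order_trans)
qed

lemma outer_expectation_mono:
  assumes "prob_space M" "\<And>\<omega>. \<omega> \<in> space M \<Longrightarrow> T \<omega> \<le> T' \<omega>"
    and "\<And>\<omega>. \<omega> \<in> space M \<Longrightarrow> c \<le> T \<omega>" "\<And>\<omega>. \<omega> \<in> space M \<Longrightarrow> T' \<omega> \<le> c'"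
  shows "outer_expectation M T \<le> outer_expectation M T'"
  unfolding outer_expectation_def[of M T']
proof (rule cInf_greatest)
  interpret prob_space M by fact
  show "{integral\<^sup>L M U | U. integrable M U \<and> (\<forall>\<omega>\<in>space M. T' \<omega> \<le> U \<omega>)} \<noteq> {}"
    using assms(4) by (auto intro!: exI[of _ "\<lambda>_. c'"])
  fix x assume "x \<in> {integral\<^sup>L M U | U. integrable M U \<and> (\<forall>\<omega>\<in>space M. T' \<omega> \<le> U \<omega>)}"
  then obtain U where "x = integral\<^sup>L M U" "integrable M U" "\<forall>\<omega>\<in>space M. T' \<omega> \<le> U \<omega>" by auto
  then show "outer_expectation M T \<le> x"
    using assms by (auto intro!: outer_expectation_le[where c=c] intro: order_trans)
qed

definition bounded_lipschitz :: "'b metric \<Rightarrow> real \<Rightarrow> real \<Rightarrow> ('b \<Rightarrow> real) \<Rightarrow> bool" where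
  "bounded_lipschitz D C m H \<longleftrightarrow> 0 \<le> m \<and> (\<forall>x\<in>mspace D. \<bar>H x\<bar> \<le> C) \<and>
     (\<forall>x\<in>mspace D. \<forall>y\<in>mspace D. \<bar>H x - H y\<bar> \<le> m * mdist D x y)"

lemma bounded_lipschitz_continuous_map:
  assumes "bounded_lipschitz D C m H"
  shows "continuous_map (mtopology_of D) euclideanreal H"
proof -
  have "Lipschitz_continuous_map D euclidean_metric H"
    using assms unfolding Lipschitz_continuous_map_def bounded_lipschitz_def
    by (auto simp: dist_real_def)
  from Lipschitz_continuous_imp_continuous_map[OF this] show ?thesis by simp
qed

lemma bounded_lipschitz_minus:
  "bounded_lipschitz D C m H \<Longrightarrow> bounded_lipschitz D C m (\<lambda>x. - H x)"
  unfolding bounded_lipschitz_def by (auto simp: abs_minus_commute)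

text \<open>The witnesses are the infimal convolutions of \<open>H\<close> with \<open>m\<close> times the metric.  Points at a
  distance above \<open>\<delta>\<close> are irrelevant for the infimum as soon as \<open>m \<delta> > 2 C\<close>, and at smaller distances
  continuity takes over.\<close>

lemma bounded_lipschitz_minorants:
  assumes cont: "continuous_map (mtopology_of D) euclideanreal H"
    and bnd: "\<And>x. x \<in> mspace D \<Longrightarrow> \<bar>H x\<bar> \<le> C"
  obtains Hm :: "nat \<Rightarrow> 'b \<Rightarrow> real" where
    "\<And>m. bounded_lipschitz D C m (Hm m)"
    "\<And>m x. x \<in> mspace D \<Longrightarrow> Hm m x \<le> H x"
    "\<And>x. x \<in> mspace D \<Longrightarrow> (\<lambda>m. Hm m x) \<longlonglongrightarrow> H x"
proof -
  interpret D: Metric_space "mspace D" "mdist D" by simp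
  define Hm where "Hm m x = (INF y\<in>mspace D. H y + real m * mdist D x y)" for m x
  have bdd: "bdd_below ((\<lambda>y. H y + real m * mdist D x y) ` mspace D)" for m x
    using bnd by (auto intro!: bdd_belowI2[of _ "-C"] simp: abs_le_iff intro: add_increasing2)
      (smt (verit, best) D.nonneg bnd mult_nonneg_nonneg of_nat_0_le_iff)
  have le: "Hm m x \<le> H y + real m * mdist D x y" if "y \<in> mspace D" for m x y
    unfolding Hm_def by (rule cINF_lower[OF bdd that])
  have ge: "a \<le> Hm m x" if "x \<in> mspace D" "\<And>y. y \<in> mspace D \<Longrightarrow> a \<le> H y + real m * mdist D x y"
    for a m x
    unfolding Hm_def using that by (intro cINF_greatest) auto
  have leH: "Hm m x \<le> H x" if "x \<in> mspace D" for m x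
    using le[OF that, of m x] that by simp
  have geC: "- C \<le> Hm m x" if x: "x \<in> mspace D" for m x
  proof (rule ge[OF x])
    fix y assume "y \<in> mspace D"
    with bnd[of y] show "- C \<le> H y + real m * mdist D x y"
      by (smt (verit, best) D.nonneg mult_nonneg_nonneg of_nat_0_le_iff)
  qed
  have lip1: "Hm m x \<le> Hm m y + real m * mdist D x y"
    if x: "x \<in> mspace D" and y: "y \<in> mspace D" for m x y
  proof -
    have "Hm m x - real m * mdist D x y \<le> Hm m y"
    proof (rule ge[OF y])
      fix u assume u: "u \<in> mspace D"
      have "real m * mdist D x u \<le> real m * (mdist D x y + mdist D y u)"
        using x y u by (intro mult_left_mono D.triangle) auto
      with le[OF u, of m x] show "Hm m x - real m * mdist D x y \<le> H u + real m * mdist D y u"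
        by (simp add: algebra_simps)
    qed
    then show ?thesis by simp
  qed
  have bl: "bounded_lipschitz D C m (Hm m)" for m :: nat
    unfolding bounded_lipschitz_def
  proof (intro conjI ballI)
    fix x assume "x \<in> mspace D"
    then show "\<bar>Hm m x\<bar> \<le> C" using leH[of x m] geC[of x m] bnd[of x] by linarith
  next
    fix x y assume "x \<in> mspace D" "y \<in> mspace D"
    then show "\<bar>Hm m x - Hm m y\<bar> \<le> m * mdist D x y"
      using lip1[of x y m] lip1[of y x m] by (simp add: abs_le_iff D.commute)
  qed simp
  have lim: "(\<lambda>m. Hm m x) \<longlonglongrightarrow> H x" if x: "x \<in> mspace D" for x
  proof (rule LIMSEQ_I)
    fix e :: real assume e: "e > 0"
    have "openin (mtopology_of D) {y \<in> topspace (mtopology_of D). H y \<in> {H x - e/2<..}}"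
      by (rule openin_continuous_map_preimage[OF cont]) simp
    then obtain \<delta> where d: "\<delta> > 0" and sub: "D.mball x \<delta> \<subseteq> {y \<in> mspace D. H y > H x - e/2}"
      using x e unfolding mtopology_of_def D.openin_mtopology by auto
    obtain m0 :: nat where m0: "2 * C / \<delta> < real m0" using reals_Archimedean2 by blast
    have C0: "C \<ge> 0" using bnd[OF x] by linarith
    show "\<exists>no. \<forall>m\<ge>no. norm (Hm m x - H x) < e"
    proof (intro exI allI impI)
      fix m assume m: "m \<ge> m0"
      have "H x - e/2 \<le> Hm m x"
      proof (rule ge[OF x])
        fix y assume y: "y \<in> mspace D"
        show "H x - e/2 \<le> H y + real m * mdist D x y"
        proof (cases "mdist D x y < \<delta>")
          case True
          then have "y \<in> D.mball x \<delta>" using x y by (simp add: D.in_mball)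
          then have "H y > H x - e/2" using sub by auto
          then show ?thesis using D.nonneg[of x y] by (smt (verit) mult_nonneg_nonneg of_nat_0_le_iff)
        next
          case False
          have "2 * C \<le> real m0 * \<delta>" using m0 d by (simp add: field_simps)
          also have "\<dots> \<le> real m * mdist D x y"
            using m False d by (intro mult_mono) auto
          finally show ?thesis using bnd[OF x] bnd[OF y] e by linarith
        qed
      qed
      then show "norm (Hm m x - H x) < e" using leH[OF x, of m] e by simp
    qed
  qed
  show ?thesis using that[of Hm] bl leH lim by blast
qed

lemma continuous_map_borel_sigma_measurable:
  assumes L: "sets L = sets (borel_sigma D)"
    and cont: "continuous_map (mtopology_of D) euclideanreal H"
  shows "H \<in> borel_measurable L"
proof (rule borel_measurableI)
  have sub: "{U. openin (mtopology_of D) U} \<subseteq> Pow (mspace D)"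
    using openin_subset by fastforce
  have sp: "space L = mspace D"
    using sets_eq_imp_space_eq[OF L] sub by (simp add: borel_sigma_def space_measure_of)
  fix S :: "real set" assume "open S"
  then have "openin (mtopology_of D) {x \<in> topspace (mtopology_of D). H x \<in> S}"
    by (intro openin_continuous_map_preimage[OF cont]) simp
  moreover have "{x \<in> topspace (mtopology_of D). H x \<in> S} = H -` S \<inter> space L"
    by (auto simp: sp)
  ultimately show "H -` S \<inter> space L \<in> sets L"
    unfolding L borel_sigma_def using sub by (simp add: sets_measure_of)
qed

text \<open>Lipschitz minorants and majorants of a bounded continuous function squeeze its outer
  expectations; since their integrals against the limit law converge to that of the function, the
  outer expectations converge too.\<close>

lemma HJ_weakly_converges_lipschitzI:
  assumes M: "prob_space M" and L: "prob_space L" "sets L = sets (borel_sigma D)" "space L = mspace D"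
    and X: "\<forall>\<^sub>F n in sequentially. \<forall>\<omega>\<in>space M. X n \<omega> \<in> mspace D"
    and lip: "\<And>H C m. bounded_lipschitz D C m H \<Longrightarrow>
      (\<lambda>n. outer_expectation M (\<lambda>\<omega>. H (X n \<omega>))) \<longlonglongrightarrow> (\<integral>x. H x \<partial>L)"
  shows "HJ_weakly_converges M X D L"
  unfolding HJ_weakly_converges_def
proof (intro conjI allI impI)
  interpret L: prob_space L by fact
  fix H assume "continuous_map (mtopology_of D) euclideanreal H \<and> bounded (H ` mspace D)"
  then have cont: "continuous_map (mtopology_of D) euclideanreal H" and "bounded (H ` mspace D)" by auto
  then obtain C where C: "\<And>x. x \<in> mspace D \<Longrightarrow> \<bar>H x\<bar> \<le> C" by (auto simp: bounded_iff)
  from bounded_lipschitz_minorants[OF cont C] obtain Hm where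
    Hm: "\<And>m. bounded_lipschitz D C (real m) (Hm m)" "\<And>m x. x \<in> mspace D \<Longrightarrow> Hm m x \<le> H x"
      "\<And>x. x \<in> mspace D \<Longrightarrow> (\<lambda>m. Hm m x) \<longlonglongrightarrow> H x" by blast
  have cont': "continuous_map (mtopology_of D) euclideanreal (\<lambda>x. - H x)"
    using continuous_map_minus[OF cont] .
  have "\<And>x. x \<in> mspace D \<Longrightarrow> \<bar>- H x\<bar> \<le> C" using C by simp
  from bounded_lipschitz_minorants[OF cont' this] obtain Km where
    Km: "\<And>m. bounded_lipschitz D C (real m) (Km m)" "\<And>m x. x \<in> mspace D \<Longrightarrow> Km m x \<le> - H x"
      "\<And>x. x \<in> mspace D \<Longrightarrow> (\<lambda>m. Km m x) \<longlonglongrightarrow> - H x" by blast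
  have meas: "G \<in> borel_measurable L" if "bounded_lipschitz D C' m G" for G C' m
    by (rule continuous_map_borel_sigma_measurable[OF L(2) bounded_lipschitz_continuous_map[OF that]])
  have Hmeas: "H \<in> borel_measurable L" by (rule continuous_map_borel_sigma_measurable[OF L(2) cont])
  have limH: "(\<lambda>m. \<integral>x. Hm m x \<partial>L) \<longlonglongrightarrow> (\<integral>x. H x \<partial>L)"
    by (rule integral_dominated_convergence[where w="\<lambda>_. C"])
      (use Hm meas[OF Hm(1)] Hmeas L(3) in \<open>auto simp: bounded_lipschitz_def\<close>)
  have limK: "(\<lambda>m. \<integral>x. - Km m x \<partial>L) \<longlonglongrightarrow> (\<integral>x. H x \<partial>L)"
  proof (rule integral_dominated_convergence[where w="\<lambda>_. C"])
    show "AE x in L. (\<lambda>m. - Km m x) \<longlonglongrightarrow> H x"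
      using tendsto_minus[OF Km(3)] L(3) by auto
  qed (use Km meas[OF Km(1)] Hmeas L(3) in \<open>auto simp: bounded_lipschitz_def\<close>)
  show "(\<lambda>n. outer_expectation M (\<lambda>\<omega>. H (X n \<omega>))) \<longlonglongrightarrow> (\<integral>x. H x \<partial>L)"
  proof (rule order_tendstoI)
    fix a assume "a < (\<integral>x. H x \<partial>L)"
    then obtain m where m: "a < (\<integral>x. Hm m x \<partial>L)"
      using order_tendstoD(1)[OF limH] by (auto simp: eventually_sequentially)
    have "\<forall>\<^sub>F n in sequentially. a < outer_expectation M (\<lambda>\<omega>. Hm m (X n \<omega>))"
      by (rule order_tendstoD(1)[OF lip[OF Hm(1)] m])
    with X show "\<forall>\<^sub>F n in sequentially. a < outer_expectation M (\<lambda>\<omega>. H (X n \<omega>))"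
    proof eventually_elim
      case (elim n)
      have "outer_expectation M (\<lambda>\<omega>. Hm m (X n \<omega>)) \<le> outer_expectation M (\<lambda>\<omega>. H (X n \<omega>))"
        using elim C Hm(1)[of m] Hm(2) 
        by (intro outer_expectation_mono[OF M, where c="-C" and c'=C])
          (fastforce simp: bounded_lipschitz_def abs_le_iff)+
      then show ?case using elim by simp
    qed
  next
    fix a assume "(\<integral>x. H x \<partial>L) < a"
    then obtain m where m: "(\<integral>x. - Km m x \<partial>L) < a"
      using order_tendstoD(2)[OF limK] by (auto simp: eventually_sequentially)
    have "\<forall>\<^sub>F n in sequentially. outer_expectation M (\<lambda>\<omega>. - Km m (X n \<omega>)) < a"
      by (rule order_tendstoD(2)[OF lip[OF bounded_lipschitz_minus[OF Km(1)]] m])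
    with X show "\<forall>\<^sub>F n in sequentially. outer_expectation M (\<lambda>\<omega>. H (X n \<omega>)) < a"
    proof eventually_elim
      case (elim n)
      have le: "H x \<le> - Km m x" if "x \<in> mspace D" for x using Km(2)[OF that, of m] by simp
      have "outer_expectation M (\<lambda>\<omega>. H (X n \<omega>)) \<le> outer_expectation M (\<lambda>\<omega>. - Km m (X n \<omega>))"
        using elim C Km(1)[of m] le
        by (intro outer_expectation_mono[OF M, where c="-C" and c'=C])
          (fastforce simp: bounded_lipschitz_def abs_le_iff)+
      then show ?case using elim by simp
    qed
  qed
qed (fact X)

subsection \<open>The space of bounded functions\<close>

lemma mspace_linfty_iff:
  "x \<in> mspace (linfty F) \<longleftrightarrow> x \<in> extensional F \<and> (\<exists>B. \<forall>f\<in>F. \<bar>x f\<bar> \<le> B)"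
proof -
  have "Met_TC.mbounded (x ` F) \<longleftrightarrow> (\<exists>B. \<forall>f\<in>F. \<bar>x f\<bar> \<le> B)"
    by (simp add: bounded_iff)
  then show ?thesis by (simp add: Met_TC.fspace_def)
qed

lemma mdist_linfty_le_iff:
  assumes "x \<in> mspace (linfty F)" "y \<in> mspace (linfty F)" "F \<noteq> {}"
  shows "mdist (linfty F) x y \<le> a \<longleftrightarrow> (\<forall>f\<in>F. \<bar>x f - y f\<bar> \<le> a)"
  using funspace_mdist_le[OF assms] by (simp add: dist_real_def)

lemma mdist_linfty_upper:
  assumes "x \<in> mspace (linfty F)" "y \<in> mspace (linfty F)" "f \<in> F"
  shows "\<bar>x f - y f\<bar> \<le> mdist (linfty F) x y"
  using mdist_linfty_le_iff[OF assms(1,2), of "mdist (linfty F) x y"] assms(3) by auto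

section \<open>Convergence of finite-dimensional marginals\<close>

text \<open>Functions whose expectations are determined by the characteristic functions of linear
  combinations.  The product formula for cosines makes them an algebra, in spite of the linear
  generation.\<close>

inductive trig_poly :: "nat \<Rightarrow> ((nat \<Rightarrow> real) \<Rightarrow> real) \<Rightarrow> bool" for N where
  wave: "trig_poly N (\<lambda>x. cos ((\<Sum>i<N. c i * x i) + b))"
| scale: "trig_poly N T \<Longrightarrow> trig_poly N (\<lambda>x. a * T x)"
| add: "trig_poly N S \<Longrightarrow> trig_poly N T \<Longrightarrow> trig_poly N (\<lambda>x. S x + T x)"

inductive coord_poly :: "nat \<Rightarrow> ((nat \<Rightarrow> real) \<Rightarrow> real) \<Rightarrow> bool" for N where
  const: "coord_poly N (\<lambda>x. a)"
| coord: "i < N \<Longrightarrow> coord_poly N (\<lambda>x. x i)"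
| add: "coord_poly N S \<Longrightarrow> coord_poly N T \<Longrightarrow> coord_poly N (\<lambda>x. S x + T x)"
| mult: "coord_poly N S \<Longrightarrow> coord_poly N T \<Longrightarrow> coord_poly N (\<lambda>x. S x * T x)"

lemma trig_poly_mult:
  assumes "trig_poly N S" "trig_poly N T"
  shows "trig_poly N (\<lambda>x. S x * T x)"
  using assms(1)
proof induction
  case (wave c b)
  show ?case using assms(2)
  proof induction
    case (wave c' b')
    have eq: "cos (u + b) * cos (v + b') = 1/2 * cos ((u - v) + (b - b')) + 1/2 * cos ((u + v) + (b + b'))"
      for u v :: real
      unfolding cos_times_cos by (simp add: field_simps)
    have "trig_poly N (\<lambda>x. 1/2 * cos ((\<Sum>i<N. (c i - c' i) * x i) + (b - b'))
        + 1/2 * cos ((\<Sum>i<N. (c i + c' i) * x i) + (b + b')))"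
      by (intro trig_poly.intros)
    then show ?case
      unfolding eq by (simp add: algebra_simps sum.distrib sum_subtractf)
  next
    case (scale T a)
    from trig_poly.scale[OF scale.IH, of a] show ?case by (simp add: algebra_simps)
  next
    case (add S T)
    from trig_poly.add[OF add.IH] show ?case by (simp add: algebra_simps)
  qed
next
  case (scale S a)
  from trig_poly.scale[OF scale.IH, of a] show ?case by (simp add: algebra_simps)
next
  case (add S S')
  from trig_poly.add[OF add.IH] show ?case by (simp add: algebra_simps)
qed

lemma trig_poly_sin:
  assumes "coord_poly N P"
  shows "trig_poly N (\<lambda>x. P (\<lambda>i. if i < N then sin (\<alpha> * x i) else 0))"
  using assms
proof induction
  case (const a)
  from trig_poly.scale[OF trig_poly.wave[of N "\<lambda>_. 0" 0], of a] show ?case by simp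
next
  case (coord j)
  have "sin (\<alpha> * x j) = cos ((\<Sum>i<N. (if i = j then \<alpha> else 0) * x i) + (- pi/2))" for x :: "nat \<Rightarrow> real"
  proof -
    have "(\<Sum>i<N. (if i = j then \<alpha> else 0) * x i) = (\<Sum>i<N. if i = j then \<alpha> * x i else 0)"
      by (intro sum.cong) auto
    then show ?thesis using coord by (simp add: cos_diff)
  qed
  then show ?case using coord trig_poly.wave[of N "\<lambda>i. if i = j then \<alpha> else 0" "- pi/2"] by simp
qed (auto intro: trig_poly.add trig_poly_mult)

text \<open>Such a function ignores the coordinates from \<open>N\<close> on.  Sequences stand for vectors here because
  the number of coordinates varies within proofs, which excludes a type-indexed dimension.\<close>

definition lipschitz_coords :: "nat \<Rightarrow> real \<Rightarrow> ((nat \<Rightarrow> real) \<Rightarrow> real) \<Rightarrow> bool" where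
  "lipschitz_coords N m G \<longleftrightarrow> (\<forall>x y. \<bar>G x - G y\<bar> \<le> m * (\<Sum>i<N. \<bar>x i - y i\<bar>))"

lemma lipschitz_coords_continuous:
  assumes "lipschitz_coords N m G"
  shows "continuous_on A G"
  unfolding continuous_on_def
proof (intro ballI)
  fix x assume "x \<in> A"
  have c: "((\<lambda>y. y i) \<longlongrightarrow> x i) (at x within A)" for i
    using continuous_on_subset[OF continuous_on_product_coordinates[of i], of A] \<open>x \<in> A\<close>
    by (auto simp: continuous_on_def)
  have "((\<lambda>y. m * (\<Sum>i<N. \<bar>y i - x i\<bar>)) \<longlongrightarrow> m * (\<Sum>i<N. \<bar>x i - x i\<bar>)) (at x within A)"
    by (intro tendsto_intros c)
  then have "((\<lambda>y. m * (\<Sum>i<N. \<bar>y i - x i\<bar>)) \<longlongrightarrow> 0) (at x within A)" by simp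
  then have "((\<lambda>y. G y - G x) \<longlongrightarrow> 0) (at x within A)"
    by (rule Lim_null_comparison[rotated]) (use assms in \<open>auto simp: lipschitz_coords_def\<close>)
  then show "(G \<longlongrightarrow> G x) (at x within A)" using LIM_zero_cancel by blast
qed

lemma lipschitz_coords_measurable:
  assumes "lipschitz_coords N m G" "\<And>i. V i \<in> borel_measurable M"
  shows "(\<lambda>\<omega>. G (\<lambda>i. V i \<omega>)) \<in> borel_measurable M"
proof -
  have "G \<in> borel_measurable borel"
    using lipschitz_coords_continuous[OF assms(1)] by (rule borel_measurable_continuous_onI)
  moreover have "(\<lambda>\<omega>. \<lambda>i. V i \<omega>) \<in> measurable M borel"
    by (rule measurable_coordinatewise_then_product) (use assms in auto)
  ultimately show ?thesis using measurable_compose by blast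
qed

text \<open>A polynomial in the \<open>sin (\<alpha> x\<^sub>i)\<close> is bounded on the whole space by its bound on the cube
  \<open>[-1,1]\<^sup>N\<close>, whatever happens outside the region where the sine is injective.  The
  approximation is therefore good on a large cube and harmless outside of it, where second
  moments take over.\<close>

lemma trig_poly_approximation:
  assumes lip: "lipschitz_coords N m G" and bnd: "\<And>x. \<bar>G x\<bar> \<le> C"
    and R: "R > 0" and e: "e > 0"
  obtains T where "trig_poly N T"
    "\<And>x. \<bar>G x - T x\<bar> \<le> e + (2 * C + e) * (\<Sum>i<N. (x i)\<^sup>2 / R\<^sup>2)"
proof -
  \<comment> \<open>the sine of \<open>\<alpha> x\<close> is injective exactly on the interval from \<open>- R\<close> to \<open>R\<close>\<close>
  define \<alpha> where "\<alpha> = pi / (2 * R)"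
  have \<alpha>: "\<alpha> > 0" using R by (simp add: \<alpha>_def)
  define K where "K = {s::nat \<Rightarrow> real. \<forall>i. s i \<in> (if i < N then {-1..1} else {0})}"
  have "compactin (product_topology (\<lambda>i. euclidean) UNIV) (PiE UNIV (\<lambda>i::nat. if i < N then {-1..1::real} else {0}))"
    by (subst compactin_PiE) auto
  then have K: "compact K"
    unfolding euclidean_product_topology K_def PiE_UNIV_domain by (simp add: Pi_def)
  let ?G = "\<lambda>s. G (\<lambda>i. arcsin (s i) / \<alpha>)"
  have contG: "continuous_on UNIV G" by (rule lipschitz_coords_continuous[OF lip])
  have "continuous_on K (\<lambda>s i. arcsin (s i) / \<alpha>)"
  proof (rule continuous_on_coordinatewise_then_product)
    fix i
    have "continuous_on K (\<lambda>s. arcsin (s i))"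
    proof (rule continuous_on_arcsin)
      show "continuous_on K (\<lambda>s. s i)"
        by (rule continuous_on_subset[OF continuous_on_product_coordinates]) simp
      show "\<forall>x\<in>K. - 1 \<le> x i \<and> x i \<le> 1" by (auto simp: K_def split: if_splits) (metis order_refl zero_le_one le_minus_one_simps(1))+
    qed
    then show "continuous_on K (\<lambda>s. arcsin (s i) / \<alpha>)"
      by (rule continuous_on_divide) (use \<alpha> in \<open>auto intro: continuous_on_const\<close>)
  qed
  then have cG: "continuous_on K ?G"
    by (intro continuous_on_compose2[OF contG]) auto
  have "\<exists>P. coord_poly N P \<and> (\<forall>s\<in>K. \<bar>?G s - P s\<bar> < e)"
  proof (rule Stone_Weierstrass_HOL[OF K, where P="coord_poly N"])
    show "continuous_on K f" if "coord_poly N f" for f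
      using that by induction (auto intro!: continuous_intros
          intro: continuous_on_subset[OF continuous_on_product_coordinates])
    show "\<exists>f. coord_poly N f \<and> f x \<noteq> f y" if "x \<in> K \<and> y \<in> K \<and> x \<noteq> y" for x y
    proof -
      from that obtain i where "x i \<noteq> y i" by auto
      moreover have "i < N"
      proof (rule ccontr)
        assume "\<not> i < N"
        then have "x i = 0" "y i = 0" using that by (auto simp: K_def dest!: spec[of _ i])
        then show False using \<open>x i \<noteq> y i\<close> by simp
      qed
      ultimately show ?thesis using coord_poly.coord by blast
    qed
  qed (use e cG in \<open>auto intro: coord_poly.intros\<close>)
  then obtain P where P: "coord_poly N P" "\<And>s. s \<in> K \<Longrightarrow> \<bar>?G s - P s\<bar> < e" by blast
  define \<sigma> where "\<sigma> x = (\<lambda>i. if i < N then sin (\<alpha> * x i) else 0)" for x :: "nat \<Rightarrow> real"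
  have \<sigma>K: "\<sigma> x \<in> K" for x by (auto simp: \<sigma>_def K_def)
  show ?thesis
  proof (rule that[of "\<lambda>x. P (\<sigma> x)"])
    show "trig_poly N (\<lambda>x. P (\<sigma> x))" unfolding \<sigma>_def by (rule trig_poly_sin[OF P(1)])
    fix x
    have C0: "C \<ge> 0" using bnd[of x] by linarith
    have nn: "(2 * C + e) * (\<Sum>i<N. (x i)\<^sup>2 / R\<^sup>2) \<ge> 0"
      using C0 e by (intro mult_nonneg_nonneg sum_nonneg) auto
    show "\<bar>G x - P (\<sigma> x)\<bar> \<le> e + (2 * C + e) * (\<Sum>i<N. (x i)\<^sup>2 / R\<^sup>2)"
    proof (cases "\<forall>i<N. \<bar>x i\<bar> \<le> R")
      case True
      have "arcsin (\<sigma> x i) / \<alpha> = x i" if i: "i < N" for i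
      proof -
        have x: "- R \<le> x i" "x i \<le> R" using True i by (auto simp: abs_le_iff)
        have "\<alpha> * (- R) \<le> \<alpha> * x i" "\<alpha> * x i \<le> \<alpha> * R" using x \<alpha> by (intro mult_left_mono; simp)+
        moreover have "\<alpha> * R = pi / 2" using R by (simp add: \<alpha>_def)
        ultimately have "arcsin (sin (\<alpha> * x i)) = \<alpha> * x i" by (intro arcsin_sin) auto
        then show ?thesis using i \<alpha> by (simp add: \<sigma>_def)
      qed
      then have "\<bar>?G (\<sigma> x) - G x\<bar> \<le> m * (\<Sum>i<N. 0)"
        using lip[unfolded lipschitz_coords_def, rule_format, of "\<lambda>i. arcsin (\<sigma> x i) / \<alpha>" x] by simp
      then have "?G (\<sigma> x) = G x" by simp
      then show ?thesis using P(2)[OF \<sigma>K, of x] nn by simp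
    next
      case False
      then obtain j where j: "j < N" "R < \<bar>x j\<bar>" by auto
      have "R\<^sup>2 \<le> (x j)\<^sup>2" using j R by (metis abs_le_square_iff abs_of_pos less_imp_le)
      then have "1 \<le> (x j)\<^sup>2 / R\<^sup>2" using R by simp
      also have "\<dots> \<le> (\<Sum>i<N. (x i)\<^sup>2 / R\<^sup>2)" using j by (intro member_le_sum) auto
      finally have "(2 * C + e) * 1 \<le> (2 * C + e) * (\<Sum>i<N. (x i)\<^sup>2 / R\<^sup>2)"
        using C0 e by (intro mult_left_mono) auto
      then have "2 * C + e \<le> e + (2 * C + e) * (\<Sum>i<N. (x i)\<^sup>2 / R\<^sup>2)" using e by simp
      moreover have "\<bar>G x - P (\<sigma> x)\<bar> \<le> 2 * C + e"
        using P(2)[OF \<sigma>K, of x] bnd[of x] bnd[of "\<lambda>i. arcsin (\<sigma> x i) / \<alpha>"] by linarith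
      ultimately show ?thesis by (rule order_trans[rotated])
    qed
  qed
qed

lemma trig_poly_bounded_measurable:
  assumes "trig_poly N T" and V: "\<And>i. V i \<in> borel_measurable M"
  shows "(\<lambda>\<omega>. T (\<lambda>i. V i \<omega>)) \<in> borel_measurable M \<and> (\<exists>B. \<forall>x. \<bar>T x\<bar> \<le> B)"
  using assms(1)
proof induction
  case (wave c b)
  show ?case using V by (auto intro!: exI[of _ 1])
next
  case (scale T a)
  then obtain B where B: "\<And>x. \<bar>T x\<bar> \<le> B" by auto
  have "\<bar>a * T x\<bar> \<le> \<bar>a\<bar> * B" for x using B by (simp add: abs_mult mult_left_mono)
  then show ?case using scale by auto
next
  case (add S T)
  then obtain B B' where B: "\<And>x. \<bar>S x\<bar> \<le> B" "\<And>x. \<bar>T x\<bar> \<le> B'" by auto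
  have "\<bar>S x + T x\<bar> \<le> B + B'" for x using B[of x] by (smt (verit))
  then show ?case using add by auto
qed

lemma (in prob_space) trig_poly_integrable:
  assumes "trig_poly N T" and V: "\<And>i. V i \<in> borel_measurable M"
  shows "integrable M (\<lambda>\<omega>. T (\<lambda>i. V i \<omega>))"
proof -
  from trig_poly_bounded_measurable[where T=T and V=V, OF assms] obtain B where
    "(\<lambda>\<omega>. T (\<lambda>i. V i \<omega>)) \<in> borel_measurable M" "\<And>x. \<bar>T x\<bar> \<le> B" by auto
  then show ?thesis by (intro integrable_const_bound[where B=B]) auto
qed

lemma (in prob_space) integral_trig_approximation:
  fixes B :: real
  assumes lip: "lipschitz_coords N m G" and bnd: "\<And>x. \<bar>G x\<bar> \<le> C"
    and T: "trig_poly N T" and V: "\<And>i. V i \<in> borel_measurable M"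
    and app: "\<And>x. \<bar>G x - T x\<bar> \<le> e + K * (\<Sum>i<N. (x i)\<^sup>2 / R\<^sup>2)" and K: "K \<ge> 0"
    and mom: "\<And>i. i < N \<Longrightarrow> integrable M (\<lambda>\<omega>. (V i \<omega>)\<^sup>2)"
      "\<And>i. i < N \<Longrightarrow> expectation (\<lambda>\<omega>. (V i \<omega>)\<^sup>2) \<le> B"
  shows "\<bar>expectation (\<lambda>\<omega>. G (\<lambda>i. V i \<omega>)) - expectation (\<lambda>\<omega>. T (\<lambda>i. V i \<omega>))\<bar> \<le> e + K * (N * B / R\<^sup>2)"
proof -
  have iG: "integrable M (\<lambda>\<omega>. G (\<lambda>i. V i \<omega>))"
    using lipschitz_coords_measurable[where V=V, OF lip V] bnd
    by (intro integrable_const_bound[where B=C]) auto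
  have iT: "integrable M (\<lambda>\<omega>. T (\<lambda>i. V i \<omega>))" by (rule trig_poly_integrable[where V=V, OF T V])
  have "\<bar>expectation (\<lambda>\<omega>. G (\<lambda>i. V i \<omega>)) - expectation (\<lambda>\<omega>. T (\<lambda>i. V i \<omega>))\<bar>
      = \<bar>expectation (\<lambda>\<omega>. G (\<lambda>i. V i \<omega>) - T (\<lambda>i. V i \<omega>))\<bar>" using iG iT by simp
  also have "\<dots> \<le> expectation (\<lambda>\<omega>. \<bar>G (\<lambda>i. V i \<omega>) - T (\<lambda>i. V i \<omega>)\<bar>)"
    by (rule integral_abs_bound)
  also have "\<dots> \<le> expectation (\<lambda>\<omega>. e + K * (\<Sum>i<N. (V i \<omega>)\<^sup>2 / R\<^sup>2))"
    using iG iT mom app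
    by (intro integral_mono integrable_abs Bochner_Integration.integrable_diff
        Bochner_Integration.integrable_add integrable_mult_right Bochner_Integration.integrable_sum) auto
  also have "\<dots> = e + K * (\<Sum>i<N. expectation (\<lambda>\<omega>. (V i \<omega>)\<^sup>2) / R\<^sup>2)"
  proof -
    have I: "integrable M (\<lambda>\<omega>. \<Sum>i<N. (V i \<omega>)\<^sup>2 / R\<^sup>2)"
      using mom by (intro Bochner_Integration.integrable_sum) auto
    have "expectation (\<lambda>\<omega>. \<Sum>i<N. (V i \<omega>)\<^sup>2 / R\<^sup>2) = (\<Sum>i<N. expectation (\<lambda>\<omega>. (V i \<omega>)\<^sup>2) / R\<^sup>2)"
      using mom by (subst Bochner_Integration.integral_sum) auto
    then show ?thesis using I by (simp add: prob_space)
  qed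
  also have "\<dots> \<le> e + K * (\<Sum>i<N. B / R\<^sup>2)"
    using mom K by (intro add_left_mono mult_left_mono sum_mono divide_right_mono) auto
  finally show ?thesis by simp
qed

text \<open>A form of the Cramer-Wold device.  Bounded second moments supply the tightness, so that
  trigonometric polynomials, for which the convergence is assumed, can replace \<open>G\<close> up to a uniformly
  small error.\<close>

lemma fidi_convergence:
  fixes V :: "nat \<Rightarrow> nat \<Rightarrow> 'w \<Rightarrow> real" and W :: "nat \<Rightarrow> 'v \<Rightarrow> real"
  assumes M: "prob_space M" and L: "prob_space L"
    and V: "\<And>n i. V n i \<in> borel_measurable M" and W: "\<And>i. W i \<in> borel_measurable L"
    and cos: "\<And>c b. (\<lambda>n. \<integral>\<omega>. cos ((\<Sum>i<N. c i * V n i \<omega>) + b) \<partial>M)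
        \<longlonglongrightarrow> (\<integral>w. cos ((\<Sum>i<N. c i * W i w) + b) \<partial>L)"
    and momV: "\<forall>\<^sub>F n in sequentially. \<forall>i<N. integrable M (\<lambda>\<omega>. (V n i \<omega>)\<^sup>2) \<and> (\<integral>\<omega>. (V n i \<omega>)\<^sup>2 \<partial>M) \<le> B"
    and momW: "\<forall>i<N. integrable L (\<lambda>w. (W i w)\<^sup>2) \<and> (\<integral>w. (W i w)\<^sup>2 \<partial>L) \<le> B"
    and lip: "lipschitz_coords N m G" and bnd: "\<And>x. \<bar>G x\<bar> \<le> C"
  shows "(\<lambda>n. \<integral>\<omega>. G (\<lambda>i. V n i \<omega>) \<partial>M) \<longlonglongrightarrow> (\<integral>w. G (\<lambda>i. W i w) \<partial>L)"
proof (rule tendstoI)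
  interpret M: prob_space M by fact
  interpret L: prob_space L by fact
  fix e0 :: real assume e0: "e0 > 0"
  define e where "e = e0 / 6"
  have e: "e > 0" using e0 by (simp add: e_def)
  have C0: "C \<ge> 0" using bnd[of undefined] by linarith
  \<comment> \<open>by Chebyshev, the mass outside the cube of radius \<open>R\<close> is at most \<open>N B / R\<^sup>2\<close>\<close>
  define R where "R = sqrt ((2 * C + e) * N * \<bar>B\<bar> / e + 1)"
  have R: "R > 0" "R\<^sup>2 = (2 * C + e) * N * \<bar>B\<bar> / e + 1"
    using C0 e unfolding R_def by (auto intro!: add_nonneg_pos)
  have KB: "(2 * C + e) * (N * B / R\<^sup>2) \<le> e"
  proof -
    have "(2 * C + e) * (N * B) \<le> (2 * C + e) * (N * \<bar>B\<bar>)"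
      using C0 e by (intro mult_left_mono) auto
    also have "\<dots> \<le> e * R\<^sup>2" unfolding R(2) using e by (simp add: field_simps)
    finally show ?thesis using R(1) by (simp add: field_simps)
  qed
  from trig_poly_approximation[OF lip bnd R(1) e] obtain T where T: "trig_poly N T"
    "\<And>x. \<bar>G x - T x\<bar> \<le> e + (2 * C + e) * (\<Sum>i<N. (x i)\<^sup>2 / R\<^sup>2)" by blast
  have convT: "(\<lambda>n. \<integral>\<omega>. T (\<lambda>i. V n i \<omega>) \<partial>M) \<longlonglongrightarrow> (\<integral>w. T (\<lambda>i. W i w) \<partial>L)"
    using T(1)
  proof induction
    case (wave c b)
    then show ?case using cos by simp
  next
    case (scale T a)
    then show ?case by (auto intro!: tendsto_intros)
  next
    case (add S T)
    have "integrable M (\<lambda>\<omega>. S (\<lambda>i. V n i \<omega>))" "integrable M (\<lambda>\<omega>. T (\<lambda>i. V n i \<omega>))" for n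
      using add.hyps by (auto intro!: M.trig_poly_integrable[where V="V n"] V)
    moreover have "integrable L (\<lambda>\<omega>. S (\<lambda>i. W i \<omega>))" "integrable L (\<lambda>\<omega>. T (\<lambda>i. W i \<omega>))"
      using add.hyps by (auto intro!: L.trig_poly_integrable[where V="W"] W)
    ultimately show ?case using tendsto_add[OF add.IH] by simp
  qed
  have K0: "2 * C + e \<ge> 0" using C0 e by simp
  have LW: "\<bar>(\<integral>w. G (\<lambda>i. W i w) \<partial>L) - (\<integral>w. T (\<lambda>i. W i w) \<partial>L)\<bar> \<le> 2 * e"
    using L.integral_trig_approximation[where V=W, OF lip bnd T(1) W T(2) K0, where B=B] momW KB by auto
  have "\<forall>\<^sub>F n in sequentially. dist (\<integral>\<omega>. T (\<lambda>i. V n i \<omega>) \<partial>M) (\<integral>w. T (\<lambda>i. W i w) \<partial>L) < e"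
    by (rule tendstoD[OF convT e])
  with momV show "\<forall>\<^sub>F n in sequentially. dist (\<integral>\<omega>. G (\<lambda>i. V n i \<omega>) \<partial>M) (\<integral>w. G (\<lambda>i. W i w) \<partial>L) < e0"
  proof eventually_elim
    case (elim n)
    have "\<bar>(\<integral>\<omega>. G (\<lambda>i. V n i \<omega>) \<partial>M) - (\<integral>\<omega>. T (\<lambda>i. V n i \<omega>) \<partial>M)\<bar> \<le> 2 * e"
      using M.integral_trig_approximation[where V="V n", OF lip bnd T(1) V T(2) K0, where B=B] elim KB by auto
    then show ?case using LW elim e0 unfolding e_def dist_real_def by linarith
  qed
qed

section \<open>Maximal inequalities\<close>

lemma exp_le_quadratic:
  fixes x :: real
  assumes "\<bar>x\<bar> \<le> 1"
  shows "exp x \<le> 1 + x + x\<^sup>2"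
proof (cases "x \<ge> 0")
  case True
  then show ?thesis using exp_bound[of x] assms by simp
next
  case False
  define y where "y = - x"
  have y: "0 \<le> y" using False by (simp add: y_def)
  have "1 * 1 \<le> (1 + y + y\<^sup>2/2) * (1 - y + y\<^sup>2)"
  proof -
    have "(1 + y + y\<^sup>2/2) * (1 - y + y\<^sup>2) = 1 + (y\<^sup>2/2 + y^3/2 + y^4/2)"
      by (simp add: field_simps power2_eq_square power3_eq_cube power4_eq_xxxx)
    moreover have "0 \<le> y\<^sup>2/2 + y^3/2 + y^4/2" using y by simp
    ultimately show ?thesis by simp
  qed
  also have "\<dots> \<le> exp y * (1 - y + y\<^sup>2)"
  proof (rule mult_right_mono)
    show "1 + y + y\<^sup>2/2 \<le> exp y" using exp_lower_Taylor_quadratic[OF y] by simp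
    show "0 \<le> 1 - y + y\<^sup>2" using sum_squares_ge_zero[of "y - 1/2" 0] by (simp add: power2_eq_square algebra_simps)
  qed
  finally have "exp (- y) * 1 \<le> exp (- y) * (exp y * (1 - y + y\<^sup>2))" by (intro mult_left_mono) auto
  then show ?thesis by (simp add: y_def mult.assoc[symmetric] exp_minus)
qed

text \<open>The maximum is compared with an exponential: \<open>s x \<le> a - 1 + exp (s x - a)\<close> for every \<open>a\<close>, and
  the maximum of the exponentials is at most their sum.  The hypothesis on the exponential moments is
  that of a Gaussian variable if \<open>\<beta> = 0\<close>; for \<open>\<beta> > 0\<close> it covers sums of bounded independent variables,
  as in Bernstein's inequality.\<close>

lemma (in prob_space) expectation_Max_abs_le:
  fixes X :: "'j \<Rightarrow> 'a \<Rightarrow> real"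
  assumes J: "finite J" "J \<noteq> {}" "real (card J) \<le> N"
    and X: "\<And>j. j \<in> J \<Longrightarrow> X j \<in> borel_measurable M"
    and V: "V > 0" and \<beta>: "\<beta> \<ge> 0"
    and mgf: "\<And>j s. j \<in> J \<Longrightarrow> \<bar>s\<bar> * \<beta> \<le> 1 \<Longrightarrow>
        integrable M (\<lambda>\<omega>. exp (s * X j \<omega>)) \<and> expectation (\<lambda>\<omega>. exp (s * X j \<omega>)) \<le> exp (s\<^sup>2 * V)"
  shows "integrable M (\<lambda>\<omega>. Max ((\<lambda>j. \<bar>X j \<omega>\<bar>) ` J))"
    and "expectation (\<lambda>\<omega>. Max ((\<lambda>j. \<bar>X j \<omega>\<bar>) ` J)) \<le> \<beta> * ln (2 * N) + 2 * sqrt V * sqrt (ln (2 * N))"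
proof -
  let ?M = "\<lambda>\<omega>. Max ((\<lambda>j. \<bar>X j \<omega>\<bar>) ` J)"
  have "card J \<ge> 1" using J by (simp add: Suc_le_eq card_gt_0_iff)
  then have N: "N \<ge> 1" using J by linarith
  define l where "l = sqrt (ln (2 * N))"
  have lnN: "ln (2 * N) > 0" using N by simp
  have l: "l > 0" "l\<^sup>2 = ln (2 * N)" using lnN by (auto simp: l_def)
  \<comment> \<open>the smaller, up to a factor, of \<open>1 / \<beta>\<close>, the limit of validity, and \<open>l / sqrt V\<close>, the Gaussian optimum\<close>
  define s where "s = 1 / (\<beta> + sqrt V / l)"
  have den: "\<beta> + sqrt V / l > 0" using V l \<beta> by (intro add_nonneg_pos) auto
  have s: "s > 0" using den by (simp add: s_def)
  have s\<beta>: "s * \<beta> \<le> 1" using den V l by (simp add: s_def divide_le_eq)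
  have sV: "s * V \<le> sqrt V * l"
  proof -
    have "s \<le> 1 / (sqrt V / l)" unfolding s_def using V l \<beta> den by (intro divide_left_mono mult_pos_pos) auto
    then have "s * V \<le> 1 / (sqrt V / l) * V" using V by (intro mult_right_mono) auto
    also have "\<dots> = sqrt V * l" using V by (simp add: field_simps real_sqrt_mult_self flip: power2_eq_square)
    finally show ?thesis .
  qed
  \<comment> \<open>chosen such that \<open>E Q \<le> exp a\<close>\<close>
  define a where "a = ln (2 * N) + s\<^sup>2 * V"
  define Q where "Q \<omega> = (\<Sum>j\<in>J. exp (s * X j \<omega>) + exp (- s * X j \<omega>))" for \<omega>
  have int: "integrable M (\<lambda>\<omega>. exp (s * X j \<omega>))" "integrable M (\<lambda>\<omega>. exp (- s * X j \<omega>))" if "j \<in> J" for j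
    using mgf[OF that, of s] mgf[OF that, of "-s"] s s\<beta> by auto
  have iQ: "integrable M Q" unfolding Q_def using int by (intro Bochner_Integration.integrable_sum Bochner_Integration.integrable_add) auto
  have "expectation Q = (\<Sum>j\<in>J. expectation (\<lambda>\<omega>. exp (s * X j \<omega>)) + expectation (\<lambda>\<omega>. exp (- s * X j \<omega>)))"
    unfolding Q_def using int by (subst Bochner_Integration.integral_sum) auto
  also have "\<dots> \<le> (\<Sum>j\<in>J. exp (s\<^sup>2 * V) + exp (s\<^sup>2 * V))"
  proof (intro sum_mono add_mono)
    fix j assume j: "j \<in> J"
    show "expectation (\<lambda>\<omega>. exp (s * X j \<omega>)) \<le> exp (s\<^sup>2 * V)" using mgf[OF j, of s] s s\<beta> by auto
    show "expectation (\<lambda>\<omega>. exp (- s * X j \<omega>)) \<le> exp (s\<^sup>2 * V)" using mgf[OF j, of "-s"] s s\<beta> by auto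
  qed
  also have "\<dots> \<le> N * (exp (s\<^sup>2 * V) + exp (s\<^sup>2 * V))" using J by (simp add: mult_right_mono)
  also have "\<dots> = exp a" using N by (simp add: a_def exp_add)
  finally have EQ: "expectation Q \<le> exp a" .
  have bound: "?M \<omega> \<le> (a - 1 + exp (- a) * Q \<omega>) / s" for \<omega>
  proof -
    have "?M \<omega> \<in> (\<lambda>j. \<bar>X j \<omega>\<bar>) ` J" using J by (intro Max_in) auto
    then obtain j where j: "j \<in> J" "?M \<omega> = \<bar>X j \<omega>\<bar>" by auto
    have "exp (s * \<bar>X j \<omega>\<bar>) \<le> exp (s * X j \<omega>) + exp (- s * X j \<omega>)"
      by (cases "X j \<omega> \<ge> 0") (auto simp: abs_if)
    also have "\<dots> \<le> Q \<omega>"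
      unfolding Q_def using J j by (intro member_le_sum[where f="\<lambda>j. exp (s * X j \<omega>) + exp (- s * X j \<omega>)"]) (auto intro: add_nonneg_nonneg)
    finally have "exp (- a) * exp (s * \<bar>X j \<omega>\<bar>) \<le> exp (- a) * Q \<omega>" by (intro mult_left_mono) auto
    moreover have "1 + (s * \<bar>X j \<omega>\<bar> - a) \<le> exp (s * \<bar>X j \<omega>\<bar> - a)" by (rule exp_ge_add_one_self)
    ultimately have "s * \<bar>X j \<omega>\<bar> \<le> a - 1 + exp (- a) * Q \<omega>" by (simp add: exp_diff exp_minus field_simps)
    then show ?thesis using s j by (simp add: field_simps)
  qed
  have nn: "0 \<le> ?M \<omega>" for \<omega>
  proof -
    obtain j where "j \<in> J" using J by auto
    then have "\<bar>X j \<omega>\<bar> \<le> ?M \<omega>" using J by (intro Max_ge) auto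
    then show ?thesis by linarith
  qed
  have meas: "?M \<in> borel_measurable M"
    using J X by (intro borel_measurable_Max) auto
  have ib: "integrable M (\<lambda>\<omega>. (a - 1 + exp (- a) * Q \<omega>) / s)"
    using iQ by auto
  show iM: "integrable M ?M"
  proof (rule Bochner_Integration.integrable_bound[OF ib meas], intro AE_I2)
    show "norm (?M \<omega>) \<le> norm ((a - 1 + exp (- a) * Q \<omega>) / s)" for \<omega>
      using bound[of \<omega>] nn[of \<omega>] unfolding real_norm_def by linarith
  qed
  have "expectation ?M \<le> expectation (\<lambda>\<omega>. (a - 1 + exp (- a) * Q \<omega>) / s)"
    by (rule integral_mono[OF iM ib bound])
  also have "\<dots> = (a - 1 + exp (- a) * expectation Q) / s"
    using iQ by (simp add: prob_space)
  also have "\<dots> \<le> (a - 1 + exp (- a) * exp a) / s"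
    using EQ s by (intro divide_right_mono add_left_mono mult_left_mono) auto
  also have "a - 1 + exp (- a) * exp a = l\<^sup>2 + s\<^sup>2 * V"
  proof -
    have "exp (- a) * exp a = 1" by (simp flip: exp_add)
    then show ?thesis by (simp add: a_def l)
  qed
  also have "(l\<^sup>2 + s\<^sup>2 * V) / s = l\<^sup>2 * (1 / s) + s * V" using s by (simp add: field_simps power2_eq_square)
  also have "l\<^sup>2 * (1 / s) = \<beta> * l\<^sup>2 + sqrt V * l" using l by (simp add: s_def field_simps power2_eq_square)
  finally show "expectation ?M \<le> \<beta> * ln (2 * N) + 2 * sqrt V * sqrt (ln (2 * N))"
    using sV l by (simp add: l_def)
qed

section \<open>Centred sums of independent observations\<close>

text \<open>One row of observations.  The normalising constant \<open>r\<close> has the order of the number of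
  observations in \<open>S\<close>: there, the law of an observation is at most \<open>C r / n\<close> times \<open>P\<close>.  Nothing is said
  about the observations outside \<open>S\<close>, which are invisible to functions that vanish there.\<close>

locale independent_row = prob_space M for M :: "'w measure" +
  fixes Y :: "nat \<Rightarrow> 'w \<Rightarrow> 'a::topological_space" and n :: nat and r C :: real
    and S :: "'a set" and P :: "'a measure"
  assumes indep: "indep_vars (\<lambda>_. borel) Y {1..n}"
    and r_pos: "r > 0" and C_pos: "C > 0" and sets_P: "sets P = sets borel"
    and dominated: "\<And>g i. g \<in> borel_measurable borel \<Longrightarrow> (\<And>y. 0 \<le> g y) \<Longrightarrow>
        (\<And>y. y \<notin> S \<Longrightarrow> g y = 0) \<Longrightarrow> integrable P g \<Longrightarrow> i \<in> {1..n} \<Longrightarrow>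
        integrable M (\<lambda>\<omega>. g (Y i \<omega>)) \<and> n * expectation (\<lambda>\<omega>. g (Y i \<omega>)) \<le> C * r * (\<integral>y. g y \<partial>P)"
begin

definition T :: "('a \<Rightarrow> real) \<Rightarrow> 'w \<Rightarrow> real" where
  "T g \<omega> = 1 / sqrt r * (\<Sum>i=1..n. g (Y i \<omega>) - expectation (\<lambda>\<omega>. g (Y i \<omega>)))"

definition test :: "('a \<Rightarrow> real) \<Rightarrow> bool" where
  "test g \<longleftrightarrow> g \<in> borel_measurable borel \<and> (\<forall>y. y \<notin> S \<longrightarrow> g y = 0) \<and> integrable P g"

lemma Y_measurable: "i \<in> {1..n} \<Longrightarrow> Y i \<in> measurable M borel"
  using indep unfolding indep_vars_def by auto

lemma test_abs: "test g \<Longrightarrow> test (\<lambda>y. \<bar>g y\<bar>)"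
  unfolding test_def by auto

lemma test_add: "test f \<Longrightarrow> test g \<Longrightarrow> test (\<lambda>y. f y + g y)"
  unfolding test_def by auto

lemma test_sum: "(\<And>i. i \<in> I \<Longrightarrow> test (f i)) \<Longrightarrow> test (\<lambda>y. \<Sum>i\<in>I. f i y)"
  unfolding test_def by (auto intro!: borel_measurable_sum)

lemma test_bounded:
  assumes "test w" "g \<in> borel_measurable borel" "\<And>y. \<bar>g y\<bar> \<le> w y"
  shows "test g"
proof -
  have "integrable P g"
  proof (rule Bochner_Integration.integrable_bound)
    show "integrable P w" using assms by (simp add: test_def)
    show "g \<in> borel_measurable P" using assms(2) sets_P by (simp cong: measurable_cong_sets)
    show "AE y in P. norm (g y) \<le> norm (w y)" using assms(3) by (auto intro: order_trans[OF _ abs_ge_self])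
  qed
  moreover have "g y = 0" if "y \<notin> S" for y using assms(1) assms(3)[of y] that by (auto simp: test_def)
  ultimately show ?thesis using assms by (auto simp: test_def)
qed

lemma test_integrable:
  assumes "test g" "i \<in> {1..n}"
  shows "integrable M (\<lambda>\<omega>. g (Y i \<omega>))"
proof -
  have "integrable M (\<lambda>\<omega>. \<bar>g (Y i \<omega>)\<bar>)"
    using dominated[of "\<lambda>y. \<bar>g y\<bar>" i] assms by (auto simp: test_def)
  then show ?thesis
    by (rule Bochner_Integration.integrable_bound)
      (use measurable_compose[OF Y_measurable[OF assms(2)]] assms in \<open>auto simp: test_def\<close>)
qed

lemma sum_expectation_le:
  assumes "test g" "\<And>y. 0 \<le> g y"
  shows "(\<Sum>i=1..n. expectation (\<lambda>\<omega>. g (Y i \<omega>))) \<le> C * r * (\<integral>y. g y \<partial>P)"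
proof (cases "n = 0")
  case True
  then show ?thesis using C_pos r_pos assms(2) by simp
next
  case False
  have "(\<Sum>i=1..n. expectation (\<lambda>\<omega>. g (Y i \<omega>))) \<le> (\<Sum>i=1..n. C * r * (\<integral>y. g y \<partial>P) / n)"
    using dominated[of g] assms False by (intro sum_mono) (auto simp: test_def field_simps)
  then show ?thesis using False by simp
qed

lemma T_measurable: "test g \<Longrightarrow> T g \<in> borel_measurable M"
  unfolding T_def using test_integrable by (intro borel_measurable_times borel_measurable_sum borel_measurable_diff) auto

lemma T_integrable: "test g \<Longrightarrow> integrable M (T g)"
  unfolding T_def using test_integrable
  by (intro integrable_mult_right Bochner_Integration.integrable_sum Bochner_Integration.integrable_diff) auto

lemma T_add: "test f \<Longrightarrow> test g \<Longrightarrow> T (\<lambda>y. f y + g y) \<omega> = T f \<omega> + T g \<omega>"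
  unfolding T_def by (simp add: test_integrable sum.distrib sum_subtractf algebra_simps)

lemma T_diff: "test f \<Longrightarrow> test g \<Longrightarrow> T (\<lambda>y. f y - g y) \<omega> = T f \<omega> - T g \<omega>"
  unfolding T_def by (simp add: test_integrable sum.distrib sum_subtractf algebra_simps)

lemma T_sum: "finite I \<Longrightarrow> (\<And>i. i \<in> I \<Longrightarrow> test (f i)) \<Longrightarrow> T (\<lambda>y. \<Sum>i\<in>I. f i y) \<omega> = (\<Sum>i\<in>I. T (f i) \<omega>)"
proof (induction I rule: finite_induct)
  case empty
  then show ?case by (simp add: T_def)
next
  case (insert x F)
  then show ?case using T_add[of "f x" "\<lambda>y. \<Sum>i\<in>F. f i y"] test_sum[of F f] by simp
qed

text \<open>Domination of functions carries over to centred sums at the price of the mean of the dominating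
  function, which has the large factor \<open>sqrt r\<close>.\<close>

lemma T_abs_le:
  assumes w: "test w" and g: "g \<in> borel_measurable borel" "\<And>y. \<bar>g y\<bar> \<le> w y"
  shows "\<bar>T g \<omega>\<bar> \<le> \<bar>T w \<omega>\<bar> + 2 * C * sqrt r * (\<integral>y. w y \<partial>P)"
proof -
  have w0: "0 \<le> w y" for y using g(2)[of y] by linarith
  have tg: "test g" by (rule test_bounded[OF w g])
  let ?E = "\<lambda>g i. expectation (\<lambda>\<omega>. g (Y i \<omega>))"
  have "\<bar>\<Sum>i=1..n. g (Y i \<omega>) - ?E g i\<bar> \<le> (\<Sum>i=1..n. w (Y i \<omega>) + ?E w i)"
  proof (intro order_trans[OF sum_abs] sum_mono)
    fix i assume i: "i \<in> {1..n}"
    have "\<bar>?E g i\<bar> \<le> expectation (\<lambda>\<omega>. \<bar>g (Y i \<omega>)\<bar>)" by (rule integral_abs_bound)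
    also have "\<dots> \<le> ?E w i" using test_integrable[OF w i] test_integrable[OF tg i] g by (intro integral_mono) auto
    finally show "\<bar>g (Y i \<omega>) - ?E g i\<bar> \<le> w (Y i \<omega>) + ?E w i" using g(2)[of "Y i \<omega>"] by linarith
  qed
  also have "\<dots> = (\<Sum>i=1..n. w (Y i \<omega>) - ?E w i) + 2 * (\<Sum>i=1..n. ?E w i)"
    by (simp add: sum.distrib sum_subtractf)
  also have "\<dots> \<le> \<bar>\<Sum>i=1..n. w (Y i \<omega>) - ?E w i\<bar> + 2 * (C * r * (\<integral>y. w y \<partial>P))"
    using sum_expectation_le[OF w w0] by (intro add_mono) auto
  finally have "1 / sqrt r * \<bar>\<Sum>i=1..n. g (Y i \<omega>) - ?E g i\<bar> \<le>
      1 / sqrt r * (\<bar>\<Sum>i=1..n. w (Y i \<omega>) - ?E w i\<bar> + 2 * (C * r * (\<integral>y. w y \<partial>P)))"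
    using r_pos by (intro mult_left_mono) auto
  moreover have "1 / sqrt r * (2 * (C * r * (\<integral>y. w y \<partial>P))) = 2 * C * sqrt r * (\<integral>y. w y \<partial>P)"
    using r_pos by (simp add: field_simps)
  ultimately show ?thesis
    unfolding T_def using r_pos by (simp add: abs_mult distrib_left del: times_divide_eq_left)
qed

lemma expectation_T_abs_le:
  assumes w: "test w" and w0: "\<And>y. 0 \<le> w y"
  shows "expectation (\<lambda>\<omega>. \<bar>T w \<omega>\<bar>) \<le> 2 * C * sqrt r * (\<integral>y. w y \<partial>P)"
proof -
  let ?E = "\<lambda>g i. expectation (\<lambda>\<omega>. g (Y i \<omega>))"
  have pt: "\<bar>T w \<omega>\<bar> \<le> 1 / sqrt r * (\<Sum>i=1..n. w (Y i \<omega>) + ?E w i)" for \<omega>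
  proof -
    have "0 \<le> ?E w i" for i using w0 by (intro integral_nonneg_AE) auto
    then have "\<bar>w (Y i \<omega>) - ?E w i\<bar> \<le> w (Y i \<omega>) + ?E w i" for i
      using w0[of "Y i \<omega>"] by (simp add: abs_le_iff)
    then have "\<bar>\<Sum>i=1..n. w (Y i \<omega>) - ?E w i\<bar> \<le> (\<Sum>i=1..n. w (Y i \<omega>) + ?E w i)"
      by (intro order_trans[OF sum_abs] sum_mono)
    then show ?thesis unfolding T_def using r_pos by (simp add: abs_mult divide_right_mono)
  qed
  have "expectation (\<lambda>\<omega>. \<bar>T w \<omega>\<bar>) \<le> expectation (\<lambda>\<omega>. 1 / sqrt r * (\<Sum>i=1..n. w (Y i \<omega>) + ?E w i))"
    using T_integrable[OF w] test_integrable[OF w] pt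
    by (intro integral_mono integrable_mult_right Bochner_Integration.integrable_sum) auto
  also have "\<dots> = 1 / sqrt r * (2 * (\<Sum>i=1..n. ?E w i))"
  proof -
    have "expectation (\<lambda>\<omega>. \<Sum>i=1..n. w (Y i \<omega>) + ?E w i) = (\<Sum>i=1..n. expectation (\<lambda>\<omega>. w (Y i \<omega>) + ?E w i))"
      using test_integrable[OF w] by (intro Bochner_Integration.integral_sum) auto
    also have "\<dots> = (\<Sum>i=1..n. 2 * ?E w i)"
      using test_integrable[OF w] by (intro sum.cong) (auto simp: prob_space)
    finally have "expectation (\<lambda>\<omega>. \<Sum>i=1..n. w (Y i \<omega>) + ?E w i) = 2 * (\<Sum>i=1..n. ?E w i)"
      by (simp add: sum_distrib_left)
    then show ?thesis by (simp only: integral_mult_right_zero)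
  qed
  also have "\<dots> \<le> 1 / sqrt r * (2 * (C * r * (\<integral>y. w y \<partial>P)))"
    using sum_expectation_le[OF w w0] r_pos by (intro mult_left_mono) auto
  also have "\<dots> = 2 * C * sqrt r * (\<integral>y. w y \<partial>P)"
    using r_pos by (simp add: field_simps)
  finally show ?thesis .
qed

text \<open>A summand bounded by 1 in absolute value satisfies \<open>E exp X \<le> 1 + E X\<^sup>2 \<le> exp (E X\<^sup>2)\<close>
  when it is centred; independence multiplies these bounds.\<close>

lemma T_mgf:
  assumes g: "g \<in> borel_measurable borel" "\<And>y. y \<notin> S \<Longrightarrow> g y = 0" "\<And>y. \<bar>g y\<bar> \<le> b"
    and g2: "integrable P (\<lambda>y. (g y)\<^sup>2)" "(\<integral>y. (g y)\<^sup>2 \<partial>P) \<le> v"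
    and s: "\<bar>s\<bar> * (2 * b / sqrt r) \<le> 1"
  shows "integrable M (\<lambda>\<omega>. exp (s * T g \<omega>)) \<and> expectation (\<lambda>\<omega>. exp (s * T g \<omega>)) \<le> exp (s\<^sup>2 * (C * v))"
proof -
  let ?m = "\<lambda>i. expectation (\<lambda>\<omega>. g (Y i \<omega>))"
  define X where "X i \<omega> = s / sqrt r * (g (Y i \<omega>) - ?m i)" for i \<omega>
  have gY: "(\<lambda>\<omega>. g (Y i \<omega>)) \<in> borel_measurable M" if "i \<in> {1..n}" for i
    using measurable_compose[OF Y_measurable[OF that] g(1)] .
  have iY: "integrable M (\<lambda>\<omega>. g (Y i \<omega>))" if "i \<in> {1..n}" for i
    using gY[OF that] g(3) by (intro integrable_const_bound[where B=b]) auto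
  have t2: "test (\<lambda>y. (g y)\<^sup>2)" using g g2 by (auto simp: test_def)
  have iY2: "integrable M (\<lambda>\<omega>. (g (Y i \<omega>))\<^sup>2)" if "i \<in> {1..n}" for i
    using test_integrable[OF t2 that] .
  have b0: "b \<ge> 0" using g(3)[of undefined] by linarith
  have m: "\<bar>?m i\<bar> \<le> b" if "i \<in> {1..n}" for i
  proof -
    have "\<bar>?m i\<bar> \<le> expectation (\<lambda>\<omega>. \<bar>g (Y i \<omega>)\<bar>)" by (rule integral_abs_bound)
    also have "\<dots> \<le> expectation (\<lambda>\<omega>. b)" using iY[OF that] g(3) by (intro integral_mono) auto
    finally show ?thesis by (simp add: prob_space)
  qed
  have X1: "\<bar>X i \<omega>\<bar> \<le> 1" if "i \<in> {1..n}" for i \<omega>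
  proof -
    have "\<bar>g (Y i \<omega>) - ?m i\<bar> \<le> 2 * b" using g(3)[of "Y i \<omega>"] m[OF that] by linarith
    then have "\<bar>s\<bar> / sqrt r * \<bar>g (Y i \<omega>) - ?m i\<bar> \<le> \<bar>s\<bar> / sqrt r * (2 * b)"
      using r_pos by (intro mult_left_mono) auto
    also have "\<dots> \<le> 1" using s by (simp add: field_simps)
    finally show ?thesis unfolding X_def using r_pos by (simp add: abs_mult)
  qed
  have Xm: "X i \<in> borel_measurable M" if "i \<in> {1..n}" for i unfolding X_def using gY[OF that] by auto
  have iX: "integrable M (X i)" if "i \<in> {1..n}" for i unfolding X_def using iY[OF that] by auto
  have EX: "expectation (X i) = 0" if "i \<in> {1..n}" for i
    unfolding X_def using iY[OF that] by (simp add: prob_space)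
  have iX2: "integrable M (\<lambda>\<omega>. (X i \<omega>)\<^sup>2)" if "i \<in> {1..n}" for i
    using Xm[OF that] X1[OF that] by (intro integrable_const_bound[where B=1]) (auto simp: abs_square_le_1)
  have EX2: "expectation (\<lambda>\<omega>. (X i \<omega>)\<^sup>2) \<le> s\<^sup>2 / r * expectation (\<lambda>\<omega>. (g (Y i \<omega>))\<^sup>2)" if "i \<in> {1..n}" for i
  proof -
    have "expectation (\<lambda>\<omega>. (X i \<omega>)\<^sup>2) = s\<^sup>2 / r * expectation (\<lambda>\<omega>. (g (Y i \<omega>) - ?m i)\<^sup>2)"
      unfolding X_def using r_pos by (simp add: power_mult_distrib power_divide)
    also have "expectation (\<lambda>\<omega>. (g (Y i \<omega>) - ?m i)\<^sup>2) = expectation (\<lambda>\<omega>. (g (Y i \<omega>))\<^sup>2) - (?m i)\<^sup>2"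
      using iY[OF that] iY2[OF that] by (rule variance_eq)
    also have "s\<^sup>2 / r * \<dots> \<le> s\<^sup>2 / r * expectation (\<lambda>\<omega>. (g (Y i \<omega>))\<^sup>2)"
      using r_pos by (intro mult_left_mono) auto
    finally show ?thesis .
  qed
  have expX: "exp (s * T g \<omega>) = (\<Prod>i\<in>{1..n}. exp (X i \<omega>))" for \<omega>
  proof -
    have "s * T g \<omega> = (\<Sum>i=1..n. X i \<omega>)"
      unfolding T_def X_def by (simp add: sum_distrib_left sum_divide_distrib)
    then show ?thesis by (simp add: exp_sum)
  qed
  have ind: "indep_vars (\<lambda>_. borel) (\<lambda>i \<omega>. exp (X i \<omega>)) {1..n}"
    unfolding X_def
    by (rule indep_vars_compose2[OF indep, where Y="\<lambda>i y. exp (s / sqrt r * (g y - ?m i))"]) (use g in auto)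
  have ieX: "integrable M (\<lambda>\<omega>. exp (X i \<omega>))" if "i \<in> {1..n}" for i
    using Xm[OF that] X1[OF that] by (intro integrable_const_bound[where B="exp 1"]) (auto simp: abs_le_iff)
  have EeX: "expectation (\<lambda>\<omega>. exp (X i \<omega>)) \<le> exp (s\<^sup>2 / r * expectation (\<lambda>\<omega>. (g (Y i \<omega>))\<^sup>2))"
    if i: "i \<in> {1..n}" for i
  proof -
    have "expectation (\<lambda>\<omega>. exp (X i \<omega>)) \<le> expectation (\<lambda>\<omega>. 1 + X i \<omega> + (X i \<omega>)\<^sup>2)"
      using ieX[OF i] iX[OF i] iX2[OF i] exp_le_quadratic[OF X1[OF i]] by (intro integral_mono) auto
    also have "\<dots> = 1 + expectation (\<lambda>\<omega>. (X i \<omega>)\<^sup>2)" using iX[OF i] iX2[OF i] EX[OF i] by (simp add: prob_space)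
    also have "\<dots> \<le> 1 + s\<^sup>2 / r * expectation (\<lambda>\<omega>. (g (Y i \<omega>))\<^sup>2)" using EX2[OF i] by simp
    also have "\<dots> \<le> exp (s\<^sup>2 / r * expectation (\<lambda>\<omega>. (g (Y i \<omega>))\<^sup>2))" by (rule exp_ge_add_one_self)
    finally show ?thesis .
  qed
  have "expectation (\<lambda>\<omega>. exp (s * T g \<omega>)) = (\<Prod>i\<in>{1..n}. expectation (\<lambda>\<omega>. exp (X i \<omega>)))"
    unfolding expX by (rule indep_vars_lebesgue_integral[OF _ ind ieX]) auto
  also have "\<dots> \<le> (\<Prod>i\<in>{1..n}. exp (s\<^sup>2 / r * expectation (\<lambda>\<omega>. (g (Y i \<omega>))\<^sup>2)))"
    using EeX by (intro prod_mono) auto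
  also have "\<dots> = exp (s\<^sup>2 / r * (\<Sum>i=1..n. expectation (\<lambda>\<omega>. (g (Y i \<omega>))\<^sup>2)))"
    by (simp add: exp_sum sum_distrib_left)
  also have "\<dots> \<le> exp (s\<^sup>2 * (C * v))"
  proof -
    have "(\<Sum>i=1..n. expectation (\<lambda>\<omega>. (g (Y i \<omega>))\<^sup>2)) \<le> C * r * (\<integral>y. (g y)\<^sup>2 \<partial>P)"
      by (rule sum_expectation_le[OF t2]) simp
    also have "\<dots> \<le> C * r * v" using g2 C_pos r_pos by (intro mult_left_mono) auto
    finally have "s\<^sup>2 / r * (\<Sum>i=1..n. expectation (\<lambda>\<omega>. (g (Y i \<omega>))\<^sup>2)) \<le> s\<^sup>2 / r * (C * r * v)"
      using r_pos by (intro mult_left_mono) auto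
    then show ?thesis using r_pos by simp
  qed
  finally show ?thesis
    unfolding expX using indep_vars_integrable[OF _ ind ieX] by auto
qed

end

section \<open>Bracketing chains\<close>

text \<open>Nested partitions of \<open>F\<close>, encoded by their representatives: two functions lie in the same cell of
  level \<open>q\<close> iff they have the same image under \<open>proj q\<close>.  Nestedness is \<open>proj_proj\<close>, and \<open>width_proj\<close> says
  that \<open>width q\<close> depends on the cell only.\<close>

locale bracketing_chain =
  fixes P :: "'a::topological_space measure" and F :: "('a \<Rightarrow> real) set" and S :: "'a set" and env :: "'a \<Rightarrow> real"
    and proj :: "nat \<Rightarrow> ('a \<Rightarrow> real) \<Rightarrow> ('a \<Rightarrow> real)"
    and width :: "nat \<Rightarrow> ('a \<Rightarrow> real) \<Rightarrow> 'a \<Rightarrow> real" and N :: "nat \<Rightarrow> real"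
  assumes prob_P: "prob_space P" and sets_P: "sets P = sets borel"
    and F_nonempty: "F \<noteq> {}" and F_borel: "F \<subseteq> borel_measurable borel"
    and env_borel: "env \<in> borel_measurable borel" and env_S: "\<And>y. y \<notin> S \<Longrightarrow> env y = 0"
    and env: "\<And>f y. f \<in> F \<Longrightarrow> \<bar>f y\<bar> \<le> env y" and env_L2: "integrable P (\<lambda>y. (env y)\<^sup>2)"
    and proj_in: "\<And>q f. f \<in> F \<Longrightarrow> proj q f \<in> F"
    and proj_proj: "\<And>p q f. p \<le> q \<Longrightarrow> f \<in> F \<Longrightarrow> proj p (proj q f) = proj p f"
    and finite_proj: "\<And>q. finite (proj q ` F)" and card_proj: "\<And>q. card (proj q ` F) \<le> N q"
    and width_proj: "\<And>q f. f \<in> F \<Longrightarrow> width q (proj q f) = width q f"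
    and width_borel: "\<And>q f. f \<in> F \<Longrightarrow> width q f \<in> borel_measurable borel"
    and proj_near: "\<And>q f y. f \<in> F \<Longrightarrow> \<bar>f y - proj q f y\<bar> \<le> width q f y"
    and width_decreasing: "\<And>q f y. f \<in> F \<Longrightarrow> width (Suc q) f y \<le> width q f y"
    and width_env: "\<And>q f y. f \<in> F \<Longrightarrow> width q f y \<le> 2 * env y"
    and width_L2: "\<And>q f. f \<in> F \<Longrightarrow> (\<integral>y. (width q f y)\<^sup>2 \<partial>P) \<le> (1/4)^q"
    and summable_entropy: "summable (\<lambda>q. (1/2)^q * sqrt (ln (2 * N q)))"
begin

sublocale P: prob_space P by (fact prob_P)

definition L :: "nat \<Rightarrow> real" where "L q = sqrt (ln (2 * N q))"

text \<open>Truncation thresholds, in units of \<open>sqrt r\<close>.  With this choice the term \<open>level q * (L (q + 1))\<^sup>2\<close>, due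
  to truncation, and the Gaussian term \<open>(1/2)\<^sup>q * L (q + 1)\<close> of the maximal inequality coincide.\<close>

definition level :: "nat \<Rightarrow> real" where "level q = (1/2)^q / L (Suc q)"

definition entropy_term :: "nat \<Rightarrow> real" where "entropy_term q = (1/2)^q * L (Suc q)"

lemma N_ge_1: "N q \<ge> 1"
proof -
  have "card (proj q ` F) \<ge> 1" using finite_proj[of q] F_nonempty by (simp add: Suc_le_eq card_gt_0_iff)
  then show ?thesis using card_proj[of q] by linarith
qed

lemma L_pos: "L q > 0" "(L q)\<^sup>2 = ln (2 * N q)"
  using N_ge_1[of q] by (auto simp: L_def)

lemma level_pos: "level q > 0" using L_pos by (simp add: level_def)

lemma entropy_term_pos: "entropy_term q > 0" using L_pos by (simp add: entropy_term_def)

lemma level_L: "level q * (L (Suc q))\<^sup>2 = entropy_term q"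
  using L_pos(1)[of "Suc q"] by (simp add: level_def entropy_term_def power2_eq_square)

lemma summable_entropy_term: "summable entropy_term"
proof -
  have "summable (\<lambda>q. 2 * ((1/2)^Suc q * sqrt (ln (2 * N (Suc q)))))"
    by (intro summable_mult) (use summable_entropy in \<open>subst summable_Suc_iff\<close>)
  then show ?thesis by (simp add: entropy_term_def[abs_def] L_def)
qed

lemma width_nonneg: "f \<in> F \<Longrightarrow> 0 \<le> width q f y"
  using proj_near[of f y q] by linarith

lemma env_nonneg: "0 \<le> env y"
  using F_nonempty env by (meson abs_ge_zero all_not_in_conv order_trans)

lemma width_proj_le: "p \<le> q \<Longrightarrow> f \<in> F \<Longrightarrow> width p (proj q f) = width p f"
  using width_proj[of "proj q f" p] width_proj[of f p] proj_proj[of p q f] proj_in[of f q] by simp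

lemma proj_step: "f \<in> F \<Longrightarrow> \<bar>proj (Suc q) f y - proj q f y\<bar> \<le> width q f y"
  using proj_near[OF proj_in[of f "Suc q"], of y q] proj_proj[of q "Suc q" f] width_proj_le[of q "Suc q" f] by simp

lemma measurable_P: "g \<in> borel_measurable borel \<Longrightarrow> g \<in> borel_measurable P"
  using sets_P by (simp cong: measurable_cong_sets)

lemma L2_bounded:
  assumes g: "g \<in> borel_measurable borel" and b: "\<And>y. \<bar>g y\<bar> \<le> c * env y"
  shows "integrable P (\<lambda>y. (g y)\<^sup>2)" "integrable P g"
proof -
  have "integrable P (\<lambda>y. c\<^sup>2 * (env y)\<^sup>2)" using env_L2 by simp
  then show i2: "integrable P (\<lambda>y. (g y)\<^sup>2)"
  proof (rule Bochner_Integration.integrable_bound)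
    show "(\<lambda>y. (g y)\<^sup>2) \<in> borel_measurable P" using measurable_P[OF g] by simp
    show "AE y in P. norm ((g y)\<^sup>2) \<le> norm (c\<^sup>2 * (env y)\<^sup>2)"
    proof (intro AE_I2)
      fix y
      have "(g y)\<^sup>2 \<le> (c * env y)\<^sup>2" using b[of y] power_mono[of "\<bar>g y\<bar>" "c * env y" 2] by simp
      then show "norm ((g y)\<^sup>2) \<le> norm (c\<^sup>2 * (env y)\<^sup>2)" by (simp add: power_mult_distrib)
    qed
  qed
  show "integrable P g" by (rule P.square_integrable_imp_integrable[OF measurable_P[OF g] i2])
qed

lemma width_integrable: "f \<in> F \<Longrightarrow> integrable P (\<lambda>y. (width q f y)\<^sup>2)" "f \<in> F \<Longrightarrow> integrable P (width q f)"
  using L2_bounded[OF width_borel[of f q], of 2] width_nonneg[of f q] width_env[of f q] by auto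

lemma width_L1: 
  assumes "f \<in> F"
  shows "(\<integral>y. width q f y \<partial>P) \<le> (1/2)^q"
proof (rule power2_le_imp_le)
  have "0 \<le> (\<integral>y. (width q f y - (\<integral>y. width q f y \<partial>P))\<^sup>2 \<partial>P)" by simp
  also have "\<dots> = (\<integral>y. (width q f y)\<^sup>2 \<partial>P) - (\<integral>y. width q f y \<partial>P)\<^sup>2"
    using width_integrable[OF assms] by (intro P.variance_eq) auto
  finally have "(\<integral>y. width q f y \<partial>P)\<^sup>2 \<le> (1/4)^q" using width_L2[OF assms, of q] by simp
  also have "(1/4::real)^q = ((1/2)^q)\<^sup>2" by (simp add: power2_eq_square flip: power_mult_distrib)
  finally show "(\<integral>y. width q f y \<partial>P)\<^sup>2 \<le> ((1/2)^q)\<^sup>2" .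
qed simp

end

section \<open>Chaining with truncation\<close>

locale chained_row = bracketing_chain P F S env proj width N + independent_row M Y n r C S P
  for P :: "'a::topological_space measure" and F S env proj width N
    and M :: "'w measure" and Y n r C
begin

lemma test_envelope:
  assumes "g \<in> borel_measurable borel" "\<And>y. \<bar>g y\<bar> \<le> c * env y"
  shows "test g"
proof -
  have "g y = 0" if "y \<notin> S" for y using assms(2)[of y] env_S[OF that] by simp
  then show ?thesis using L2_bounded(2)[OF assms] assms(1) unfolding test_def by blast
qed

text \<open>At the point \<open>y\<close>, the chain of \<open>f\<close> from level \<open>q0\<close> is followed as long as the widths respect the
  thresholds; \<open>exits\<close> says that level \<open>q + 1\<close> is the first one (after \<open>q0\<close>) at which they fail to.\<close>

definition small :: "nat \<Rightarrow> nat \<Rightarrow> ('a \<Rightarrow> real) \<Rightarrow> 'a \<Rightarrow> bool" where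
  "small q0 q f y \<longleftrightarrow> (\<forall>p\<in>{q0..q}. width p f y \<le> sqrt r * level p)"

definition exits :: "nat \<Rightarrow> nat \<Rightarrow> ('a \<Rightarrow> real) \<Rightarrow> 'a \<Rightarrow> bool" where
  "exits q0 q f y \<longleftrightarrow> small q0 q f y \<and> \<not> small q0 (Suc q) f y"

lemma small_Suc: "small q0 (Suc q) f y \<Longrightarrow> small q0 q f y"
  by (auto simp: small_def)

lemma small_proj: "q \<le> q' \<Longrightarrow> f \<in> F \<Longrightarrow> small q0 q (proj q' f) y = small q0 q f y"
  using width_proj_le by (auto simp: small_def)

lemma small_borel [measurable]: "f \<in> F \<Longrightarrow> Measurable.pred borel (small q0 q f)"
  unfolding small_def using width_borel by (intro pred_intros_finite) auto

lemma exits_borel [measurable]: "f \<in> F \<Longrightarrow> Measurable.pred borel (exits q0 q f)"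
  unfolding exits_def by measurable

text \<open>As long as no threshold is exceeded, the difference at level \<open>q\<close> is passed on to level \<open>q + 1\<close>
  at the cost of one link; if the threshold of level \<open>q + 1\<close> is exceeded, it is kept as it stands.\<close>

lemma chain_identity:
  assumes "q0 \<le> q1"
  shows "f y - proj q0 f y = (f y - proj q0 f y) * of_bool (\<not> small q0 q0 f y)
    + (\<Sum>q\<in>{q0..<q1}. (f y - proj (Suc q) f y) * of_bool (exits q0 q f y)
        + (proj (Suc q) f y - proj q f y) * of_bool (small q0 q f y))
    + (f y - proj q1 f y) * of_bool (small q0 q1 f y)"
  using assms
proof (induction rule: dec_induct)
  case (step q)
  have "(f y - proj q f y) * of_bool (small q0 q f y) =
      (f y - proj (Suc q) f y) * of_bool (exits q0 q f y)
      + (proj (Suc q) f y - proj q f y) * of_bool (small q0 q f y)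
      + (f y - proj (Suc q) f y) * of_bool (small q0 (Suc q) f y)"
    using small_Suc[of q0 q f y] by (auto simp: exits_def)
  then show ?case using step by (simp add: sum.atLeastLessThan_Suc)
qed auto

text \<open>The contribution of one level.  A function that depends on the cell of level \<open>q + 1\<close> only has at most
  \<open>N (q + 1)\<close> values, so the maximal inequality applies; the bound by \<open>width q\<close> controls the variances
  and the bound by the threshold controls the exponential moments.\<close>

lemma link_bound:
  assumes cells: "G ` F = G ` proj (Suc q) ` F"
    and G: "\<And>f. f \<in> F \<Longrightarrow> G f \<in> borel_measurable borel"
      "\<And>f y. f \<in> F \<Longrightarrow> \<bar>G f y\<bar> \<le> width q f y" "\<And>f y. f \<in> F \<Longrightarrow> \<bar>G f y\<bar> \<le> sqrt r * level q"
  obtains U where "integrable M U" "\<And>f \<omega>. f \<in> F \<Longrightarrow> \<bar>T (G f) \<omega>\<bar> \<le> U \<omega>"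
    "(\<integral>\<omega>. U \<omega> \<partial>M) \<le> (2 + 2 * sqrt C) * entropy_term q"
proof -
  let ?J = "proj (Suc q) ` F"
  define U where "U \<omega> = Max ((\<lambda>f. \<bar>T (G f) \<omega>\<bar>) ` ?J)" for \<omega>
  have J: "finite ?J" "?J \<noteq> {}" "real (card ?J) \<le> N (Suc q)"
    using finite_proj F_nonempty card_proj by auto
  have JF: "f \<in> F" if "f \<in> ?J" for f using that proj_in by auto
  have b2: "\<bar>G f y\<bar> \<le> 2 * env y" if "f \<in> F" for f y using G(2)[OF that] width_env[OF that] order_trans by blast
  have m: "integrable M (\<lambda>\<omega>. exp (s * T (G f) \<omega>)) \<and> (\<integral>\<omega>. exp (s * T (G f) \<omega>) \<partial>M) \<le> exp (s\<^sup>2 * (C * (1/4)^q))"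
    if f: "f \<in> ?J" and s: "\<bar>s\<bar> * (2 * level q) \<le> 1" for f s
  proof (rule T_mgf[where b="sqrt r * level q"])
    show iG: "integrable P (\<lambda>y. (G f y)\<^sup>2)" by (rule L2_bounded(1)[OF G(1)[OF JF[OF f]] b2[OF JF[OF f]]])
    have "(G f y)\<^sup>2 \<le> (width q f y)\<^sup>2" for y
      using G(2)[OF JF[OF f], of y] by (simp add: abs_le_square_iff[symmetric] order_trans[OF _ abs_ge_self])
    then have "(\<integral>y. (G f y)\<^sup>2 \<partial>P) \<le> (\<integral>y. (width q f y)\<^sup>2 \<partial>P)"
      using iG width_integrable(1)[OF JF[OF f]] by (intro integral_mono) auto
    then show "(\<integral>y. (G f y)\<^sup>2 \<partial>P) \<le> (1/4)^q" using width_L2[OF JF[OF f], of q] by simp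
    show "G f y = 0" if "y \<notin> S" for y using b2[OF JF[OF f], of y] env_S[OF that] by simp
  qed (use G JF f s r_pos in auto)
  have V: "C * (1/4)^q > 0" using C_pos by simp
  have Tm: "T (G f) \<in> borel_measurable M" if "f \<in> ?J" for f
    by (rule T_measurable[OF test_envelope[OF G(1)[OF JF[OF that]] b2[OF JF[OF that]]]])
  have l0: "0 \<le> 2 * level q" using level_pos[of q] by simp
  have iU: "integrable M U"
    unfolding U_def[abs_def] by (rule expectation_Max_abs_le(1)[OF J _ V l0]) (erule Tm, erule (1) m)
  have EU: "expectation U \<le> 2 * level q * ln (2 * N (Suc q)) + 2 * sqrt (C * (1/4)^q) * sqrt (ln (2 * N (Suc q)))"
    unfolding U_def[abs_def] by (rule expectation_Max_abs_le(2)[OF J _ V l0]) (erule Tm, erule (1) m)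
  have "sqrt (C * (1/4)^q) = sqrt C * (1/2)^q"
    by (simp add: real_sqrt_mult real_sqrt_power real_sqrt_divide)
  then have "(\<integral>\<omega>. U \<omega> \<partial>M) \<le> 2 * level q * (L (Suc q))\<^sup>2 + 2 * (sqrt C * (1/2)^q) * L (Suc q)"
    using EU L_pos(2)[of "Suc q"] unfolding L_def by simp
  also have "\<dots> = (2 + 2 * sqrt C) * entropy_term q"
    using level_L[of q] by (simp add: entropy_term_def algebra_simps)
  finally have "(\<integral>\<omega>. U \<omega> \<partial>M) \<le> (2 + 2 * sqrt C) * entropy_term q" .
  moreover have "\<bar>T (G f) \<omega>\<bar> \<le> U \<omega>" if "f \<in> F" for f \<omega>
  proof -
    from that cells obtain g where g: "g \<in> ?J" "G f = G g" by blast
    then show ?thesis unfolding U_def using J by (auto intro!: Max_ge)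
  qed
  ultimately show ?thesis by (intro that[OF iU]) auto
qed


lemma sum_entropy_le: "(\<Sum>q\<in>{q0..<q1}. entropy_term q) \<le> (\<Sum>i. entropy_term (i + q0))"
proof -
  have "(\<Sum>q\<in>{q0..<q1}. entropy_term q) = (\<Sum>i\<in>{0..<q1-q0}. entropy_term (i + q0))"
    by (rule sum.reindex_bij_witness[of _ "\<lambda>i. i + q0" "\<lambda>q. q - q0"]) auto
  also have "\<dots> \<le> (\<Sum>i. entropy_term (i + q0))"
    using summable_ignore_initial_segment[OF summable_entropy_term, of q0] entropy_term_pos
    by (intro sum_le_suminf) (auto intro: less_imp_le)
  finally show ?thesis .
qed

text \<open>Leaving the chain at level \<open>q + 1\<close> means that the width there exceeds
  \<open>sqrt r * level (q + 1)\<close>, so its first moment is at most its second moment divided by this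
  threshold; the thresholds are chosen such that this is again an entropy term.\<close>

lemma exit_mean:
  assumes f: "f \<in> F" and q: "q0 \<le> q"
  shows "2 * C * sqrt r * (\<integral>y. width (Suc q) f y * of_bool (exits q0 q f y) \<partial>P) \<le> 2 * C * entropy_term (Suc q)"
proof -
  let ?c = "sqrt r * level (Suc q)"
  have c: "?c > 0" using level_pos r_pos by simp
  have le: "width (Suc q) f y * of_bool (exits q0 q f y) \<le> (width (Suc q) f y)\<^sup>2 / ?c" for y
  proof (cases "exits q0 q f y")
    case True
    then have "\<exists>p\<in>{q0..Suc q}. \<not> width p f y \<le> sqrt r * level p" "\<forall>p\<in>{q0..q}. width p f y \<le> sqrt r * level p"
      by (auto simp: exits_def small_def)
    then have "?c < width (Suc q) f y" by (metis atLeastAtMost_iff le_Suc_eq not_le)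
    then have "width (Suc q) f y * ?c \<le> width (Suc q) f y * width (Suc q) f y"
      using width_nonneg[OF f] by (intro mult_left_mono) auto
    then show ?thesis using True c by (simp add: pos_le_divide_eq power2_eq_square)
  next
    case False
    then show ?thesis using c by simp
  qed
  have b: "(\<lambda>y. width (Suc q) f y * of_bool (exits q0 q f y)) \<in> borel_measurable borel"
    using width_borel[OF f, of "Suc q"] exits_borel[OF f, of q0 q] by measurable
  have "integrable P (\<lambda>y. width (Suc q) f y * of_bool (exits q0 q f y))"
    using width_nonneg[OF f] width_env[OF f] env_nonneg
    by (intro L2_bounded(2)[OF b, of 2]) auto
  then have "(\<integral>y. width (Suc q) f y * of_bool (exits q0 q f y) \<partial>P) \<le> (\<integral>y. (width (Suc q) f y)\<^sup>2 / ?c \<partial>P)"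
    using width_integrable(1)[OF f] le by (intro integral_mono) auto
  also have "\<dots> \<le> (1/4)^Suc q / ?c"
    using width_L2[OF f, of "Suc q"] c by (simp add: divide_right_mono del: power_Suc)
  finally have "2 * C * sqrt r * (\<integral>y. width (Suc q) f y * of_bool (exits q0 q f y) \<partial>P)
      \<le> 2 * C * sqrt r * ((1/4)^Suc q / ?c)"
    using C_pos r_pos by (intro mult_left_mono) auto
  also have "\<dots> = 2 * C * ((1/4)^Suc q / level (Suc q))" using r_pos by simp
  also have "(1/4)^Suc q / level (Suc q) = entropy_term (Suc q)"
  proof -
    have "(1/4::real)^Suc q = (1/2)^Suc q * (1/2)^Suc q" by (simp flip: power_mult_distrib)
    then show ?thesis unfolding level_def entropy_term_def by simp
  qed
  finally show ?thesis .
qed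

text \<open>The five parts of the chain are treated as follows.  Functions whose width is too large already at
  level \<open>q0\<close> are dominated by the truncated envelope.  Links are handled by \<open>link_bound\<close>.  A function that
  leaves the chain is dominated by its width, whose centred sum is again handled by \<open>link_bound\<close> and
  whose mean is small by \<open>exit_mean\<close>.  At the last level \<open>q1\<close> the width is so small in mean that even
  the factor \<open>sqrt r\<close> is harmless.\<close>

theorem chaining_bound:
  obtains U where "integrable M U" "\<And>f \<omega>. f \<in> F \<Longrightarrow> \<bar>T f \<omega> - T (proj q0 f) \<omega>\<bar> \<le> U \<omega>"
    "(\<integral>\<omega>. U \<omega> \<partial>M) \<le>
       4 * C * sqrt r * (\<integral>y. 2 * env y * of_bool (sqrt r * level q0 < 2 * env y) \<partial>P)
       + (6 + 6 * sqrt C + 2 * C) * (\<Sum>i. entropy_term (i + q0)) + 2 * C * (1/2)^q0"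
proof -
  define w1 where "w1 y = 2 * env y * of_bool (sqrt r * level q0 < 2 * env y)" for y
  define D2 where "D2 q f y = (f y - proj (Suc q) f y) * of_bool (exits q0 q f y)" for q f y
  define W2 where "W2 q f y = width (Suc q) f y * of_bool (exits q0 q f y)" for q f y
  define D3 where "D3 q f y = (proj (Suc q) f y - proj q f y) * of_bool (small q0 q f y)" for q f y
  define D1 where "D1 f y = (f y - proj q0 f y) * of_bool (\<not> small q0 q0 f y)" for f y
  have fb: "f \<in> borel_measurable borel" if "f \<in> F" for f using F_borel that by auto
  have pb: "proj q f \<in> borel_measurable borel" if "f \<in> F" for f q using F_borel proj_in[OF that] by auto
  note [measurable] = env_borel width_borel
  \<comment> \<open>the last level of the chain only has to beat \<open>sqrt r\<close>, so it may depend on the row\<close>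
  obtain k where k: "(1/2)^k < (1/2)^q0 / sqrt r"
    using real_arch_pow_inv[of "(1/2)^q0 / sqrt r" "1/2"] r_pos by auto
  define q1 where "q1 = max k q0"
  have q1: "q0 \<le> q1" "sqrt r * (1/2)^q1 \<le> (1/2)^q0"
  proof -
    have "(1/2::real)^q1 \<le> (1/2)^k" by (rule power_decreasing) (auto simp: q1_def)
    then have "(1/2)^q1 \<le> (1/2)^q0 / sqrt r" using k by linarith
    then show "sqrt r * (1/2)^q1 \<le> (1/2)^q0" using r_pos by (simp add: field_simps)
  qed (simp add: q1_def)
  define D4 where "D4 f y = (f y - proj q1 f y) * of_bool (small q0 q1 f y)" for f y
  define W4 where "W4 f y = width q1 f y * of_bool (small q0 q1 f y)" for f y
  have smallD: "width q f y \<le> sqrt r * level q" if "small q0 q f y" "q0 \<le> q" for q f y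
    using that by (auto simp: small_def)
  have "\<exists>U. integrable M U \<and> (\<forall>f\<in>F. \<forall>\<omega>. \<bar>T (W2 q f) \<omega>\<bar> \<le> U \<omega>) \<and> (\<integral>\<omega>. U \<omega> \<partial>M) \<le> (2 + 2 * sqrt C) * entropy_term q"
    if q: "q0 \<le> q" for q
  proof -
    have e: "exits q0 q (proj (Suc q) f) y = exits q0 q f y" if "f \<in> F" for f y
      using small_proj[of q "Suc q" f q0 y] small_proj[of "Suc q" "Suc q" f q0 y] that by (simp add: exits_def)
    have cells: "W2 q f = W2 q (proj (Suc q) f)" if "f \<in> F" for f
      unfolding W2_def using e[OF that] width_proj[OF that] by auto
    show ?thesis
    proof (rule link_bound[of "W2 q" q])
      show "W2 q ` F = W2 q ` proj (Suc q) ` F" using cells proj_in by (force simp: image_iff)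
      show "W2 q f \<in> borel_measurable borel" if "f \<in> F" for f
        unfolding W2_def using width_borel[OF that, of "Suc q"] exits_borel[OF that, of q0 q] by measurable
      show b: "\<bar>W2 q f y\<bar> \<le> width q f y" if "f \<in> F" for f y
        unfolding W2_def using width_nonneg[OF that] width_decreasing[OF that] by (auto simp: abs_mult)
      show "\<bar>W2 q f y\<bar> \<le> sqrt r * level q" if "f \<in> F" for f y
        using b[OF that, of y] smallD[of q f y] q level_pos[of q] r_pos
        by (cases "exits q0 q f y") (auto simp: W2_def exits_def)
    qed blast
  qed
  then obtain U2 where U2: "\<And>q. q0 \<le> q \<Longrightarrow> integrable M (U2 q)" "\<And>q f \<omega>. q0 \<le> q \<Longrightarrow> f \<in> F \<Longrightarrow> \<bar>T (W2 q f) \<omega>\<bar> \<le> U2 q \<omega>"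
    "\<And>q. q0 \<le> q \<Longrightarrow> (\<integral>\<omega>. U2 q \<omega> \<partial>M) \<le> (2 + 2 * sqrt C) * entropy_term q" by metis
  have "\<exists>U. integrable M U \<and> (\<forall>f\<in>F. \<forall>\<omega>. \<bar>T (D3 q f) \<omega>\<bar> \<le> U \<omega>) \<and> (\<integral>\<omega>. U \<omega> \<partial>M) \<le> (2 + 2 * sqrt C) * entropy_term q"
    if q: "q0 \<le> q" for q
  proof -
    have cells: "D3 q f = D3 q (proj (Suc q) f)" if "f \<in> F" for f
      unfolding D3_def using small_proj[of q "Suc q" f q0] that proj_proj[of _ "Suc q" f] by auto
    show ?thesis
    proof (rule link_bound[of "D3 q" q])
      show "D3 q ` F = D3 q ` proj (Suc q) ` F" using cells proj_in by (force simp: image_iff)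
      show "D3 q f \<in> borel_measurable borel" if "f \<in> F" for f
        unfolding D3_def using pb[OF that] small_borel[OF that, of q0 q] by measurable
      show b: "\<bar>D3 q f y\<bar> \<le> width q f y" if "f \<in> F" for f y
        unfolding D3_def using width_nonneg[OF that, of q y] proj_step[OF that, of q y] by (auto simp: abs_mult)
      show "\<bar>D3 q f y\<bar> \<le> sqrt r * level q" if "f \<in> F" for f y
        using b[OF that, of y] smallD[of q f y] q level_pos[of q] r_pos
        by (cases "small q0 q f y") (auto simp: D3_def)
    qed blast
  qed
  then obtain U3 where U3: "\<And>q. q0 \<le> q \<Longrightarrow> integrable M (U3 q)" "\<And>q f \<omega>. q0 \<le> q \<Longrightarrow> f \<in> F \<Longrightarrow> \<bar>T (D3 q f) \<omega>\<bar> \<le> U3 q \<omega>"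
    "\<And>q. q0 \<le> q \<Longrightarrow> (\<integral>\<omega>. U3 q \<omega> \<partial>M) \<le> (2 + 2 * sqrt C) * entropy_term q" by metis
  have W4b: "W4 f \<in> borel_measurable borel" if "f \<in> F" for f
    unfolding W4_def using width_borel[OF that, of q1] small_borel[OF that, of q0 q1] by measurable
  have W4w: "\<bar>W4 f y\<bar> \<le> width q1 f y" if "f \<in> F" for f y
    unfolding W4_def using width_nonneg[OF that] by (auto simp: abs_mult)
  have "\<exists>U. integrable M U \<and> (\<forall>f\<in>F. \<forall>\<omega>. \<bar>T (W4 f) \<omega>\<bar> \<le> U \<omega>) \<and> (\<integral>\<omega>. U \<omega> \<partial>M) \<le> (2 + 2 * sqrt C) * entropy_term q1"
  proof -
    have cells: "W4 f = W4 (proj (Suc q1) f)" if "f \<in> F" for f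
      unfolding W4_def using small_proj[of q1 "Suc q1" f q0] width_proj_le[of q1 "Suc q1" f] that by auto
    show ?thesis
    proof (rule link_bound[of W4 q1])
      show "W4 ` F = W4 ` proj (Suc q1) ` F" using cells proj_in by (force simp: image_iff)
      show "\<bar>W4 f y\<bar> \<le> sqrt r * level q1" if "f \<in> F" for f y
        using W4w[OF that, of y] smallD[of q1 f y] q1 level_pos[of q1] r_pos
        by (cases "small q0 q1 f y") (auto simp: W4_def)
    qed (use W4b W4w in blast)+
  qed
  then obtain U4 where U4: "integrable M U4" "\<And>f \<omega>. f \<in> F \<Longrightarrow> \<bar>T (W4 f) \<omega>\<bar> \<le> U4 \<omega>"
    "(\<integral>\<omega>. U4 \<omega> \<partial>M) \<le> (2 + 2 * sqrt C) * entropy_term q1" by metis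
  \<comment> \<open>all functions involved are dominated by a multiple of the envelope\<close>
  have w1b: "w1 \<in> borel_measurable borel" unfolding w1_def by measurable
  have w1t: "test w1"
    by (rule test_envelope[OF w1b, of 2]) (use env_nonneg in \<open>auto simp: w1_def\<close>)
  have D1b: "D1 f \<in> borel_measurable borel" if "f \<in> F" for f
    unfolding D1_def using fb[OF that] pb[OF that] small_borel[OF that] by measurable
  have D2b: "D2 q f \<in> borel_measurable borel" if "f \<in> F" for f q
    unfolding D2_def using fb[OF that] pb[OF that] exits_borel[OF that] by measurable
  have D3b: "D3 q f \<in> borel_measurable borel" if "f \<in> F" for f q
    unfolding D3_def using pb[OF that] small_borel[OF that] by measurable
  have D4b: "D4 f \<in> borel_measurable borel" if "f \<in> F" for f
    unfolding D4_def using fb[OF that] pb[OF that] small_borel[OF that] by measurable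
  have W2b: "W2 q f \<in> borel_measurable borel" if "f \<in> F" for f q
    unfolding W2_def using width_borel[OF that, of "Suc q"] exits_borel[OF that, of q0 q] by measurable
  have D1w: "\<bar>D1 f y\<bar> \<le> w1 y" if f: "f \<in> F" for f y
  proof (cases "small q0 q0 f y")
    case False
    then have "sqrt r * level q0 < 2 * env y" using width_env[OF f, of q0 y] by (auto simp: small_def)
    then show ?thesis using False proj_near[OF f, of y q0] width_env[OF f, of q0 y] by (auto simp: D1_def w1_def)
  qed (use env_nonneg in \<open>auto simp: D1_def w1_def\<close>)
  have D2w: "\<bar>D2 q f y\<bar> \<le> W2 q f y" if f: "f \<in> F" for f q y
    unfolding D2_def W2_def using proj_near[OF f, of y "Suc q"] by (auto simp: abs_mult)
  have D4w: "\<bar>D4 f y\<bar> \<le> W4 f y" if f: "f \<in> F" for f y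
    unfolding D4_def W4_def using proj_near[OF f, of y q1] by (auto simp: abs_mult)
  have D3w: "\<bar>D3 q f y\<bar> \<le> 2 * env y" if f: "f \<in> F" for f q y
    unfolding D3_def using proj_step[OF f, of q y] width_env[OF f, of q y] env_nonneg[of y] by (auto simp: abs_mult)
  have W2w: "\<bar>W2 q f y\<bar> \<le> 2 * env y" if f: "f \<in> F" for f q y
    unfolding W2_def using width_nonneg[OF f, of "Suc q" y] width_env[OF f, of "Suc q" y] env_nonneg[of y] by (auto simp: abs_mult)
  have W2t: "test (W2 q f)" if "f \<in> F" for q f by (rule test_envelope[OF W2b[OF that] W2w[OF that]])
  have W4t: "test (W4 f)" if "f \<in> F" for f
    by (rule test_envelope[OF W4b[OF that], of 2]) (use W4w[OF that] width_env[OF that] order_trans in blast)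
  have D1t: "test (D1 f)" if "f \<in> F" for f by (rule test_bounded[OF w1t D1b[OF that] D1w[OF that]])
  have D2t: "test (D2 q f)" if "f \<in> F" for q f by (rule test_bounded[OF W2t[OF that] D2b[OF that] D2w[OF that]])
  have D3t: "test (D3 q f)" if "f \<in> F" for q f by (rule test_envelope[OF D3b[OF that] D3w[OF that]])
  have D4t: "test (D4 f)" if "f \<in> F" for f by (rule test_bounded[OF W4t[OF that] D4b[OF that] D4w[OF that]])
  have Ft: "test f" if "f \<in> F" for f by (rule test_envelope[OF fb[OF that], of 1]) (use env[OF that] in auto)
  define U where "U \<omega> = (\<bar>T w1 \<omega>\<bar> + 2 * C * sqrt r * (\<integral>y. w1 y \<partial>P))
      + (\<Sum>q\<in>{q0..<q1}. (U2 q \<omega> + 2 * C * entropy_term (Suc q)) + U3 q \<omega>)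
      + (U4 \<omega> + 2 * C * (1/2)^q0)" for \<omega>
  have bound: "\<bar>T f \<omega> - T (proj q0 f) \<omega>\<bar> \<le> U \<omega>" if f: "f \<in> F" for f \<omega>
  proof -
    have "T f \<omega> - T (proj q0 f) \<omega> = T (\<lambda>y. f y - proj q0 f y) \<omega>"
      using T_diff[OF Ft[OF f] Ft[OF proj_in[OF f]]] by simp
    also have "\<dots> = T (\<lambda>y. D1 f y + (\<Sum>q\<in>{q0..<q1}. D2 q f y + D3 q f y) + D4 f y) \<omega>"
      using chain_identity[OF q1(1), of f] by (simp add: D1_def D2_def D3_def D4_def)
    also have "\<dots> = T (D1 f) \<omega> + (\<Sum>q\<in>{q0..<q1}. T (D2 q f) \<omega> + T (D3 q f) \<omega>) + T (D4 f) \<omega>"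
      using D1t[OF f] D2t[OF f] D3t[OF f] D4t[OF f]
      by (simp add: T_add T_sum test_add test_sum)
    finally have eq: "T f \<omega> - T (proj q0 f) \<omega> = T (D1 f) \<omega> + (\<Sum>q\<in>{q0..<q1}. T (D2 q f) \<omega> + T (D3 q f) \<omega>) + T (D4 f) \<omega>" .
    have b1: "\<bar>T (D1 f) \<omega>\<bar> \<le> \<bar>T w1 \<omega>\<bar> + 2 * C * sqrt r * (\<integral>y. w1 y \<partial>P)"
      by (rule T_abs_le[OF w1t D1b[OF f] D1w[OF f]])
    have b2: "\<bar>T (D2 q f) \<omega> + T (D3 q f) \<omega>\<bar> \<le> (U2 q \<omega> + 2 * C * entropy_term (Suc q)) + U3 q \<omega>"
      if q: "q \<in> {q0..<q1}" for q
    proof -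
      have "2 * C * sqrt r * (\<integral>y. W2 q f y \<partial>P) \<le> 2 * C * entropy_term (Suc q)"
        using exit_mean[OF f, of q0 q] q unfolding W2_def by simp
      moreover have "\<bar>T (W2 q f) \<omega>\<bar> \<le> U2 q \<omega>" "\<bar>T (D3 q f) \<omega>\<bar> \<le> U3 q \<omega>"
        using U2(2)[of q f \<omega>] U3(2)[of q f \<omega>] q f by auto
      ultimately show ?thesis
        using T_abs_le[OF W2t[OF f] D2b[OF f] D2w[OF f], of q \<omega>] by linarith
    qed
    have b4: "\<bar>T (D4 f) \<omega>\<bar> \<le> U4 \<omega> + 2 * C * (1/2)^q0"
    proof -
      have "(\<integral>y. W4 f y \<partial>P) \<le> (\<integral>y. width q1 f y \<partial>P)"
        using W4t[OF f] width_integrable(2)[OF f] W4w[OF f] 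
        by (intro integral_mono) (auto simp: test_def abs_le_iff)
      also have "\<dots> \<le> (1/2)^q1" by (rule width_L1[OF f])
      finally have "2 * C * (sqrt r * (\<integral>y. W4 f y \<partial>P)) \<le> 2 * C * (sqrt r * (1/2)^q1)"
        using C_pos r_pos by (intro mult_left_mono) auto
      also have "\<dots> \<le> 2 * C * (1/2)^q0" using q1(2) C_pos by (intro mult_left_mono) auto
      finally show ?thesis
        using T_abs_le[OF W4t[OF f] D4b[OF f] D4w[OF f], of \<omega>] U4(2)[OF f, of \<omega>] by (simp add: mult.assoc)
    qed
    have "\<bar>\<Sum>q\<in>{q0..<q1}. T (D2 q f) \<omega> + T (D3 q f) \<omega>\<bar> \<le> (\<Sum>q\<in>{q0..<q1}. (U2 q \<omega> + 2 * C * entropy_term (Suc q)) + U3 q \<omega>)"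
      using b2 by (intro order_trans[OF sum_abs] sum_mono)
    then show ?thesis using b1 b4 unfolding eq U_def by linarith
  qed
  have iU: "integrable M U"
    unfolding U_def using U2(1) U3(1) U4(1) T_integrable[OF w1t]
    by (intro Bochner_Integration.integrable_add Bochner_Integration.integrable_sum integrable_abs) auto
  have iS: "integrable M (\<lambda>\<omega>. \<Sum>q\<in>{q0..<q1}. (U2 q \<omega> + 2 * C * entropy_term (Suc q)) + U3 q \<omega>)"
    using U2(1) U3(1) by (intro Bochner_Integration.integrable_add Bochner_Integration.integrable_sum) auto
  let ?E = "\<Sum>i. entropy_term (i + q0)"
  have "(\<integral>\<omega>. U \<omega> \<partial>M) = ((\<integral>\<omega>. \<bar>T w1 \<omega>\<bar> \<partial>M) + 2 * C * sqrt r * (\<integral>y. w1 y \<partial>P))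
      + (\<integral>\<omega>. (\<Sum>q\<in>{q0..<q1}. (U2 q \<omega> + 2 * C * entropy_term (Suc q)) + U3 q \<omega>) \<partial>M)
      + ((\<integral>\<omega>. U4 \<omega> \<partial>M) + 2 * C * (1/2)^q0)"
    (is "_ = _ + ?S + _") unfolding U_def using iS U4(1) T_integrable[OF w1t] by (simp add: prob_space)
  moreover have "?S \<le> (4 + 4 * sqrt C) * ?E + 2 * C * ?E"
  proof -
  have "?S = (\<Sum>q\<in>{q0..<q1}. ((\<integral>\<omega>. U2 q \<omega> \<partial>M) + 2 * C * entropy_term (Suc q)) + (\<integral>\<omega>. U3 q \<omega> \<partial>M))"
    using U2(1) U3(1) by (subst Bochner_Integration.integral_sum) (auto simp: prob_space)
  also have "\<dots> \<le> (\<Sum>q\<in>{q0..<q1}. ((2 + 2 * sqrt C) * entropy_term q + 2 * C * entropy_term (Suc q)) + (2 + 2 * sqrt C) * entropy_term q)"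
    using U2(3) U3(3) by (intro sum_mono add_mono) auto
  also have "\<dots> = (4 + 4 * sqrt C) * (\<Sum>q\<in>{q0..<q1}. entropy_term q) + 2 * C * (\<Sum>q\<in>{q0..<q1}. entropy_term (Suc q))"
    by (simp add: sum.distrib sum_distrib_left algebra_simps)
  also have "\<dots> \<le> (4 + 4 * sqrt C) * ?E + 2 * C * ?E"
  proof (intro add_mono mult_left_mono)
    have "(\<Sum>q\<in>{q0..<q1}. entropy_term (Suc q)) = (\<Sum>q\<in>{Suc q0..<Suc q1}. entropy_term q)"
      by (rule sum.shift_bounds_Suc_ivl[symmetric])
    also have "\<dots> \<le> (\<Sum>q\<in>{q0..<Suc q1}. entropy_term q)"
      using entropy_term_pos by (intro sum_mono2) (auto intro: less_imp_le)
    also have "\<dots> \<le> ?E" by (rule sum_entropy_le)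
    finally show "(\<Sum>q\<in>{q0..<q1}. entropy_term (Suc q)) \<le> ?E" .
  qed (use C_pos sum_entropy_le in auto)
  finally show ?thesis .
  qed
  moreover have "(\<integral>\<omega>. U4 \<omega> \<partial>M) \<le> (2 + 2 * sqrt C) * ?E"
  proof -
    have "entropy_term q1 \<le> (\<Sum>q\<in>{q0..<Suc q1}. entropy_term q)"
      using q1(1) entropy_term_pos by (intro member_le_sum) (auto intro: less_imp_le)
    also have "\<dots> \<le> ?E" by (rule sum_entropy_le)
    finally have "(2 + 2 * sqrt C) * entropy_term q1 \<le> (2 + 2 * sqrt C) * ?E" using C_pos by (intro mult_left_mono) auto
    then show ?thesis using U4(3) by linarith
  qed
  moreover have "(\<integral>\<omega>. \<bar>T w1 \<omega>\<bar> \<partial>M) \<le> 2 * C * sqrt r * (\<integral>y. w1 y \<partial>P)"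
    by (rule expectation_T_abs_le[OF w1t]) (use env_nonneg in \<open>auto simp: w1_def\<close>)
  moreover have "(4 + 4 * sqrt C) * ?E + 2 * C * ?E + (2 + 2 * sqrt C) * ?E = (6 + 6 * sqrt C + 2 * C) * ?E"
    by (simp add: algebra_simps)
  ultimately have "(\<integral>\<omega>. U \<omega> \<partial>M) \<le> 4 * C * sqrt r * (\<integral>y. w1 y \<partial>P) + (6 + 6 * sqrt C + 2 * C) * ?E + 2 * C * (1/2)^q0"
    by linarith
  with iU bound show ?thesis using that unfolding w1_def by blast
qed

end

section \<open>Centred normal laws\<close>

definition std_gauss :: "real measure" where
  "std_gauss = std_normal_distribution"

lemma sets_std_gauss [simp, measurable_cong]: "sets std_gauss = sets borel"
  unfolding std_gauss_def by simp

interpretation std_gauss: prob_space std_gauss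
  unfolding std_gauss_def by (rule prob_space_normal_density) simp

lemma std_gauss_moments:
  "integrable std_gauss (\<lambda>x. x)" "(\<integral>x. x \<partial>std_gauss) = 0"
  "integrable std_gauss (\<lambda>x. x\<^sup>2)" "(\<integral>x. x\<^sup>2 \<partial>std_gauss) = 1"
  using integrable_std_normal_distribution_moment[of 1] integral_std_normal_distribution_moment_odd[of 1]
    integrable_std_normal_distribution_moment[of 2] std_normal_distribution_even_moments(1)[of 1]
  unfolding std_gauss_def[symmetric] by (simp_all add: fact_2)

text \<open>The image of the standard normal law under scaling; unlike a density, it makes sense for
  \<open>\<sigma> = 0\<close> too.\<close>

definition normal_law :: "real \<Rightarrow> real measure" where
  "normal_law \<sigma> = distr std_gauss borel (\<lambda>x. \<sigma> * x)"

lemma normal_law_real_distribution: "real_distribution (normal_law \<sigma>)"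
  unfolding normal_law_def by (rule std_gauss.real_distribution_distr) measurable

lemma integral_normal_law:
  fixes h :: "real \<Rightarrow> 'b::{banach, second_countable_topology}"
  assumes "h \<in> borel_measurable borel"
  shows "(\<integral>x. h x \<partial>normal_law \<sigma>) = (\<integral>x. h (\<sigma> * x) \<partial>std_gauss)"
    "integrable (normal_law \<sigma>) h \<longleftrightarrow> integrable std_gauss (\<lambda>x. h (\<sigma> * x))"
proof -
  have m: "(\<lambda>x. \<sigma> * x) \<in> measurable std_gauss borel" by measurable
  show "(\<integral>x. h x \<partial>normal_law \<sigma>) = (\<integral>x. h (\<sigma> * x) \<partial>std_gauss)"
    unfolding normal_law_def by (rule integral_distr[OF m assms])
  show "integrable (normal_law \<sigma>) h \<longleftrightarrow> integrable std_gauss (\<lambda>x. h (\<sigma> * x))"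
    unfolding normal_law_def by (rule integrable_distr_eq[OF m assms])
qed

lemma char_normal_law: "char (normal_law \<sigma>) t = exp (- (t\<^sup>2 * \<sigma>\<^sup>2) / 2)"
proof -
  have "char (normal_law \<sigma>) t = char std_gauss (t * \<sigma>)"
    unfolding char_def by (subst integral_normal_law) (simp_all add: mult.assoc)
  also have "\<dots> = exp (- (t\<^sup>2 * \<sigma>\<^sup>2) / 2)"
    unfolding std_gauss_def by (simp add: char_std_normal_distribution power_mult_distrib)
  finally show ?thesis .
qed

lemma gaussian_normal_law: "gaussian_law (normal_law \<sigma>)"
proof (cases "\<sigma> = 0")
  case True
  then have "normal_law \<sigma> = distr std_gauss borel (\<lambda>x. 0)"
    unfolding normal_law_def by (intro distr_cong) auto
  also have "\<dots> = return borel 0" by (rule std_gauss.distr_const) simp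
  finally show ?thesis unfolding gaussian_law_def by blast
next
  case False
  have "distributed std_gauss lborel (\<lambda>x. x) std_normal_density"
  proof -
    have "distr std_gauss lborel (\<lambda>x. x) = std_gauss" by (rule distr_id2) simp
    then show ?thesis unfolding distributed_def by (simp add: std_gauss_def)
  qed
  from std_gauss.normal_density_affine[OF this, of \<sigma> 0] False
  have "distributed std_gauss lborel (\<lambda>x. \<sigma> * x) (normal_density 0 \<bar>\<sigma>\<bar>)" by simp
  then have "distr std_gauss lborel (\<lambda>x. \<sigma> * x) = density lborel (normal_density 0 \<bar>\<sigma>\<bar>)"
    by (simp add: distributed_def)
  moreover have "distr std_gauss lborel (\<lambda>x. \<sigma> * x) = normal_law \<sigma>"
    unfolding normal_law_def by (rule distr_cong) auto
  ultimately have "normal_law \<sigma> = density lborel (normal_density 0 \<bar>\<sigma>\<bar>)" by simp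
  moreover have "\<bar>\<sigma>\<bar> > 0" using False by simp
  ultimately show ?thesis unfolding gaussian_law_def by blast
qed

lemma normal_law_moments:
  "integrable (normal_law \<sigma>) (\<lambda>x. x)" "(\<integral>x. x \<partial>normal_law \<sigma>) = 0"
  "integrable (normal_law \<sigma>) (\<lambda>x. x\<^sup>2)" "(\<integral>x. x\<^sup>2 \<partial>normal_law \<sigma>) = \<sigma>\<^sup>2"
proof -
  have "integrable std_gauss (\<lambda>x. \<sigma> * x)" by (rule integrable_mult_right[OF std_gauss_moments(1)])
  then show "integrable (normal_law \<sigma>) (\<lambda>x. x)" by (subst integral_normal_law) simp_all
  have "integrable std_gauss (\<lambda>x. \<sigma>\<^sup>2 * x\<^sup>2)" by (rule integrable_mult_right[OF std_gauss_moments(3)])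
  then show "integrable (normal_law \<sigma>) (\<lambda>x. x\<^sup>2)"
    by (subst integral_normal_law) (simp_all only: power_mult_distrib, measurable)
  have "(\<integral>x. x \<partial>normal_law \<sigma>) = (\<integral>x. \<sigma> * x \<partial>std_gauss)" by (rule integral_normal_law) measurable
  also have "\<dots> = \<sigma> * (\<integral>x. x \<partial>std_gauss)" by (rule integral_mult_right_zero)
  finally show "(\<integral>x. x \<partial>normal_law \<sigma>) = 0" by (simp only: std_gauss_moments(2) mult_zero_right)
  have "(\<integral>x. x\<^sup>2 \<partial>normal_law \<sigma>) = (\<integral>x. (\<sigma> * x)\<^sup>2 \<partial>std_gauss)" by (rule integral_normal_law) measurable
  also have "\<dots> = \<sigma>\<^sup>2 * (\<integral>x. x\<^sup>2 \<partial>std_gauss)" unfolding power_mult_distrib by (rule integral_mult_right_zero)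
  finally show "(\<integral>x. x\<^sup>2 \<partial>normal_law \<sigma>) = \<sigma>\<^sup>2" by (simp only: std_gauss_moments(4) mult_1_right)
qed

lemma normal_law_mgf:
  "integrable (normal_law \<sigma>) (\<lambda>x. exp (s * x))" "(\<integral>x. exp (s * x) \<partial>normal_law \<sigma>) = exp (s\<^sup>2 * \<sigma>\<^sup>2 / 2)"
proof -
  define a where "a = s * \<sigma>"
  have eq: "std_normal_density x * exp (a * x) = exp (a\<^sup>2 / 2) * normal_density a 1 x" for x
  proof -
    have "- x\<^sup>2 / 2 + a * x = a\<^sup>2/2 + (- (x - a)\<^sup>2 / 2)" by (simp add: power2_eq_square field_simps)
    then have "exp (- x\<^sup>2 / 2) * exp (a * x) = exp (a\<^sup>2/2) * exp (- (x - a)\<^sup>2 / 2)" by (simp flip: exp_add)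
    then show ?thesis unfolding normal_density_def by (simp add: field_simps)
  qed
  have i: "integrable std_gauss (\<lambda>x. exp (a * x))"
    unfolding std_gauss_def by (subst integrable_density) (auto simp: normal_density_nonneg eq)
  have v: "(\<integral>x. exp (a * x) \<partial>std_gauss) = exp (a\<^sup>2 / 2)"
    unfolding std_gauss_def by (subst integral_density) (auto simp: normal_density_nonneg eq)
  have assoc: "s * (\<sigma> * x) = a * x" for x by (simp add: a_def)
  show "integrable (normal_law \<sigma>) (\<lambda>x. exp (s * x))"
    by (subst integral_normal_law) (simp_all only: assoc i, measurable)
  show "(\<integral>x. exp (s * x) \<partial>normal_law \<sigma>) = exp (s\<^sup>2 * \<sigma>\<^sup>2 / 2)"
    by (subst integral_normal_law) (simp_all only: assoc v, measurable, simp add: a_def power_mult_distrib)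
qed

definition white_noise :: "(nat \<Rightarrow> real) measure" where
  "white_noise = PiM UNIV (\<lambda>_. std_gauss)"

lemma prob_space_white_noise: "prob_space white_noise"
  unfolding white_noise_def by (rule prob_space_PiM) (rule std_gauss.prob_space_axioms)

interpretation white_noise: prob_space white_noise by (rule prob_space_white_noise)

lemma white_noise_coordinate [measurable]: "(\<lambda>\<omega>. \<omega> i) \<in> borel_measurable white_noise"
proof -
  have "(\<lambda>\<omega>. \<omega> i) \<in> measurable white_noise std_gauss"
    unfolding white_noise_def by (rule measurable_component_singleton) simp
  moreover have "sets std_gauss = sets borel" by simp
  ultimately show ?thesis using measurable_cong_sets by blast
qed

lemma distr_white_noise: "distr white_noise borel (\<lambda>\<omega>. \<omega> i) = std_gauss"
proof -
  interpret product_prob_space "\<lambda>_::nat. std_gauss" UNIV by unfold_locales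
  have "distr white_noise std_gauss (\<lambda>\<omega>. \<omega> i) = std_gauss"
    unfolding white_noise_def by (rule PiM_component) simp
  moreover have "distr white_noise std_gauss (\<lambda>\<omega>. \<omega> i) = distr white_noise borel (\<lambda>\<omega>. \<omega> i)"
    by (rule distr_cong) auto
  ultimately show ?thesis by simp
qed

lemma indep_white_noise: "white_noise.indep_vars (\<lambda>_. borel) (\<lambda>i \<omega>. \<omega> i) UNIV"
proof (subst white_noise.indep_vars_iff_distr_eq_PiM')
  have s: "sets white_noise = sets (PiM UNIV (\<lambda>i::nat. borel :: real measure))"
    unfolding white_noise_def by (intro sets_PiM_cong) auto
  have "distr white_noise (PiM UNIV (\<lambda>i. borel)) (\<lambda>x. \<lambda>i\<in>UNIV. x i) = distr white_noise white_noise (\<lambda>x. x)"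
    by (rule distr_cong) (auto simp: s)
  also have "\<dots> = white_noise" by (simp add: distr_id2)
  also have "\<dots> = PiM UNIV (\<lambda>i. distr white_noise borel (\<lambda>\<omega>. \<omega> i))"
    unfolding distr_white_noise unfolding white_noise_def ..
  finally show "distr white_noise (PiM UNIV (\<lambda>i. borel)) (\<lambda>x. \<lambda>i\<in>UNIV. x i) = PiM UNIV (\<lambda>i. distr white_noise borel (\<lambda>\<omega>. \<omega> i))" .
qed auto

lemma distr_white_noise_sum:
  "distr white_noise borel (\<lambda>\<omega>. \<Sum>l<m. b l * \<omega> l) = normal_law (sqrt (\<Sum>l<m. (b l)\<^sup>2))"
proof (rule Levy_uniqueness[OF _ normal_law_real_distribution], rule white_noise.real_distribution_distr)
  show "char (distr white_noise borel (\<lambda>\<omega>. \<Sum>l<m. b l * \<omega> l)) = char (normal_law (sqrt (\<Sum>l<m. (b l)\<^sup>2)))"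
  proof
    fix t
    have ind: "white_noise.indep_vars (\<lambda>_. borel) (\<lambda>l \<omega>. b l * \<omega> l) {..<m}"
      by (rule white_noise.indep_vars_compose2[OF white_noise.indep_vars_subset[OF indep_white_noise], where Y="\<lambda>l x. b l * x"]) auto
    have "char (distr white_noise borel (\<lambda>\<omega>. b l * \<omega> l)) t = exp (- (t\<^sup>2 * (b l)\<^sup>2) / 2)" for l
    proof -
      have "distr white_noise borel (\<lambda>\<omega>. b l * \<omega> l) = normal_law (b l)"
        unfolding normal_law_def distr_white_noise[of l, symmetric] by (subst distr_distr) (auto simp: comp_def)
      then show ?thesis by (simp add: char_normal_law)
    qed
    then have "char (distr white_noise borel (\<lambda>\<omega>. \<Sum>l<m. b l * \<omega> l)) t = (\<Prod>l<m. complex_of_real (exp (- (t\<^sup>2 * (b l)\<^sup>2) / 2)))"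
      using white_noise.char_distr_sum[OF ind, of t] by simp
    also have "\<dots> = complex_of_real (exp (\<Sum>l<m. - (t\<^sup>2 * (b l)\<^sup>2) / 2))"
      by (simp only: of_real_prod[symmetric] exp_sum[OF finite_lessThan])
    also have "(\<Sum>l<m. - (t\<^sup>2 * (b l)\<^sup>2) / 2) = - (t\<^sup>2 * (\<Sum>l<m. (b l)\<^sup>2)) / 2"
      by (simp add: sum_negf sum_divide_distrib sum_distrib_left)
    finally show "char (distr white_noise borel (\<lambda>\<omega>. \<Sum>l<m. b l * \<omega> l)) t = char (normal_law (sqrt (\<Sum>l<m. (b l)\<^sup>2))) t"
      by (simp add: char_normal_law sum_nonneg)
  qed
qed auto

section \<open>Gaussian sequences with prescribed covariance\<close>

definition square_integrable :: "'a measure \<Rightarrow> ('a \<Rightarrow> real) \<Rightarrow> bool" where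
  "square_integrable P f \<longleftrightarrow> f \<in> borel_measurable P \<and> integrable P (\<lambda>y. (f y)\<^sup>2)"

definition ip :: "'a measure \<Rightarrow> ('a \<Rightarrow> real) \<Rightarrow> ('a \<Rightarrow> real) \<Rightarrow> real" where
  "ip P f g = (\<integral>y. f y * g y \<partial>P)"

lemma square_integrable_mult:
  assumes "square_integrable P f" "square_integrable P g"
  shows "integrable P (\<lambda>y. f y * g y)"
proof (rule Bochner_Integration.integrable_bound)
  show "integrable P (\<lambda>y. (f y)\<^sup>2 + (g y)\<^sup>2)" using assms by (auto simp: square_integrable_def)
  show "(\<lambda>y. f y * g y) \<in> borel_measurable P" using assms by (auto simp: square_integrable_def)
  have "\<bar>a * b\<bar> \<le> a\<^sup>2 + b\<^sup>2" for a b :: real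
  proof -
    have "2 * \<bar>a * b\<bar> \<le> a\<^sup>2 + b\<^sup>2" using sum_squares_bound[of "\<bar>a\<bar>" "\<bar>b\<bar>"] by (simp add: abs_mult)
    moreover have "0 \<le> \<bar>a * b\<bar>" by simp
    ultimately show ?thesis by linarith
  qed
  then show "AE y in P. norm (f y * g y) \<le> norm ((f y)\<^sup>2 + (g y)\<^sup>2)" by (auto simp: abs_mult)
qed

lemma square_integrable_add:
  assumes "square_integrable P f" "square_integrable P g"
  shows "square_integrable P (\<lambda>y. f y + g y)"
proof -
  have "(\<lambda>y. (f y + g y)\<^sup>2) = (\<lambda>y. (f y)\<^sup>2 + (g y)\<^sup>2 + 2 * (f y * g y))"
    by (simp add: power2_eq_square algebra_simps)
  then show ?thesis
    using square_integrable_mult[OF assms] assms by (auto simp: square_integrable_def)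
qed

lemma square_integrable_scale: "square_integrable P f \<Longrightarrow> square_integrable P (\<lambda>y. c * f y)"
  by (auto simp: square_integrable_def power_mult_distrib)

lemma square_integrable_zero: "square_integrable P (\<lambda>y. 0)"
  by (auto simp: square_integrable_def)

lemma square_integrable_sum:
  "(\<And>i. i \<in> I \<Longrightarrow> square_integrable P (f i)) \<Longrightarrow> square_integrable P (\<lambda>y. \<Sum>i\<in>I. f i y)"
  by (induction I rule: infinite_finite_induct) (auto intro: square_integrable_zero square_integrable_add)

lemma square_integrable_lincomb:
  "(\<And>i. i \<in> I \<Longrightarrow> square_integrable P (f i)) \<Longrightarrow> square_integrable P (\<lambda>y. \<Sum>i\<in>I. c i * f i y)"
  by (intro square_integrable_sum square_integrable_scale)

lemma square_integrable_diff:
  assumes "square_integrable P f" "square_integrable P g"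
  shows "square_integrable P (\<lambda>y. f y - g y)"
  using square_integrable_add[OF assms(1) square_integrable_scale[OF assms(2), of "-1"]] by simp

lemma ip_commute: "ip P f g = ip P g f"
  by (simp add: ip_def mult.commute)

lemma ip_scale: "ip P (\<lambda>y. c * f y) g = c * ip P f g"
  by (simp add: ip_def mult.assoc)

lemma ip_sum:
  assumes "finite I" "\<And>i. i \<in> I \<Longrightarrow> square_integrable P (f i)" "square_integrable P g"
  shows "ip P (\<lambda>y. \<Sum>i\<in>I. c i * f i y) g = (\<Sum>i\<in>I. c i * ip P (f i) g)"
proof -
  have "ip P (\<lambda>y. \<Sum>i\<in>I. c i * f i y) g = (\<integral>y. (\<Sum>i\<in>I. c i * (f i y * g y)) \<partial>P)"
    unfolding ip_def by (simp add: sum_distrib_right mult.assoc)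
  also have "\<dots> = (\<Sum>i\<in>I. c i * ip P (f i) g)"
    unfolding ip_def using square_integrable_mult[OF assms(2,3)]
    by (subst Bochner_Integration.integral_sum) auto
  finally show ?thesis .
qed

lemma ip_diff:
  assumes "square_integrable P f" "square_integrable P f'" "square_integrable P g"
  shows "ip P (\<lambda>y. f y - f' y) g = ip P f g - ip P f' g"
  unfolding ip_def using square_integrable_mult[OF assms(1,3)] square_integrable_mult[OF assms(2,3)]
  by (simp add: left_diff_distrib)

lemma ip_null:
  assumes "square_integrable P v" "ip P v v = 0"
  shows "ip P v h = 0"
proof -
  have "(\<integral>y. (v y)\<^sup>2 \<partial>P) = 0" using assms(2) by (simp add: ip_def power2_eq_square)
  then have "AE y in P. (v y)\<^sup>2 = 0"
    using assms(1) by (subst (asm) integral_nonneg_eq_0_iff_AE) (auto simp: square_integrable_def)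
  then have "AE y in P. v y * h y = 0" by auto
  then show ?thesis unfolding ip_def by (rule integral_eq_zero_AE)
qed

text \<open>Vectors whose component orthogonal to their predecessors vanishes become 0, so that linearly
  dependent sequences are covered.\<close>

function gram_schmidt :: "'a measure \<Rightarrow> (nat \<Rightarrow> 'a \<Rightarrow> real) \<Rightarrow> nat \<Rightarrow> 'a \<Rightarrow> real" where
  "gram_schmidt P g n =
     (let v = (\<lambda>y. g n y - (\<Sum>l<n. ip P (g n) (gram_schmidt P g l) * gram_schmidt P g l y))
      in if ip P v v = 0 then (\<lambda>_. 0) else (\<lambda>y. v y / sqrt (ip P v v)))"
  by pat_completeness auto
termination by (relation "Wellfounded.measure (\<lambda>(P, g, n). n)") auto

declare gram_schmidt.simps [simp del]

context
  fixes P :: "'a measure" and g :: "nat \<Rightarrow> 'a \<Rightarrow> real"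
  assumes g: "\<And>n. square_integrable P (g n)"
begin

abbreviation "ons \<equiv> gram_schmidt P g"

abbreviation "orth_part n \<equiv> (\<lambda>y. g n y - (\<Sum>l<n. ip P (g n) (ons l) * ons l y))"

lemma gram_schmidt_cases:
  "(ip P (orth_part n) (orth_part n) = 0 \<and> ons n = (\<lambda>_. 0)) \<or>
   (ip P (orth_part n) (orth_part n) > 0 \<and> ons n = (\<lambda>y. orth_part n y / sqrt (ip P (orth_part n) (orth_part n))))"
proof -
  have "ip P (orth_part n) (orth_part n) \<ge> 0" unfolding ip_def by (rule integral_nonneg_AE) auto
  then show ?thesis by (subst (3 6) gram_schmidt.simps) (auto simp: Let_def)
qed

lemma ons_square_integrable: "square_integrable P (ons n)"
proof (induction n rule: less_induct)
  case (less n)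
  have r: "square_integrable P (orth_part n)"
    using less by (intro square_integrable_diff g square_integrable_lincomb) auto
  show ?case
    using gram_schmidt_cases[of n] square_integrable_scale[OF r, of "1 / sqrt (ip P (orth_part n) (orth_part n))"]
    by (auto simp: square_integrable_zero)
qed

lemma rest_square_integrable: "square_integrable P (orth_part n)"
  by (intro square_integrable_diff g square_integrable_lincomb ons_square_integrable)

lemma ons_orthonormal:
  "(\<forall>l<n. ip P (ons n) (ons l) = 0) \<and> (ip P (ons n) (ons n) = 1 \<or> ons n = (\<lambda>_. 0))"
proof (induction n rule: less_induct)
  case (less n)
  have orth: "ip P (ons k) (ons l) = 0" if "k < n" "l < n" "k \<noteq> l" for k l
    using less[of k] less[of l] that ip_commute[of P "ons k" "ons l"] by (cases "k < l") auto
  have rest_orth: "ip P (orth_part n) (ons l) = 0" if l: "l < n" for l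
  proof -
    have "ip P (orth_part n) (ons l) = ip P (g n) (ons l) - (\<Sum>k<n. ip P (g n) (ons k) * ip P (ons k) (ons l))"
      using g ons_square_integrable
      by (subst ip_diff) (auto simp: ip_sum intro: square_integrable_lincomb)
    also have "(\<Sum>k<n. ip P (g n) (ons k) * ip P (ons k) (ons l)) = (\<Sum>k<n. if k = l then ip P (g n) (ons l) * ip P (ons l) (ons l) else 0)"
      using orth l by (intro sum.cong) auto
    also have "\<dots> = ip P (g n) (ons l)" using l less[OF l] by (auto simp: ip_def)
    finally show ?thesis by simp
  qed
  consider "ons n = (\<lambda>_. 0)" | "ip P (orth_part n) (orth_part n) > 0" "ons n = (\<lambda>y. orth_part n y / sqrt (ip P (orth_part n) (orth_part n)))"
    using gram_schmidt_cases[of n] by auto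
  then show ?case
  proof cases
    case 1
    then show ?thesis by (simp add: ip_def)
  next
    case 2
    let ?s = "sqrt (ip P (orth_part n) (orth_part n))"
    have en: "ons n = (\<lambda>y. (1 / ?s) * orth_part n y)" unfolding 2(2) by simp
    have "ip P (ons n) (ons l) = (1 / ?s) * ip P (orth_part n) (ons l)" for l
      by (subst en) (rule ip_scale)
    moreover have "ip P (orth_part n) (ons n) = (1 / ?s) * ip P (orth_part n) (orth_part n)"
      by (subst ip_commute, subst en, rule ip_scale)
    moreover have "ip P (orth_part n) (orth_part n) = ?s * ?s" "?s \<noteq> 0" using 2(1) by auto
    ultimately show ?thesis using rest_orth by simp
  qed
qed

lemma gram_schmidt_expansion:
  assumes h: "square_integrable P h"
  shows "ip P (g n) h = (\<Sum>l<Suc n. ip P (g n) (ons l) * ip P (ons l) h)"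
proof -
  have rest: "ip P (orth_part n) h' = ip P (g n) h' - (\<Sum>l<n. ip P (g n) (ons l) * ip P (ons l) h')"
    if "square_integrable P h'" for h'
    using that g ons_square_integrable
    by (subst ip_diff) (auto simp: ip_sum intro: square_integrable_lincomb)
  have "ip P (orth_part n) h = ip P (g n) (ons n) * ip P (ons n) h"
  proof -
    consider "ip P (orth_part n) (orth_part n) = 0" "ons n = (\<lambda>_. 0)"
      | "ip P (orth_part n) (orth_part n) > 0" "ons n = (\<lambda>y. orth_part n y / sqrt (ip P (orth_part n) (orth_part n)))"
      using gram_schmidt_cases[of n] by auto
    then show ?thesis
    proof cases
      case 1
      then show ?thesis using ip_null[OF rest_square_integrable 1(1)] by (simp add: ip_def)
    next
      case 2
      let ?s = "sqrt (ip P (orth_part n) (orth_part n))"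
      have s: "?s > 0" using 2(1) by simp
      then have rn: "orth_part n = (\<lambda>y. ?s * ons n y)" unfolding 2(2) by auto
      have sh: "ip P (orth_part n) h' = ?s * ip P (ons n) h'" for h' by (subst rn) (rule ip_scale)
      have "ons n \<noteq> (\<lambda>_. 0)"
      proof
        assume z: "ons n = (\<lambda>_. 0)"
        have "orth_part n = (\<lambda>_. 0)" by (subst rn) (simp add: z)
        then have "ip P (orth_part n) (orth_part n) = 0" by (simp add: ip_def)
        then show False using 2(1) by simp
      qed
      then have 1: "ip P (ons n) (ons n) = 1" using ons_orthonormal[of n] by blast
      have "ip P (orth_part n) (ons n) = ip P (g n) (ons n)"
      proof -
        have "ip P (ons l) (ons n) = 0" if "l < n" for l
          using ons_orthonormal[of n] that by (subst ip_commute) blast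
        then show ?thesis using rest[OF ons_square_integrable[of n]] by simp
      qed
      then have "ip P (g n) (ons n) = ?s" using sh[of "ons n"] 1 by simp
      then show ?thesis using sh[of h] by simp
    qed
  qed
  then show ?thesis using rest[OF h] by (simp add: lessThan_Suc)
qed

text \<open>The expansion of \<open>g n\<close> in the orthonormal system, with the system replaced by independent
  standard normal variables; this map is an isometry, so covariances are inner products.\<close>

definition gaussian_sequence :: "nat \<Rightarrow> (nat \<Rightarrow> real) \<Rightarrow> real" where
  "gaussian_sequence n \<omega> = (\<Sum>l<Suc n. ip P (g n) (ons l) * \<omega> l)"

lemma gaussian_sequence_measurable [measurable]: "gaussian_sequence n \<in> borel_measurable white_noise"
  unfolding gaussian_sequence_def by measurable

lemma distr_gaussian_sequence:
  fixes n :: "'i \<Rightarrow> nat"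
  assumes I: "finite I"
  shows "distr white_noise borel (\<lambda>\<omega>. \<Sum>i\<in>I. c i * gaussian_sequence (n i) \<omega>)
    = normal_law (sqrt (\<integral>y. (\<Sum>i\<in>I. c i * g (n i) y)\<^sup>2 \<partial>P))"
proof -
  define m where "m = Suc (Max (insert 0 (n ` I)))"
  have m: "n i < m" if "i \<in> I" for i
    using that I unfolding m_def by (intro le_imp_less_Suc Max_ge) auto
  define a where "a k l = ip P (g k) (ons l)" for k l
  have above: "a k l = 0" if "k < l" for k l
  proof -
    have "a k l = (\<Sum>j<Suc k. a k j * ip P (ons j) (ons l))"
      unfolding a_def by (rule gram_schmidt_expansion[OF ons_square_integrable])
    also have "\<dots> = 0"
    proof (intro sum.neutral ballI)
      fix j assume "j \<in> {..<Suc k}"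
      then have "ip P (ons l) (ons j) = 0" using ons_orthonormal[of l] that by auto
      then show "a k j * ip P (ons j) (ons l) = 0" by (simp add: ip_commute[of P "ons j" "ons l"])
    qed
    finally show ?thesis .
  qed
  have upto_m: "(\<Sum>l<Suc k. a k l * x l) = (\<Sum>l<m. a k l * x l)" if "k < m" for k and x :: "nat \<Rightarrow> real"
    using that above by (intro sum.mono_neutral_left) auto
  define b where "b l = (\<Sum>i\<in>I. c i * a (n i) l)" for l
  have "(\<Sum>i\<in>I. c i * gaussian_sequence (n i) \<omega>) = (\<Sum>l<m. b l * \<omega> l)" for \<omega>
  proof -
    have "(\<Sum>i\<in>I. c i * gaussian_sequence (n i) \<omega>) = (\<Sum>i\<in>I. c i * (\<Sum>l<m. a (n i) l * \<omega> l))"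
      unfolding gaussian_sequence_def using upto_m m by (intro sum.cong) (auto simp: a_def)
    also have "\<dots> = (\<Sum>l<m. b l * \<omega> l)"
      unfolding b_def sum_distrib_left sum_distrib_right by (subst sum.swap) (simp add: mult.assoc)
    finally show ?thesis .
  qed
  moreover have "(\<Sum>l<m. (b l)\<^sup>2) = (\<integral>y. (\<Sum>i\<in>I. c i * g (n i) y)\<^sup>2 \<partial>P)"
  proof -
    have "(\<integral>y. (\<Sum>i\<in>I. c i * g (n i) y)\<^sup>2 \<partial>P) = ip P (\<lambda>y. \<Sum>i\<in>I. c i * g (n i) y) (\<lambda>y. \<Sum>i\<in>I. c i * g (n i) y)"
      by (simp add: ip_def power2_eq_square)
    also have "\<dots> = (\<Sum>i\<in>I. c i * ip P (g (n i)) (\<lambda>y. \<Sum>j\<in>I. c j * g (n j) y))"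
      using I g by (intro ip_sum) (auto intro: square_integrable_lincomb)
    also have "\<dots> = (\<Sum>i\<in>I. c i * (\<Sum>j\<in>I. c j * ip P (g (n i)) (g (n j))))"
    proof (intro sum.cong refl arg_cong2[where f="(*)"])
      fix i
      show "ip P (g (n i)) (\<lambda>y. \<Sum>j\<in>I. c j * g (n j) y) = (\<Sum>j\<in>I. c j * ip P (g (n i)) (g (n j)))"
        by (subst ip_commute, subst ip_sum) (use I g in \<open>auto simp: ip_commute\<close>)
    qed
    also have "\<dots> = (\<Sum>i\<in>I. c i * (\<Sum>j\<in>I. c j * (\<Sum>l<m. a (n i) l * a (n j) l)))"
    proof (intro sum.cong refl arg_cong2[where f="(*)"])
      fix i j assume "i \<in> I" "j \<in> I"
      have "ip P (g (n i)) (g (n j)) = (\<Sum>l<Suc (n i). a (n i) l * ip P (ons l) (g (n j)))"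
        unfolding a_def by (rule gram_schmidt_expansion[OF g])
      also have "\<dots> = (\<Sum>l<m. a (n i) l * ip P (ons l) (g (n j)))"
        by (rule upto_m) (use m \<open>i \<in> I\<close> in auto)
      finally show "ip P (g (n i)) (g (n j)) = (\<Sum>l<m. a (n i) l * a (n j) l)"
        by (simp add: a_def ip_commute)
    qed
    also have "\<dots> = (\<Sum>l<m. \<Sum>i\<in>I. \<Sum>j\<in>I. c i * (c j * (a (n i) l * a (n j) l)))"
      unfolding sum_distrib_left by (subst sum.swap, intro sum.cong refl) (subst sum.swap, rule refl)
    also have "\<dots> = (\<Sum>l<m. (b l)\<^sup>2)"
      unfolding b_def power2_eq_square sum_product by (intro sum.cong refl) (simp add: mult_ac)
    finally show ?thesis by simp
  qed
  ultimately show ?thesis using distr_white_noise_sum[of b m] by simp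
qed

end

section \<open>The limit law\<close>

text \<open>The function is the distance to the complement, cut off at 1.  It lets Lipschitz functionals detect
  the Borel sets of a metric space that need not be separable.\<close>

lemma open_as_positive_part:
  assumes U: "openin (mtopology_of D) U"
  obtains H where "bounded_lipschitz D 1 1 H" "U = {x \<in> mspace D. H x > 0}"
proof (cases "U = mspace D")
  case True
  then show ?thesis by (intro that[of "\<lambda>_. 1"]) (auto simp: bounded_lipschitz_def)
next
  case False
  interpret D: Metric_space "mspace D" "mdist D" by simp
  have Usub: "U \<subseteq> mspace D" using openin_subset[OF U] by simp
  let ?K = "mspace D - U"
  have K: "?K \<noteq> {}" using False Usub by auto
  define H where "H x = (INF y\<in>?K. min 1 (mdist D x y))" for x
  have bdd: "bdd_below ((\<lambda>y. min 1 (mdist D x y)) ` ?K)" for x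
    by (rule bdd_belowI2[of _ 0]) auto
  have le: "H x \<le> min 1 (mdist D x y)" if "y \<in> ?K" for x y
    unfolding H_def by (rule cINF_lower[OF bdd that])
  have ge: "a \<le> H x" if "\<And>y. y \<in> ?K \<Longrightarrow> a \<le> min 1 (mdist D x y)" for a x
    unfolding H_def using that K by (intro cINF_greatest) auto
  have lip1: "H x \<le> H y + mdist D x y" if xy: "x \<in> mspace D" "y \<in> mspace D" for x y
  proof -
    have "H x - mdist D x y \<le> H y"
    proof (rule ge)
      fix u assume u: "u \<in> ?K"
      have "mdist D x u \<le> mdist D x y + mdist D y u" using xy u by (intro D.triangle) auto
      then show "H x - mdist D x y \<le> min 1 (mdist D y u)" using le[OF u, of x] D.nonneg[of x y] by linarith
    qed
    then show ?thesis by simp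
  qed
  have "bounded_lipschitz D 1 1 H"
    unfolding bounded_lipschitz_def
  proof (intro conjI ballI)
    fix x assume "x \<in> mspace D"
    obtain y where "y \<in> ?K" using K by auto
    then have "H x \<le> 1" using le[of y x] by linarith
    moreover have "0 \<le> H x" by (rule ge) auto
    ultimately show "\<bar>H x\<bar> \<le> 1" by simp
  next
    fix x y assume "x \<in> mspace D" "y \<in> mspace D"
    then show "\<bar>H x - H y\<bar> \<le> 1 * mdist D x y"
      using lip1[of x y] lip1[of y x] by (simp add: abs_le_iff D.commute)
  qed simp
  moreover have "U = {x \<in> mspace D. H x > 0}"
  proof (intro set_eqI iffI)
    fix x assume x: "x \<in> U"
    then obtain \<delta> where d: "\<delta> > 0" "D.mball x \<delta> \<subseteq> U"
      using U unfolding mtopology_of_def D.openin_mtopology by auto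
    have "min 1 \<delta> \<le> H x"
    proof (rule ge)
      fix y assume "y \<in> ?K"
      then have "y \<notin> D.mball x \<delta>" "y \<in> mspace D" using d by auto
      then have "\<not> mdist D x y < \<delta>" using x Usub by (auto simp: D.in_mball)
      then show "min 1 \<delta> \<le> min 1 (mdist D x y)" by auto
    qed
    moreover have "0 < min 1 \<delta>" using d by simp
    ultimately show "x \<in> {x \<in> mspace D. H x > 0}" using x Usub by auto
  next
    fix x assume x: "x \<in> {x \<in> mspace D. H x > 0}"
    show "x \<in> U"
    proof (rule ccontr)
      assume "x \<notin> U"
      then have "x \<in> ?K" using x by auto
      then have "H x \<le> 0" using le[of x x] x by auto
      then show False using x by auto
    qed
  qed
  ultimately show ?thesis using that by blast
qed

lemma tendsto_dominated_difference:
  fixes a b :: "nat \<Rightarrow> real"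
  assumes "\<And>q. \<bar>a q - l\<bar> \<le> b q" "b \<longlonglongrightarrow> 0"
  shows "a \<longlonglongrightarrow> l"
proof -
  have "(\<lambda>q. a q - l) \<longlonglongrightarrow> 0"
    by (rule Lim_null_comparison[OF _ assms(2)]) (simp add: assms(1))
  then show ?thesis by (rule LIM_zero_cancel)
qed

lemma space_borel_sigma: "space (borel_sigma D) = mspace D"
  unfolding borel_sigma_def by (rule space_measure_of) (use openin_subset in fastforce)

lemma sets_borel_sigma: "sets (borel_sigma D) = sigma_sets (mspace D) {U. openin (mtopology_of D) U}"
  unfolding borel_sigma_def by (rule sets_measure_of) (use openin_subset in fastforce)

lemma measurable_borel_sigma_lipschitzI:
  assumes X: "\<And>\<omega>. \<omega> \<in> space M \<Longrightarrow> X \<omega> \<in> mspace D"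
    and lip: "\<And>H C m. bounded_lipschitz D C m H \<Longrightarrow> (\<lambda>\<omega>. H (X \<omega>)) \<in> borel_measurable M"
  shows "X \<in> measurable M (borel_sigma D)"
proof (rule measurable_sigma_sets[OF sets_borel_sigma])
  show "{U. openin (mtopology_of D) U} \<subseteq> Pow (mspace D)" using openin_subset by fastforce
  show "X \<in> space M \<rightarrow> mspace D" using X by auto
  fix U assume "U \<in> {U. openin (mtopology_of D) U}"
  then obtain H where H: "bounded_lipschitz D 1 1 H" "U = {x \<in> mspace D. H x > 0}"
    using open_as_positive_part by blast
  have "X -` U \<inter> space M = {\<omega> \<in> space M. H (X \<omega>) > 0}" using X by (auto simp: H(2))
  also have "\<dots> \<in> sets M" using lip[OF H(1)] by measurable
  finally show "X -` U \<inter> space M \<in> sets M" .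
qed

lemma coordinate_continuous_map:
  assumes "f \<in> F"
  shows "continuous_map (mtopology_of (linfty F)) euclideanreal (\<lambda>w. w f)"
proof -
  have "Lipschitz_continuous_map (linfty F) euclidean_metric (\<lambda>w. w f)"
    unfolding Lipschitz_continuous_map_def
    using mdist_linfty_upper[OF _ _ assms] by (auto intro!: exI[of _ 1] simp: dist_real_def simp del: mspace_funspace mdist_funspace)
  from Lipschitz_continuous_imp_continuous_map[OF this] show ?thesis by simp
qed

lemma coordinate_measurable:
  assumes "sets L = sets (borel_sigma (linfty F))" "f \<in> F"
  shows "(\<lambda>w. w f) \<in> borel_measurable L"
  by (rule continuous_map_borel_sigma_measurable[OF assms(1) coordinate_continuous_map[OF assms(2)]])

context bracketing_chain
begin

text \<open>A Lipschitz functional of \<open>v \<circ> proj q\<close> sees finitely many real numbers only.\<close>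

lemma finite_rank_coords:
  assumes H: "bounded_lipschitz (linfty F) C m H"
  obtains k e G where "lipschitz_coords k m G" "\<And>x. \<bar>G x\<bar> \<le> C" "\<And>i. e i \<in> proj q ` F"
    "\<And>v. H (\<lambda>f\<in>F. v (proj q f)) = G (\<lambda>i. v (e i))"
proof -
  let ?R = "proj q ` F"
  define k where "k = card ?R"
  obtain h where h: "bij_betw h {0..<k} ?R"
    using ex_bij_betw_nat_finite[OF finite_proj[of q]] unfolding k_def by blast
  have k: "k > 0" using finite_proj[of q] F_nonempty by (simp add: k_def card_gt_0_iff)
  define e where "e i = h (if i < k then i else 0)" for i
  define idx where "idx r = inv_into {0..<k} h r" for r
  have idx: "idx r < k" "e (idx r) = r" if "r \<in> ?R" for r
  proof -
    have "idx r \<in> {0..<k}" unfolding idx_def using h that by (intro inv_into_into) (simp add: bij_betw_def)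
    then show "idx r < k" by simp
    then show "e (idx r) = r" using h that by (simp add: e_def idx_def bij_betw_inv_into_right[of h "{0..<k}" ?R])
  qed
  have e: "e i \<in> ?R" for i
  proof -
    have "(if i < k then i else 0) \<in> {0..<k}" using k by auto
    then show ?thesis unfolding e_def using h bij_betwE by blast
  qed
  define emb where "emb x = (\<lambda>f\<in>F. x (idx (proj q f)) :: real)" for x
  have emb_in: "emb x \<in> mspace (linfty F)" for x
  proof -
    have "\<bar>x (idx r)\<bar> \<le> (\<Sum>r\<in>?R. \<bar>x (idx r)\<bar>)" if "r \<in> ?R" for r
      using finite_proj[of q] that by (intro member_le_sum) auto
    then show ?thesis unfolding mspace_linfty_iff emb_def by auto
  qed
  have m: "m \<ge> 0" using H by (simp add: bounded_lipschitz_def)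
  show ?thesis
  proof (rule that[of k "\<lambda>x. H (emb x)" e])
    show "lipschitz_coords k m (\<lambda>x. H (emb x))"
      unfolding lipschitz_coords_def
    proof (intro allI)
      fix x y
      have "\<bar>H (emb x) - H (emb y)\<bar> \<le> m * mdist (linfty F) (emb x) (emb y)"
        using H emb_in unfolding bounded_lipschitz_def by blast
      also have "mdist (linfty F) (emb x) (emb y) \<le> (\<Sum>i<k. \<bar>x i - y i\<bar>)"
        unfolding mdist_linfty_le_iff[OF emb_in emb_in F_nonempty]
      proof
        fix f assume f: "f \<in> F"
        have "\<bar>x (idx (proj q f)) - y (idx (proj q f))\<bar> \<le> (\<Sum>i<k. \<bar>x i - y i\<bar>)"
          using idx(1)[of "proj q f"] f by (intro member_le_sum) auto
        then show "\<bar>emb x f - emb y f\<bar> \<le> (\<Sum>i<k. \<bar>x i - y i\<bar>)" using f by (simp add: emb_def)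
      qed
      finally show "\<bar>H (emb x) - H (emb y)\<bar> \<le> m * (\<Sum>i<k. \<bar>x i - y i\<bar>)"
        using m by (simp add: mult_left_mono)
    qed
    show "\<bar>H (emb x)\<bar> \<le> C" for x using H emb_in unfolding bounded_lipschitz_def by blast
    show "e i \<in> ?R" for i by (rule e)
    show "H (\<lambda>f\<in>F. v (proj q f)) = H (emb (\<lambda>i. v (e i)))" for v
    proof -
      have "(\<lambda>f\<in>F. v (proj q f)) = emb (\<lambda>i. v (e i))"
        unfolding emb_def using idx(2) by (intro restrict_ext) auto
      then show ?thesis by simp
    qed
  qed
qed

definition reps :: "('a \<Rightarrow> real) set" where "reps = (\<Union>q. proj q ` F)"

lemma reps: "countable reps" "reps \<noteq> {}" "reps \<subseteq> F"
proof -
  show "countable reps" unfolding reps_def by (intro countable_UN countable_finite[OF finite_proj]) simp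
qed (use F_nonempty proj_in in \<open>auto simp: reps_def\<close>)

lemma proj_reps: "f \<in> F \<Longrightarrow> proj q f \<in> reps" by (auto simp: reps_def)

lemma F_square_integrable: "f \<in> F \<Longrightarrow> square_integrable P f"
proof -
  assume f: "f \<in> F"
  then have "f \<in> borel_measurable borel" using F_borel by auto
  moreover have "\<bar>f y\<bar> \<le> 1 * env y" for y using env[OF f] by simp
  ultimately show ?thesis using L2_bounded(1)[of f 1] measurable_P unfolding square_integrable_def by blast
qed

text \<open>An enumeration of the representatives turns the Gaussian sequence into a process indexed by
  functions.\<close>

definition noise :: "('a \<Rightarrow> real) \<Rightarrow> (nat \<Rightarrow> real) \<Rightarrow> real" where
  "noise f = gaussian_sequence P (from_nat_into reps) (to_nat_on reps f)"

lemma rep_seq: "square_integrable P (from_nat_into reps n)"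
  using F_square_integrable reps from_nat_into[OF reps(2)] by blast

lemma noise_measurable [measurable]: "noise f \<in> borel_measurable white_noise"
  unfolding noise_def by (rule gaussian_sequence_measurable[OF rep_seq])

lemma distr_noise:
  assumes I: "finite I" and u: "\<And>i. i \<in> I \<Longrightarrow> u i \<in> reps"
  shows "distr white_noise borel (\<lambda>\<omega>. \<Sum>i\<in>I. c i * noise (u i) \<omega>) = normal_law (sqrt (\<integral>y. (\<Sum>i\<in>I. c i * u i y)\<^sup>2 \<partial>P))"
proof -
  have "(\<Sum>i\<in>I. c i * from_nat_into reps (to_nat_on reps (u i)) y) = (\<Sum>i\<in>I. c i * u i y)" for y
    using u reps(1) by (intro sum.cong) auto
  then show ?thesis
    using distr_gaussian_sequence[OF rep_seq I, where c=c and n="\<lambda>i. to_nat_on reps (u i)"] unfolding noise_def by simp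
qed

lemma noise_increment_mgf:
  assumes u: "u \<in> reps" "v \<in> reps" and V: "(\<integral>y. (u y - v y)\<^sup>2 \<partial>P) \<le> 2 * V"
  shows "integrable white_noise (\<lambda>\<omega>. exp (s * (noise u \<omega> - noise v \<omega>))) \<and>
    (\<integral>\<omega>. exp (s * (noise u \<omega> - noise v \<omega>)) \<partial>white_noise) \<le> exp (s\<^sup>2 * V)"
proof -
  let ?Z = "\<lambda>\<omega>. noise u \<omega> - noise v \<omega>" and ?\<sigma> = "sqrt (\<integral>y. (u y - v y)\<^sup>2 \<partial>P)"
  have d: "distr white_noise borel ?Z = normal_law ?\<sigma>"
    using distr_noise[of "UNIV :: bool set" "\<lambda>b. if b then u else v" "\<lambda>b. if b then 1 else -1"] u
    by (simp add: UNIV_bool)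
  have i: "integrable white_noise (\<lambda>\<omega>. exp (s * ?Z \<omega>))"
    using normal_law_mgf(1)[of ?\<sigma> s] unfolding d[symmetric] by (subst (asm) integrable_distr_eq) auto
  have "(\<integral>\<omega>. exp (s * ?Z \<omega>) \<partial>white_noise) = exp (s\<^sup>2 * ?\<sigma>\<^sup>2 / 2)"
    using normal_law_mgf(2)[of ?\<sigma> s] unfolding d[symmetric] by (subst (asm) integral_distr) auto
  also have "?\<sigma>\<^sup>2 = (\<integral>y. (u y - v y)\<^sup>2 \<partial>P)" by (simp add: integral_nonneg_AE)
  also have "exp (s\<^sup>2 * \<dots> / 2) \<le> exp (s\<^sup>2 * V)"
    using mult_left_mono[OF V, of "s\<^sup>2"] by simp
  finally show ?thesis using i by simp
qed

text \<open>The maximum runs over the representatives of level \<open>q + 1\<close> only; by nestedness it bounds the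
  increments of all functions of the class (\<open>link_upper\<close>).\<close>

definition link :: "nat \<Rightarrow> (nat \<Rightarrow> real) \<Rightarrow> real" where
  "link q \<omega> = Max ((\<lambda>f. \<bar>noise f \<omega> - noise (proj q f) \<omega>\<bar>) ` proj (Suc q) ` F)"

lemma link_measurable [measurable]: "link q \<in> borel_measurable white_noise"
  unfolding link_def[abs_def] using finite_proj by (intro borel_measurable_Max) auto

lemma link_upper:
  assumes f: "f \<in> F"
  shows "\<bar>noise (proj (Suc q) f) \<omega> - noise (proj q f) \<omega>\<bar> \<le> link q \<omega>"
proof -
  have "\<bar>noise (proj (Suc q) f) \<omega> - noise (proj q (proj (Suc q) f)) \<omega>\<bar> \<le> link q \<omega>"
    unfolding link_def using finite_proj f by (intro Max_ge) auto
  then show ?thesis using proj_proj[of q "Suc q" f] f by simp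
qed

lemma link_nonneg: "0 \<le> link q \<omega>"
  using link_upper[of _ q \<omega>] F_nonempty by (meson abs_ge_zero all_not_in_conv order_trans)

lemma link_expectation:
  "integrable white_noise (link q)" "(\<integral>\<omega>. link q \<omega> \<partial>white_noise) \<le> 2 * entropy_term q"
proof -
  let ?J = "proj (Suc q) ` F"
  have J: "finite ?J" "?J \<noteq> {}" "real (card ?J) \<le> N (Suc q)"
    using finite_proj F_nonempty card_proj by auto
  have V: "(1/4::real)^q > 0" by simp
  have m: "integrable white_noise (\<lambda>\<omega>. exp (s * (noise f \<omega> - noise (proj q f) \<omega>))) \<and>
      (\<integral>\<omega>. exp (s * (noise f \<omega> - noise (proj q f) \<omega>)) \<partial>white_noise) \<le> exp (s\<^sup>2 * (1/4)^q)"
    if f: "f \<in> ?J" for f s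
  proof (rule noise_increment_mgf)
    have fF: "f \<in> F" using f proj_in by auto
    show "f \<in> reps" "proj q f \<in> reps" using f fF by (auto simp: reps_def)
    have "(f y - proj q f y)\<^sup>2 \<le> (width q f y)\<^sup>2" for y
      using proj_near[OF fF, of y q] by (simp add: abs_le_square_iff[symmetric] order_trans[OF _ abs_ge_self])
    then have "(\<integral>y. (f y - proj q f y)\<^sup>2 \<partial>P) \<le> (\<integral>y. (width q f y)\<^sup>2 \<partial>P)"
      using square_integrable_diff[OF F_square_integrable[OF fF] F_square_integrable[OF proj_in[OF fF, of q]]] width_integrable(1)[OF fF]
      by (intro integral_mono) (auto simp: square_integrable_def)
    then show "(\<integral>y. (f y - proj q f y)\<^sup>2 \<partial>P) \<le> 2 * (1/4)^q" using width_L2[OF fF, of q] V by linarith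
  qed
  have Zm: "(\<lambda>\<omega>. noise f \<omega> - noise (proj q f) \<omega>) \<in> borel_measurable white_noise" for f by measurable
  have z: "(0::real) \<le> 0" by simp
  show "integrable white_noise (link q)"
    unfolding link_def[abs_def]
    by (rule white_noise.expectation_Max_abs_le(1)[OF J _ V z]) (rule Zm, erule m)
  have "(\<integral>\<omega>. link q \<omega> \<partial>white_noise) \<le> 0 * ln (2 * N (Suc q)) + 2 * sqrt ((1/4)^q) * sqrt (ln (2 * N (Suc q)))"
    unfolding link_def[abs_def]
    by (rule white_noise.expectation_Max_abs_le(2)[OF J _ V z]) (rule Zm, erule m)
  also have "sqrt ((1/4::real)^q) = (1/2)^q" by (simp add: real_sqrt_power real_sqrt_divide)
  finally show "(\<integral>\<omega>. link q \<omega> \<partial>white_noise) \<le> 2 * entropy_term q"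
    by (simp add: entropy_term_def L_def)
qed

definition good :: "(nat \<Rightarrow> real) set" where
  "good = {\<omega> \<in> space white_noise. (\<Sum>q. ennreal (link q \<omega>)) \<noteq> \<infinity>}"

lemma good_measurable [measurable]: "good \<in> sets white_noise"
  unfolding good_def by measurable

lemma good_summable: "\<omega> \<in> good \<Longrightarrow> summable (\<lambda>q. link q \<omega>)"
  unfolding good_def using link_nonneg by (auto intro!: summable_suminf_not_top)

definition tail :: "nat \<Rightarrow> (nat \<Rightarrow> real) \<Rightarrow> real" where
  "tail q \<omega> = (\<Sum>i. link (i + q) \<omega>)"

lemma tail_measurable [measurable]: "tail q \<in> borel_measurable white_noise"
  unfolding tail_def[abs_def] by measurable

lemma nn_integral_links:
  "(\<integral>\<^sup>+\<omega>. (\<Sum>i. ennreal (link (i + q) \<omega>)) \<partial>white_noise) \<le> ennreal (2 * (\<Sum>i. entropy_term (i + q)))"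
proof -
  have s: "summable (\<lambda>i. entropy_term (i + q))"
    by (rule summable_ignore_initial_segment[OF summable_entropy_term])
  have "(\<integral>\<^sup>+\<omega>. (\<Sum>i. ennreal (link (i + q) \<omega>)) \<partial>white_noise) = (\<Sum>i. \<integral>\<^sup>+\<omega>. ennreal (link (i + q) \<omega>) \<partial>white_noise)"
    by (rule nn_integral_suminf) measurable
  also have "\<dots> = (\<Sum>i. ennreal (\<integral>\<omega>. link (i + q) \<omega> \<partial>white_noise))"
    using link_expectation(1) link_nonneg by (subst nn_integral_eq_integral) auto
  also have "\<dots> \<le> (\<Sum>i. ennreal (2 * entropy_term (i + q)))"
    using link_expectation(2) by (intro suminf_le ennreal_leI) auto
  also have "\<dots> = ennreal (\<Sum>i. 2 * entropy_term (i + q))"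
    using s entropy_term_pos by (intro suminf_ennreal2 summable_mult) (auto intro: less_imp_le)
  finally show ?thesis using s by (simp add: suminf_mult)
qed

text \<open>By the maximal inequality the links have summable means, hence they are almost surely summable.\<close>

lemma AE_good: "AE \<omega> in white_noise. \<omega> \<in> good"
proof -
  have "(\<integral>\<^sup>+\<omega>. (\<Sum>i. ennreal (link i \<omega>)) \<partial>white_noise) \<noteq> \<infinity>"
    using nn_integral_links[of 0] by (auto simp: top_unique)
  then have "AE \<omega> in white_noise. (\<Sum>i. ennreal (link i \<omega>)) \<noteq> \<infinity>"
    by (intro nn_integral_PInf_AE) auto
  then show ?thesis
    by (rule AE_mp) (auto simp: good_def)
qed

lemma tail_expectation: "integrable white_noise (\<lambda>\<omega>. tail q \<omega> * indicator good \<omega>)"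
  "(\<integral>\<omega>. tail q \<omega> * indicator good \<omega> \<partial>white_noise) \<le> 2 * (\<Sum>i. entropy_term (i + q))"
proof -
  have pos: "0 \<le> tail q \<omega> * indicator good \<omega>" for \<omega>
    using link_nonneg good_summable unfolding tail_def
    by (auto simp: indicator_def intro!: suminf_nonneg summable_ignore_initial_segment)
  have "(\<integral>\<^sup>+\<omega>. ennreal (tail q \<omega> * indicator good \<omega>) \<partial>white_noise) \<le> (\<integral>\<^sup>+\<omega>. (\<Sum>i. ennreal (link (i + q) \<omega>)) \<partial>white_noise)"
  proof (rule nn_integral_mono)
    fix \<omega>
    show "ennreal (tail q \<omega> * indicator good \<omega>) \<le> (\<Sum>i. ennreal (link (i + q) \<omega>))"
    proof (cases "\<omega> \<in> good")
      case True
      then have "summable (\<lambda>i. link (i + q) \<omega>)" by (intro summable_ignore_initial_segment good_summable)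
      then have "ennreal (tail q \<omega>) = (\<Sum>i. ennreal (link (i + q) \<omega>))"
        unfolding tail_def using link_nonneg by (intro suminf_ennreal2[symmetric]) auto
      then show ?thesis using True by simp
    qed simp
  qed
  also note nn_integral_links[of q]
  finally have le: "(\<integral>\<^sup>+\<omega>. ennreal (tail q \<omega> * indicator good \<omega>) \<partial>white_noise) \<le> ennreal (2 * (\<Sum>i. entropy_term (i + q)))" .
  then have "(\<integral>\<^sup>+\<omega>. ennreal (tail q \<omega> * indicator good \<omega>) \<partial>white_noise) < \<infinity>"
    by (rule order.strict_trans1) simp
  then show i: "integrable white_noise (\<lambda>\<omega>. tail q \<omega> * indicator good \<omega>)"
    using pos by (intro integrableI_nonneg) auto
  have "0 \<le> (\<Sum>i. entropy_term (i + q))"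
    using entropy_term_pos summable_ignore_initial_segment[OF summable_entropy_term, of q]
    by (intro suminf_nonneg) (auto intro: less_imp_le)
  then show "(\<integral>\<omega>. tail q \<omega> * indicator good \<omega> \<partial>white_noise) \<le> 2 * (\<Sum>i. entropy_term (i + q))"
    using le nn_integral_eq_integral[OF i] pos by (simp add: ennreal_le_iff)
qed

definition path :: "(nat \<Rightarrow> real) \<Rightarrow> ('a \<Rightarrow> real) \<Rightarrow> real" where
  "path \<omega> = (\<lambda>f\<in>F. if \<omega> \<in> good then lim (\<lambda>q. noise (proj q f) \<omega>) else 0)"

lemma path_limit:
  assumes \<omega>: "\<omega> \<in> good" and f: "f \<in> F"
  shows "(\<lambda>q. noise (proj q f) \<omega>) \<longlonglongrightarrow> path \<omega> f" "\<bar>path \<omega> f - noise (proj q f) \<omega>\<bar> \<le> tail q \<omega>"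
proof -
  let ?a = "\<lambda>q. noise (proj q f) \<omega>"
  have s: "summable (\<lambda>q. link q \<omega>)" using \<omega> by (rule good_summable)
  have "summable (\<lambda>q. ?a (Suc q) - ?a q)"
    by (rule summable_comparison_test'[OF s]) (use link_upper[OF f] in auto)
  then have "convergent (\<lambda>n. \<Sum>q<n. ?a (Suc q) - ?a q)" by (simp add: summable_iff_convergent)
  then have "convergent (\<lambda>n. (\<Sum>q<n. ?a (Suc q) - ?a q) + ?a 0)"
    by (rule convergent_add) (rule convergent_const)
  moreover have "(\<Sum>q<n. ?a (Suc q) - ?a q) + ?a 0 = ?a n" for n
    using sum_lessThan_telescope[of ?a n] by simp
  ultimately have "convergent ?a" by simp
  then show lim: "?a \<longlonglongrightarrow> path \<omega> f" using \<omega> f by (simp add: path_def convergent_LIMSEQ_iff)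
  have "\<bar>?a (q + n) - ?a q\<bar> \<le> tail q \<omega>" for n
  proof -
    have "?a (q + n) - ?a q = (\<Sum>i<n. ?a (Suc (i + q)) - ?a (i + q))"
      using sum_lessThan_telescope[of "\<lambda>i. ?a (i + q)" n] by (simp add: add.commute)
    also have "\<bar>\<dots>\<bar> \<le> (\<Sum>i<n. link (i + q) \<omega>)"
      using link_upper[OF f] by (intro order_trans[OF sum_abs] sum_mono) auto
    also have "\<dots> \<le> tail q \<omega>"
      unfolding tail_def using summable_ignore_initial_segment[OF s] link_nonneg by (intro sum_le_suminf) auto
    finally show ?thesis .
  qed
  moreover have "(\<lambda>n. \<bar>?a (q + n) - ?a q\<bar>) \<longlonglongrightarrow> \<bar>path \<omega> f - ?a q\<bar>"
    using LIMSEQ_ignore_initial_segment[OF lim, of q] by (intro tendsto_intros) (simp add: add.commute[of q])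
  ultimately show "\<bar>path \<omega> f - ?a q\<bar> \<le> tail q \<omega>" by (intro LIMSEQ_le_const2) auto
qed

lemma path_proj:
  assumes \<omega>: "\<omega> \<in> good" and f: "f \<in> F"
  shows "\<bar>path \<omega> f - path \<omega> (proj q f)\<bar> \<le> 2 * tail q \<omega>"
  using path_limit(2)[OF \<omega> f, of q] path_limit(2)[OF \<omega> proj_in[OF f], of q q] proj_proj[of q q f] f by simp

lemma tail_tendsto:
  assumes "\<omega> \<in> good"
  shows "(\<lambda>q. tail q \<omega>) \<longlonglongrightarrow> 0"
  unfolding tail_def by (rule suminf_exist_split2[OF good_summable[OF assms]])

lemma path_in: "path \<omega> \<in> mspace (linfty F)"
proof (cases "\<omega> \<in> good")
  case True
  have "\<bar>path \<omega> f\<bar> \<le> tail 0 \<omega> + (\<Sum>r\<in>proj 0 ` F. \<bar>noise r \<omega>\<bar>)" if f: "f \<in> F" for f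
  proof -
    have "\<bar>noise (proj 0 f) \<omega>\<bar> \<le> (\<Sum>r\<in>proj 0 ` F. \<bar>noise r \<omega>\<bar>)"
      using finite_proj f by (intro member_le_sum) auto
    then show ?thesis using path_limit(2)[OF True f, of 0] by linarith
  qed
  moreover have "path \<omega> \<in> extensional F" by (simp add: path_def)
  ultimately show ?thesis unfolding mspace_linfty_iff by blast
next
  case False
  then show ?thesis unfolding mspace_linfty_iff path_def by auto
qed

lemma proj_comp_in:
  assumes "v \<in> mspace (linfty F)"
  shows "(\<lambda>f\<in>F. v (proj q f)) \<in> mspace (linfty F)"
proof -
  obtain B where "\<And>f. f \<in> F \<Longrightarrow> \<bar>v f\<bar> \<le> B" using assms unfolding mspace_linfty_iff by blast
  then have "\<forall>f\<in>F. \<bar>(\<lambda>f\<in>F. v (proj q f)) f\<bar> \<le> B" using proj_in by simp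
  then show ?thesis unfolding mspace_linfty_iff by (intro conjI exI restrict_extensional)
qed

text \<open>The approximations \<open>noise \<circ> proj q\<close> have finite rank, so Lipschitz functionals of them are measurable,
  and they converge uniformly on the event \<open>good\<close>; elsewhere both are set to 0.\<close>

lemma path_measurable: "path \<in> measurable white_noise (borel_sigma (linfty F))"
proof (rule measurable_borel_sigma_lipschitzI)
  show "path \<omega> \<in> mspace (linfty F)" for \<omega> by (rule path_in)
  fix H C m assume H: "bounded_lipschitz (linfty F) C m H"
  define v where "v f \<omega> = (if \<omega> \<in> good then noise f \<omega> else 0)" for f \<omega>
  have vm: "v f \<in> borel_measurable white_noise" for f unfolding v_def by measurable
  have meas: "(\<lambda>\<omega>. H (\<lambda>f\<in>F. v (proj q f) \<omega>)) \<in> borel_measurable white_noise" for q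
  proof -
    from finite_rank_coords[OF H, of q] obtain k e G where G: "lipschitz_coords k m G"
      "\<And>v. H (\<lambda>f\<in>F. v (proj q f)) = G (\<lambda>i. v (e i))" by metis
    have "(\<lambda>\<omega>. G (\<lambda>i. v (e i) \<omega>)) \<in> borel_measurable white_noise"
      by (rule lipschitz_coords_measurable[OF G(1)]) (rule vm)
    then show ?thesis by (simp add: G(2)[of "\<lambda>f. v f _"])
  qed
  have m: "m \<ge> 0" using H by (simp add: bounded_lipschitz_def)
  show "(\<lambda>\<omega>. H (path \<omega>)) \<in> borel_measurable white_noise"
  proof (rule borel_measurable_LIMSEQ_real[OF _ meas])
    fix \<omega> assume "\<omega> \<in> space white_noise"
    let ?v = "\<lambda>q. \<lambda>f\<in>F. v (proj q f) \<omega>"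
    have vin: "?v q \<in> mspace (linfty F)" for q
    proof -
      have "\<bar>v (proj q f) \<omega>\<bar> \<le> (\<Sum>r\<in>proj q ` F. \<bar>v r \<omega>\<bar>)" if "f \<in> F" for f
        using finite_proj that by (intro member_le_sum) auto
      then show ?thesis unfolding mspace_linfty_iff by auto
    qed
    show "(\<lambda>q. H (?v q)) \<longlonglongrightarrow> H (path \<omega>)"
    proof (cases "\<omega> \<in> good")
      case True
      have "\<bar>H (?v q) - H (path \<omega>)\<bar> \<le> m * tail q \<omega>" for q
      proof -
        have "\<bar>H (?v q) - H (path \<omega>)\<bar> \<le> m * mdist (linfty F) (?v q) (path \<omega>)"
          using H vin path_in unfolding bounded_lipschitz_def by blast
        also have "mdist (linfty F) (?v q) (path \<omega>) \<le> tail q \<omega>"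
          unfolding mdist_linfty_le_iff[OF vin path_in F_nonempty]
          using path_limit(2)[OF True] True by (auto simp: v_def abs_minus_commute)
        finally show ?thesis using m by (simp add: mult_left_mono)
      qed
      moreover have "(\<lambda>q. m * tail q \<omega>) \<longlonglongrightarrow> 0"
        using tendsto_mult_left[OF tail_tendsto[OF True], of m] by simp
      ultimately show ?thesis by (rule tendsto_dominated_difference)
    next
      case False
      have "?v q = path \<omega>" for q
        unfolding v_def path_def using False by (intro restrict_ext) (simp only: if_False)
      then show ?thesis by (simp only: tendsto_const)
    qed
  qed
qed

end

context bracketing_chain
begin

definition law :: "(('a \<Rightarrow> real) \<Rightarrow> real) measure" where
  "law = distr white_noise (borel_sigma (linfty F)) path"

lemma prob_space_law: "prob_space law"
  unfolding law_def by (rule white_noise.prob_space_distr[OF path_measurable])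

lemma sets_law: "sets law = sets (borel_sigma (linfty F))" and space_law: "space law = mspace (linfty F)"
  unfolding law_def by (simp_all only: sets_distr space_distr space_borel_sigma)

lemma integral_law:
  fixes H :: "(('a \<Rightarrow> real) \<Rightarrow> real) \<Rightarrow> 'b::{banach, second_countable_topology}"
  assumes "H \<in> borel_measurable law"
  shows "(\<integral>w. H w \<partial>law) = (\<integral>\<omega>. H (path \<omega>) \<partial>white_noise)"
  unfolding law_def
proof (rule integral_distr[OF path_measurable])
  show "H \<in> borel_measurable (borel_sigma (linfty F))"
    using assms sets_law measurable_cong_sets by blast
qed

lemma law_coordinate: "f \<in> F \<Longrightarrow> (\<lambda>w. w f) \<in> borel_measurable law"
  by (rule coordinate_measurable[OF sets_law])

text \<open>Along the chain, a linear combination moves by widths while it stays dominated by the envelope.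
  By the inequality of the arithmetic and geometric means, with weights \<open>2\<^sup>q\<close> and \<open>2\<^sup>-\<^sup>q\<close>, the product of a
  width and the envelope has a mean of order \<open>2\<^sup>-\<^sup>q\<close>.\<close>

lemma second_moment_proj:
  assumes I: "finite I" and u: "\<And>i. i \<in> I \<Longrightarrow> u i \<in> F"
  shows "(\<lambda>q. \<integral>y. (\<Sum>i\<in>I. c i * proj q (u i) y)\<^sup>2 \<partial>P) \<longlonglongrightarrow> (\<integral>y. (\<Sum>i\<in>I. c i * u i y)\<^sup>2 \<partial>P)"
proof -
  define A where "A = (\<Sum>i\<in>I. \<bar>c i\<bar>)"
  have A0: "A \<ge> 0" by (simp add: A_def sum_nonneg)
  define E where "E = (\<integral>y. (env y)\<^sup>2 \<partial>P)"
  let ?a = "\<lambda>q y. \<Sum>i\<in>I. c i * proj q (u i) y" and ?b = "\<lambda>y. \<Sum>i\<in>I. c i * u i y"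
  have sqa: "square_integrable P (?a q)" for q
    by (rule square_integrable_lincomb) (use u proj_in F_square_integrable in auto)
  have sqb: "square_integrable P ?b"
    by (rule square_integrable_lincomb) (use u F_square_integrable in auto)
  have env_le: "\<bar>\<Sum>i\<in>I. c i * v i\<bar> \<le> A * env y" if "\<And>i. i \<in> I \<Longrightarrow> \<bar>v i\<bar> \<le> env y" for v y
  proof -
    have "\<bar>\<Sum>i\<in>I. c i * v i\<bar> \<le> (\<Sum>i\<in>I. \<bar>c i\<bar> * env y)"
      using that by (intro order_trans[OF sum_abs] sum_mono) (auto simp: abs_mult mult_left_mono)
    then show ?thesis by (simp add: A_def sum_distrib_right)
  qed
  have pt: "\<bar>(?a q y)\<^sup>2 - (?b y)\<^sup>2\<bar> \<le> A * (\<Sum>i\<in>I. \<bar>c i\<bar> * (2^q * (width q (u i) y)\<^sup>2 + (1/2)^q * (env y)\<^sup>2))" for q y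
  proof -
    have "\<bar>?a q y - ?b y\<bar> \<le> (\<Sum>i\<in>I. \<bar>c i\<bar> * width q (u i) y)"
    proof -
      have "?a q y - ?b y = (\<Sum>i\<in>I. c i * (proj q (u i) y - u i y))"
        by (simp add: sum_subtractf right_diff_distrib)
      also have "\<bar>\<dots>\<bar> \<le> (\<Sum>i\<in>I. \<bar>c i\<bar> * width q (u i) y)"
        using proj_near[OF u] by (intro order_trans[OF sum_abs] sum_mono) (auto simp: abs_mult abs_minus_commute mult_left_mono)
      finally show ?thesis .
    qed
    moreover have "\<bar>?a q y + ?b y\<bar> \<le> 2 * (A * env y)"
      using env_le[of "\<lambda>i. proj q (u i) y" y] env_le[of "\<lambda>i. u i y" y] env[OF u] env[OF proj_in[OF u]] by (simp add: abs_le_iff)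
    ultimately have "\<bar>?a q y - ?b y\<bar> * \<bar>?a q y + ?b y\<bar> \<le> (\<Sum>i\<in>I. \<bar>c i\<bar> * width q (u i) y) * (2 * (A * env y))"
      by (intro mult_mono) auto
    also have "\<dots> = A * (\<Sum>i\<in>I. \<bar>c i\<bar> * (2 * width q (u i) y * env y))"
      by (simp add: sum_distrib_left sum_distrib_right mult_ac)
    also have "\<dots> \<le> A * (\<Sum>i\<in>I. \<bar>c i\<bar> * (2^q * (width q (u i) y)\<^sup>2 + (1/2)^q * (env y)\<^sup>2))"
    proof (intro mult_left_mono sum_mono A0)
      fix i
      let ?s = "sqrt (2^q)"
      have s: "?s\<^sup>2 = 2^q" "?s > 0" by auto
      have "2 * (?s * width q (u i) y) * (env y / ?s) \<le> (?s * width q (u i) y)\<^sup>2 + (env y / ?s)\<^sup>2"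
        by (rule sum_squares_bound)
      then show "2 * width q (u i) y * env y \<le> 2^q * (width q (u i) y)\<^sup>2 + (1/2)^q * (env y)\<^sup>2"
        using s(2) by (simp add: power_mult_distrib power_divide s(1))
    qed auto
    finally show ?thesis by (simp add: power2_eq_square square_diff_square_factored abs_mult mult.commute)
  qed
  have iw: "integrable P (\<lambda>y. A * (\<Sum>i\<in>I. \<bar>c i\<bar> * (2^q * (width q (u i) y)\<^sup>2 + (1/2)^q * (env y)\<^sup>2)))" for q
    using width_integrable(1)[OF u] env_L2
    by (intro integrable_mult_right Bochner_Integration.integrable_sum Bochner_Integration.integrable_add) auto
  have "\<bar>(\<integral>y. (?a q y)\<^sup>2 \<partial>P) - (\<integral>y. (?b y)\<^sup>2 \<partial>P)\<bar> \<le> A * (A * (1 + E)) * (1/2)^q" for q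
  proof -
    have ia: "integrable P (\<lambda>y. (?a q y)\<^sup>2)" and ib: "integrable P (\<lambda>y. (?b y)\<^sup>2)"
      using sqa sqb by (auto simp: square_integrable_def)
    have "\<bar>(\<integral>y. (?a q y)\<^sup>2 \<partial>P) - (\<integral>y. (?b y)\<^sup>2 \<partial>P)\<bar> = \<bar>\<integral>y. (?a q y)\<^sup>2 - (?b y)\<^sup>2 \<partial>P\<bar>"
      using ia ib by simp
    also have "\<dots> \<le> (\<integral>y. \<bar>(?a q y)\<^sup>2 - (?b y)\<^sup>2\<bar> \<partial>P)" by (rule integral_abs_bound)
    also have "\<dots> \<le> (\<integral>y. A * (\<Sum>i\<in>I. \<bar>c i\<bar> * (2^q * (width q (u i) y)\<^sup>2 + (1/2)^q * (env y)\<^sup>2)) \<partial>P)"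
      by (rule integral_mono[OF _ iw pt]) (use ia ib in auto)
    also have "\<dots> = A * (\<Sum>i\<in>I. \<bar>c i\<bar> * (2^q * (\<integral>y. (width q (u i) y)\<^sup>2 \<partial>P) + (1/2)^q * E))"
      using width_integrable(1)[OF u] env_L2 unfolding E_def
      by (simp add: Bochner_Integration.integral_sum)
    also have "\<dots> \<le> A * (\<Sum>i\<in>I. \<bar>c i\<bar> * (2^q * (1/4)^q + (1/2)^q * E))"
      using width_L2[OF u] A0 by (intro mult_left_mono sum_mono add_right_mono) auto
    also have "(2::real)^q * (1/4)^q = (1/2)^q" by (simp flip: power_mult_distrib)
    also have "A * (\<Sum>i\<in>I. \<bar>c i\<bar> * ((1/2)^q + (1/2)^q * E)) = A * (A * (1 + E)) * (1/2)^q"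
      unfolding A_def sum_distrib_right[symmetric] by (simp add: algebra_simps)
    finally show ?thesis .
  qed
  moreover have "(\<lambda>q. A * (A * (1 + E)) * (1/2)^q) \<longlonglongrightarrow> 0"
    using tendsto_mult_left[OF LIMSEQ_power_zero[of "1/2::real"], of "A * (A * (1 + E))"] by simp
  ultimately show ?thesis by (rule tendsto_dominated_difference)
qed

text \<open>The approximations of level \<open>q\<close> have normal laws whose variances converge, and they converge almost
  surely; the characteristic functions identify the law of the limit.\<close>

lemma distr_path:
  assumes I: "finite I" and u: "\<And>i. i \<in> I \<Longrightarrow> u i \<in> F"
  shows "distr white_noise borel (\<lambda>\<omega>. \<Sum>i\<in>I. c i * path \<omega> (u i)) = normal_law (sqrt (\<integral>y. (\<Sum>i\<in>I. c i * u i y)\<^sup>2 \<partial>P))"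
proof -
  have pm: "(\<lambda>\<omega>. path \<omega> f) \<in> borel_measurable white_noise" if "f \<in> F" for f
    by (rule measurable_compose[OF path_measurable coordinate_measurable[OF refl that]])
  define Z where "Z \<omega> = (\<Sum>i\<in>I. c i * path \<omega> (u i))" for \<omega>
  define Zq where "Zq q \<omega> = (\<Sum>i\<in>I. c i * noise (proj q (u i)) \<omega>)" for q \<omega>
  have Zm [measurable]: "Z \<in> borel_measurable white_noise"
    unfolding Z_def using pm[OF u] by (intro borel_measurable_sum borel_measurable_times) auto
  have Zqm [measurable]: "Zq q \<in> borel_measurable white_noise" for q unfolding Zq_def by measurable
  let ?v = "\<lambda>q. \<integral>y. (\<Sum>i\<in>I. c i * proj q (u i) y)\<^sup>2 \<partial>P" and ?V = "\<integral>y. (\<Sum>i\<in>I. c i * u i y)\<^sup>2 \<partial>P"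
  have "char (distr white_noise borel Z) t = char (normal_law (sqrt ?V)) t" for t
  proof (rule LIMSEQ_unique)
    show "(\<lambda>q. char (distr white_noise borel (Zq q)) t) \<longlonglongrightarrow> char (distr white_noise borel Z) t"
    proof -
      have "(\<lambda>q. \<integral>\<omega>. iexp (t * Zq q \<omega>) \<partial>white_noise) \<longlonglongrightarrow> (\<integral>\<omega>. iexp (t * Z \<omega>) \<partial>white_noise)"
      proof (rule integral_dominated_convergence[where w="\<lambda>_. 1"])
        show "AE \<omega> in white_noise. (\<lambda>q. iexp (t * Zq q \<omega>)) \<longlonglongrightarrow> iexp (t * Z \<omega>)"
          using AE_good
        proof eventually_elim
          case (elim \<omega>)
          have "(\<lambda>q. Zq q \<omega>) \<longlonglongrightarrow> Z \<omega>"
            unfolding Zq_def Z_def using path_limit(1)[OF elim u] by (intro tendsto_intros) auto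
          then have "(\<lambda>q. t * Zq q \<omega>) \<longlonglongrightarrow> t * Z \<omega>" by (rule tendsto_mult_left)
          then show ?case by (rule isCont_tendsto_compose[OF isCont_iexp])
        qed
      qed auto
      then show ?thesis unfolding char_def by (simp add: integral_distr)
    qed
    have "char (distr white_noise borel (Zq q)) t = exp (- (t\<^sup>2 * ?v q) / 2)" for q
    proof -
      have "distr white_noise borel (Zq q) = normal_law (sqrt (?v q))"
        unfolding Zq_def by (rule distr_noise[OF I proj_reps[OF u]])
      then show ?thesis by (simp add: char_normal_law integral_nonneg_AE)
    qed
    moreover have "(\<lambda>q. complex_of_real (exp (- (t\<^sup>2 * ?v q) / 2))) \<longlonglongrightarrow> complex_of_real (exp (- (t\<^sup>2 * ?V) / 2))"
      using second_moment_proj[where c=c, OF I u] by (intro tendsto_intros) auto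
    ultimately show "(\<lambda>q. char (distr white_noise borel (Zq q)) t) \<longlonglongrightarrow> char (normal_law (sqrt ?V)) t"
      by (simp add: char_normal_law integral_nonneg_AE)
  qed
  then show ?thesis
    unfolding Z_def[symmetric]
    by (intro Levy_uniqueness white_noise.real_distribution_distr normal_law_real_distribution ext) auto
qed

lemma distr_law:
  assumes I: "finite I" and u: "\<And>i. i \<in> I \<Longrightarrow> u i \<in> F"
  shows "distr law borel (\<lambda>w. \<Sum>i\<in>I. c i * w (u i)) = normal_law (sqrt (\<integral>y. (\<Sum>i\<in>I. c i * u i y)\<^sup>2 \<partial>P))"
proof -
  have m: "(\<lambda>w. \<Sum>i\<in>I. c i * w (u i)) \<in> borel_measurable (borel_sigma (linfty F))"
    using coordinate_measurable[OF refl u] by (intro borel_measurable_sum borel_measurable_times) auto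
  show ?thesis
    unfolding law_def distr_distr[OF m path_measurable] comp_def by (rule distr_path[OF I u])
qed

lemma law_moments:
  assumes I: "finite I" and u: "\<And>i. i \<in> I \<Longrightarrow> u i \<in> F"
  shows "integrable law (\<lambda>w. (\<Sum>i\<in>I. c i * w (u i))\<^sup>2)"
    "(\<integral>w. (\<Sum>i\<in>I. c i * w (u i))\<^sup>2 \<partial>law) = (\<integral>y. (\<Sum>i\<in>I. c i * u i y)\<^sup>2 \<partial>P)"
    "(\<integral>w. (\<Sum>i\<in>I. c i * w (u i)) \<partial>law) = 0"
proof -
  let ?Z = "\<lambda>w. \<Sum>i\<in>I. c i * w (u i)" and ?\<sigma> = "sqrt (\<integral>y. (\<Sum>i\<in>I. c i * u i y)\<^sup>2 \<partial>P)"
  have m: "?Z \<in> borel_measurable law"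
    using law_coordinate[OF u] by (intro borel_measurable_sum borel_measurable_times) auto
  have d: "distr law borel ?Z = normal_law ?\<sigma>" by (rule distr_law[OF I u])
  have "integrable (distr law borel ?Z) (\<lambda>x. x\<^sup>2)" by (subst d) (rule normal_law_moments(3))
  then show "integrable law (\<lambda>w. (?Z w)\<^sup>2)" by (subst (asm) integrable_distr_eq[OF m]) auto
  have "(\<integral>x. x\<^sup>2 \<partial>distr law borel ?Z) = ?\<sigma>\<^sup>2" by (subst d) (rule normal_law_moments(4))
  then show "(\<integral>w. (?Z w)\<^sup>2 \<partial>law) = (\<integral>y. (\<Sum>i\<in>I. c i * u i y)\<^sup>2 \<partial>P)"
    by (subst (asm) integral_distr[OF m]) (auto simp: integral_nonneg_AE)
  have "(\<integral>x. x \<partial>distr law borel ?Z) = 0" by (subst d) (rule normal_law_moments(2))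
  then show "(\<integral>w. ?Z w \<partial>law) = 0" by (subst (asm) integral_distr[OF m]) auto
qed

lemma law_char:
  assumes I: "finite I" and u: "\<And>i. i \<in> I \<Longrightarrow> u i \<in> F"
  shows "(\<integral>w. iexp (\<Sum>i\<in>I. c i * w (u i)) \<partial>law) = exp (- (\<integral>y. (\<Sum>i\<in>I. c i * u i y)\<^sup>2 \<partial>P) / 2)"
proof -
  let ?Z = "\<lambda>w. \<Sum>i\<in>I. c i * w (u i)" and ?\<sigma> = "sqrt (\<integral>y. (\<Sum>i\<in>I. c i * u i y)\<^sup>2 \<partial>P)"
  have m: "?Z \<in> borel_measurable law"
    using law_coordinate[OF u] by (intro borel_measurable_sum borel_measurable_times) auto
  have "char (distr law borel ?Z) 1 = exp (- (1\<^sup>2 * ?\<sigma>\<^sup>2) / 2)"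
    by (subst distr_law[OF I u]) (assumption, rule char_normal_law)
  moreover have "char (distr law borel ?Z) 1 = (\<integral>w. iexp (?Z w) \<partial>law)"
    unfolding char_def by (subst integral_distr[OF m]) simp_all
  ultimately show ?thesis by (simp add: integral_nonneg_AE)
qed

text \<open>By polarisation, from the variances of \<open>f\<close>, \<open>g\<close> and \<open>f + g\<close>.\<close>

lemma law_covariance:
  assumes f: "f \<in> F" and g: "g \<in> F"
  shows "(\<integral>w. w f * w g \<partial>law) = (\<integral>y. f y * g y \<partial>P)"
proof -
  let ?u = "\<lambda>b. if b then f else g"
  have u: "?u b \<in> F" for b using f g by simp
  have q1: "integrable law (\<lambda>w. (w f)\<^sup>2)" "(\<integral>w. (w f)\<^sup>2 \<partial>law) = (\<integral>y. (f y)\<^sup>2 \<partial>P)" if "f \<in> F" for f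
    using law_moments(1,2)[of "{()}" "\<lambda>_. f" "\<lambda>_. 1"] that by auto
  have q2: "integrable law (\<lambda>w. (w f + w g)\<^sup>2)" "(\<integral>w. (w f + w g)\<^sup>2 \<partial>law) = (\<integral>y. (f y + g y)\<^sup>2 \<partial>P)"
    using law_moments(1,2)[of "UNIV :: bool set" ?u "\<lambda>_. 1"] u by (auto simp: UNIV_bool add.commute)
  have pol: "a * b = ((a + b)\<^sup>2 - a\<^sup>2 - b\<^sup>2) / 2" for a b :: real
    by (simp add: power2_eq_square algebra_simps)
  have "(\<integral>w. w f * w g \<partial>law) = ((\<integral>w. (w f + w g)\<^sup>2 \<partial>law) - (\<integral>w. (w f)\<^sup>2 \<partial>law) - (\<integral>w. (w g)\<^sup>2 \<partial>law)) / 2"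
    unfolding pol using q1[OF f] q1[OF g] q2 by simp
  also have "\<dots> = ((\<integral>y. (f y + g y)\<^sup>2 \<partial>P) - (\<integral>y. (f y)\<^sup>2 \<partial>P) - (\<integral>y. (g y)\<^sup>2 \<partial>P)) / 2"
    using q1[OF f] q1[OF g] q2 by simp
  also have "\<dots> = (\<integral>y. f y * g y \<partial>P)"
    unfolding pol using F_square_integrable[OF f] F_square_integrable[OF g]
      square_integrable_add[OF F_square_integrable[OF f] F_square_integrable[OF g]]
    by (simp add: square_integrable_def)
  finally show ?thesis .
qed

lemma law_finite_rank_limit:
  assumes H: "bounded_lipschitz (linfty F) C m H"
  shows "(\<lambda>q. \<integral>w. H (\<lambda>f\<in>F. w (proj q f)) \<partial>law) \<longlonglongrightarrow> (\<integral>w. H w \<partial>law)"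
proof -
  have Hm: "H \<in> borel_measurable law"
    by (rule continuous_map_borel_sigma_measurable[OF sets_law bounded_lipschitz_continuous_map[OF H]])
  have Hqm: "(\<lambda>w. H (\<lambda>f\<in>F. w (proj q f))) \<in> borel_measurable law" for q
  proof -
    from finite_rank_coords[OF H, of q] obtain k e G where G: "lipschitz_coords k m G"
      "\<And>i. e i \<in> proj q ` F" "\<And>v. H (\<lambda>f\<in>F. v (proj q f)) = G (\<lambda>i. v (e i))" by metis
    have "(\<lambda>w. w (e i)) \<in> borel_measurable law" for i
      using G(2)[of i] proj_in by (intro law_coordinate) auto
    then have "(\<lambda>w. G (\<lambda>i. w (e i))) \<in> borel_measurable law"
      by (rule lipschitz_coords_measurable[OF G(1)])
    then show ?thesis by (simp only: G(3))
  qed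
  have m: "m \<ge> 0" using H by (simp add: bounded_lipschitz_def)
  have "(\<lambda>q. \<integral>\<omega>. H (\<lambda>f\<in>F. path \<omega> (proj q f)) \<partial>white_noise) \<longlonglongrightarrow> (\<integral>\<omega>. H (path \<omega>) \<partial>white_noise)"
  proof (rule integral_dominated_convergence[where w="\<lambda>_. C"])
    show "(\<lambda>\<omega>. H (path \<omega>)) \<in> borel_measurable white_noise"
      using measurable_compose[OF path_measurable, of H borel] Hm sets_law measurable_cong_sets by blast
    show "(\<lambda>\<omega>. H (\<lambda>f\<in>F. path \<omega> (proj q f))) \<in> borel_measurable white_noise" for q
      using measurable_compose[OF path_measurable, of "\<lambda>w. H (\<lambda>f\<in>F. w (proj q f))" borel] Hqm sets_law measurable_cong_sets by blast
    show "AE \<omega> in white_noise. (\<lambda>q. H (\<lambda>f\<in>F. path \<omega> (proj q f))) \<longlonglongrightarrow> H (path \<omega>)"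
      using AE_good
    proof eventually_elim
      case (elim \<omega>)
      have "\<bar>H (\<lambda>f\<in>F. path \<omega> (proj q f)) - H (path \<omega>)\<bar> \<le> m * (2 * tail q \<omega>)" for q
      proof -
        have "\<bar>H (\<lambda>f\<in>F. path \<omega> (proj q f)) - H (path \<omega>)\<bar> \<le> m * mdist (linfty F) (\<lambda>f\<in>F. path \<omega> (proj q f)) (path \<omega>)"
          using H proj_comp_in[OF path_in] path_in unfolding bounded_lipschitz_def by blast
        also have "mdist (linfty F) (\<lambda>f\<in>F. path \<omega> (proj q f)) (path \<omega>) \<le> 2 * tail q \<omega>"
          unfolding mdist_linfty_le_iff[OF proj_comp_in[OF path_in] path_in F_nonempty]
          using path_proj[OF elim] by (auto simp: abs_minus_commute)
        finally show ?thesis using m by (simp add: mult_left_mono)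
      qed
      moreover have "(\<lambda>q. m * (2 * tail q \<omega>)) \<longlonglongrightarrow> 0"
        using tendsto_mult_left[OF tail_tendsto[OF elim], of "m * 2"] by (simp add: mult.assoc)
      ultimately show ?case by (rule tendsto_dominated_difference)
    qed
    show "AE \<omega> in white_noise. norm (H (\<lambda>f\<in>F. path \<omega> (proj q f))) \<le> C" for q
      using H proj_comp_in[OF path_in] unfolding bounded_lipschitz_def by (intro AE_I2) auto
  qed simp
  then show ?thesis unfolding integral_law[OF Hm] integral_law[OF Hqm] .
qed

subsection \<open>Tightness\<close>

text \<open>Functions that are approximated, with prescribed quality, by bounded functions of finite rank.\<close>

definition finite_rank_set :: "(nat \<Rightarrow> nat) \<Rightarrow> (nat \<Rightarrow> real) \<Rightarrow> (('a \<Rightarrow> real) \<Rightarrow> real) set" where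
  "finite_rank_set q R = {w \<in> mspace (linfty F). \<forall>m. \<forall>f\<in>F.
     \<bar>w f - w (proj (q m) f)\<bar> \<le> 2 / (m + 1) \<and> \<bar>w (proj (q m) f)\<bar> \<le> R m}"

lemma closedin_finite_rank_set: "closedin (mtopology_of (linfty F)) (finite_rank_set q R)"
proof -
  let ?X = "mtopology_of (linfty F)"
  let ?A = "\<lambda>(m, f). {w \<in> topspace ?X. \<bar>w f - w (proj (q m) f)\<bar> \<in> {..2 / (real m + 1)}} \<inter>
      {w \<in> topspace ?X. \<bar>w (proj (q m) f)\<bar> \<in> {..R m}}"
  have c: "continuous_map ?X euclideanreal (\<lambda>w. \<bar>w f - w g\<bar>)" if "f \<in> F" "g \<in> F" for f g
    by (intro continuous_map_real_abs continuous_map_diff coordinate_continuous_map that)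
  have c': "continuous_map ?X euclideanreal (\<lambda>w. \<bar>w g\<bar>)" if "g \<in> F" for g
    by (intro continuous_map_real_abs coordinate_continuous_map that)
  have "closedin ?X (?A p)" if p: "p \<in> UNIV \<times> F" for p
  proof -
    obtain m f where p: "p = (m, f)" and f: "f \<in> F" using p by auto
    show ?thesis
      unfolding p case_prod_conv
      by (intro closedin_Int closedin_continuous_map_preimage[where Y=euclideanreal] c c' f proj_in) auto
  qed
  then have "closedin ?X (\<Inter>p\<in>UNIV \<times> F. ?A p)"
    using F_nonempty by (intro closedin_Inter) auto
  also have "(\<Inter>p\<in>UNIV \<times> F. ?A p) = finite_rank_set q R"
    using F_nonempty unfolding finite_rank_set_def by (auto simp del: mspace_funspace)
  finally show ?thesis .
qed

text \<open>The set is closed in a complete space.  It is totally bounded because the values at the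
  representatives of a suitable level, rounded to multiples of \<open>\<epsilon> / 4\<close>, take finitely many values on it
  and determine a function up to less than \<open>\<epsilon>\<close>.\<close>

lemma compactin_finite_rank_set: "compactin (mtopology_of (linfty F)) (finite_rank_set q R)"
proof -
  let ?K = "finite_rank_set q R"
  interpret D: Metric_space "mspace (linfty F)" "mdist (linfty F)" by (rule Metric_space_mspace_mdist)
  have Ksub: "?K \<subseteq> mspace (linfty F)" by (auto simp: finite_rank_set_def simp del: mspace_funspace)
  have "D.mtotally_bounded ?K"
    unfolding D.mtotally_bounded_def
  proof (intro allI impI)
    fix \<epsilon> :: real assume e: "\<epsilon> > 0"
    obtain m :: nat where "8 / \<epsilon> < real m" using reals_Archimedean2 by blast
    then have m: "2 / (real m + 1) < \<epsilon> / 4" using e by (simp add: field_simps)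
    let ?J = "proj (q m) ` F"
    define code where "code w = (\<lambda>r\<in>?J. \<lfloor>w r / (\<epsilon> / 4)\<rfloor>)" for w :: "('a \<Rightarrow> real) \<Rightarrow> real"
    define B where "B = \<lceil>R m / (\<epsilon> / 4)\<rceil> + 1"
    have "code ` ?K \<subseteq> PiE ?J (\<lambda>_. {- B..B})"
    proof (intro image_subsetI PiE_I)
      fix w r assume w: "w \<in> ?K" and r: "r \<in> ?J"
      then have "\<bar>w r\<bar> \<le> R m" by (auto simp: finite_rank_set_def)
      then have *: "\<bar>w r / (\<epsilon> / 4)\<bar> \<le> R m / (\<epsilon> / 4)" using e by (simp add: abs_divide divide_right_mono)
      then have "w r / (\<epsilon> / 4) \<le> R m / (\<epsilon> / 4)" "- (R m / (\<epsilon> / 4)) \<le> w r / (\<epsilon> / 4)"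
        using abs_le_D1[OF *] abs_le_D2[OF *] by linarith+
      then have "\<lfloor>w r / (\<epsilon> / 4)\<rfloor> \<le> B" "- B \<le> \<lfloor>w r / (\<epsilon> / 4)\<rfloor>" unfolding B_def by linarith+
      then show "code w r \<in> {- B..B}" using r by (simp add: code_def)
    qed (simp add: code_def)
    moreover have "finite (PiE ?J (\<lambda>_. {- B..B}))" using finite_proj by (intro finite_PiE) auto
    ultimately have "finite (code ` ?K)" by (rule finite_subset)
    then obtain T where T: "T \<subseteq> ?K" "finite T" "code ` ?K = code ` T"
      using finite_subset_image[of "code ` ?K" code ?K] by auto
    have "?K \<subseteq> (\<Union>x\<in>T. D.mball x \<epsilon>)"
    proof
      fix w assume w: "w \<in> ?K"
      then obtain x where x: "x \<in> T" "code w = code x" using T(3) by blast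
      have "mdist (linfty F) x w \<le> 3 * (\<epsilon> / 4)"
      proof (subst mdist_linfty_le_iff)
        show "x \<in> mspace (linfty F)" "w \<in> mspace (linfty F)" using x T w Ksub by auto
        show "\<forall>f\<in>F. \<bar>x f - w f\<bar> \<le> 3 * (\<epsilon> / 4)"
        proof
          fix f assume f: "f \<in> F"
          let ?r = "proj (q m) f"
          have "code w ?r = code x ?r" using x by simp
          then have "\<lfloor>w ?r / (\<epsilon> / 4)\<rfloor> = \<lfloor>x ?r / (\<epsilon> / 4)\<rfloor>" using f by (simp add: code_def)
          then have "\<bar>w ?r / (\<epsilon> / 4) - x ?r / (\<epsilon> / 4)\<bar> < 1" by linarith
          moreover have "w ?r / (\<epsilon> / 4) - x ?r / (\<epsilon> / 4) = (w ?r - x ?r) / (\<epsilon> / 4)" by (simp add: diff_divide_distrib)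
          ultimately have "\<bar>w ?r * 4 - x ?r * 4\<bar> < \<epsilon>" using e by (simp add: abs_divide)
          then have "\<bar>w ?r - x ?r\<bar> < \<epsilon> / 4" by linarith
          moreover have "\<bar>w f - w ?r\<bar> \<le> 2 / (real m + 1)" "\<bar>x f - x ?r\<bar> \<le> 2 / (real m + 1)"
            using w x T f by (auto simp: finite_rank_set_def)
          ultimately show "\<bar>x f - w f\<bar> \<le> 3 * (\<epsilon> / 4)" using m by linarith
        qed
      qed (rule F_nonempty)
      then have "mdist (linfty F) x w < \<epsilon>" using e by linarith
      then show "w \<in> (\<Union>x\<in>T. D.mball x \<epsilon>)" using x T w Ksub by (auto simp: D.in_mball simp del: mspace_funspace mdist_funspace)
    qed
    then show "\<exists>T. finite T \<and> T \<subseteq> ?K \<and> ?K \<subseteq> (\<Union>x\<in>T. D.mball x \<epsilon>)" using T by blast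
  qed
  moreover have "D.mcomplete"
  proof -
    have "Met_TC.mcomplete TYPE(real)" using complete_UNIV by simp
    from Met_TC.mcomplete_funspace[OF this, of F] show ?thesis
      unfolding mcomplete_of_def euclidean_metric_def by simp
  qed
  ultimately have "compactin D.mtopology (D.mtopology closure_of ?K)"
    using D.mtotally_bounded_eq_compact_closure_of[of ?K] by blast
  moreover have "D.mtopology closure_of ?K = ?K"
    using closedin_finite_rank_set by (simp add: mtopology_of_def closure_of_closedin)
  ultimately show ?thesis by (simp add: mtopology_of_def)
qed

lemma noise_integrable: "f \<in> F \<Longrightarrow> integrable white_noise (noise (proj q f))"
proof -
  assume f: "f \<in> F"
  have "distr white_noise borel (noise (proj q f)) = normal_law (sqrt (\<integral>y. (proj q f y)\<^sup>2 \<partial>P))"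
    using distr_noise[of "{()}" "\<lambda>_. proj q f" "\<lambda>_. 1"] proj_reps[OF f] by simp
  then have "integrable (distr white_noise borel (noise (proj q f))) (\<lambda>x. x)"
    using normal_law_moments(1) by simp
  then show ?thesis by (subst (asm) integrable_distr_eq) auto
qed

lemma entropy_tail_tendsto: "(\<lambda>q. \<Sum>i. entropy_term (i + q)) \<longlonglongrightarrow> 0"
  by (rule suminf_exist_split2[OF summable_entropy_term])

text \<open>The tails of the chain and the sizes of the finitely many marginals at a level have finite means,
  and those of the tails tend to 0.  Markov's inequality therefore provides levels \<open>q m\<close> and bounds \<open>r m\<close>
  for which the paths lie in the corresponding compact set outside an event of probability \<open>\<epsilon>\<close>; the
  share of the requirement with index \<open>m\<close> in this event is \<open>\<epsilon> / 2 (1/2)\<^sup>m\<close>.\<close>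

lemma tight_law_law: "tight_law (linfty F) law"
  unfolding tight_law_def
proof (intro allI impI)
  fix \<epsilon> :: real assume e: "\<epsilon> > 0"
  define d where "d m = \<epsilon> / 4 * (1/2)^m" for m :: nat
  have d: "d m > 0" for m using e by (simp add: d_def)
  have "\<exists>q. 2 * (\<Sum>i. entropy_term (i + q)) * (real m + 1) \<le> d m" for m
  proof -
    have "d m / (2 * (real m + 1)) > 0" using d by simp
    from order_tendstoD(2)[OF entropy_tail_tendsto this] obtain q where
      "(\<Sum>i. entropy_term (i + q)) < d m / (2 * (real m + 1))" by (auto simp: eventually_sequentially)
    then show ?thesis by (intro exI[of _ q]) (simp add: field_simps)
  qed
  then obtain q where q: "\<And>m. 2 * (\<Sum>i. entropy_term (i + q m)) * (real m + 1) \<le> d m" by metis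
  define s where "s m \<omega> = (\<Sum>r\<in>proj (q m) ` F. \<bar>noise r \<omega>\<bar>)" for m \<omega>
  have s_int: "integrable white_noise (s m)" for m
    unfolding s_def using noise_integrable by (intro Bochner_Integration.integrable_sum integrable_abs) auto
  have s_nn: "0 \<le> s m \<omega>" for m \<omega> by (simp add: s_def sum_nonneg)
  define r where "r m = ((\<integral>\<omega>. s m \<omega> \<partial>white_noise) + 1) / d m" for m
  have Es: "(\<integral>\<omega>. s m \<omega> \<partial>white_noise) \<ge> 0" for m using s_nn by (simp add: integral_nonneg_AE)
  have r: "r m > 0" for m using Es[of m] d[of m] by (simp add: r_def add_nonneg_pos)
  define K where "K = finite_rank_set q (\<lambda>m. r m + 1)"
  define A where "A m = {\<omega> \<in> space white_noise. 1 / (real m + 1) \<le> tail (q m) \<omega> * indicator good \<omega>} \<union>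
      {\<omega> \<in> space white_noise. r m \<le> s m \<omega>}" for m
  have sm [measurable]: "s m \<in> borel_measurable white_noise" for m by (rule borel_measurable_integrable[OF s_int])
  have A: "A m \<in> sets white_noise" for m unfolding A_def by measurable
  have tail_nn: "0 \<le> tail q \<omega> * indicator good \<omega>" for q \<omega>
    using link_nonneg good_summable unfolding tail_def
    by (auto simp: indicator_def intro!: suminf_nonneg summable_ignore_initial_segment)
  have pA: "measure white_noise (A m) \<le> \<epsilon> / 2 * (1/2)^m" for m
  proof -
    have "measure white_noise {\<omega> \<in> space white_noise. 1 / (real m + 1) \<le> tail (q m) \<omega> * indicator good \<omega>}
        \<le> (\<integral>\<omega>. tail (q m) \<omega> * indicator good \<omega> \<partial>white_noise) / (1 / (real m + 1))"
      by (rule integral_Markov_inequality_measure[where A="{}", OF tail_expectation(1)]) (auto simp: tail_nn)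
    also have "\<dots> \<le> 2 * (\<Sum>i. entropy_term (i + q m)) / (1 / (real m + 1))"
      by (rule divide_right_mono[OF tail_expectation(2)]) simp
    also have "\<dots> \<le> d m" using q[of m] by simp
    finally have 1: "measure white_noise {\<omega> \<in> space white_noise. 1 / (real m + 1) \<le> tail (q m) \<omega> * indicator good \<omega>} \<le> d m" .
    have "measure white_noise {\<omega> \<in> space white_noise. r m \<le> s m \<omega>} \<le> (\<integral>\<omega>. s m \<omega> \<partial>white_noise) / r m"
      by (rule integral_Markov_inequality_measure[where A="{}", OF s_int]) (auto simp: s_nn r)
    also have "\<dots> \<le> d m"
      using Es[of m] d[of m] r[of m] by (simp add: r_def divide_le_eq)
    finally have 2: "measure white_noise {\<omega> \<in> space white_noise. r m \<le> s m \<omega>} \<le> d m" .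
    have "measure white_noise (A m) \<le> d m + d m"
      unfolding A_def by (rule order_trans[OF measure_Un_le]) (use 1 2 in \<open>auto intro: add_mono\<close>)
    then show ?thesis by (simp add: d_def)
  qed
  have geo: "(\<lambda>m. \<epsilon> / 2 * (1/2)^m) sums \<epsilon>"
    using sums_mult[OF geometric_sums[of "1/2::real"], of "\<epsilon> / 2"] by simp
  have sumA: "summable (\<lambda>m. measure white_noise (A m))"
    by (rule summable_comparison_test'[OF sums_summable[OF geo]]) (use pA in auto)
  have "measure white_noise (\<Union>m. A m) \<le> (\<Sum>m. measure white_noise (A m))"
    using A sumA by (intro white_noise.finite_measure_subadditive_countably) auto
  also have "\<dots> \<le> \<epsilon>"
    using suminf_le[OF pA sumA sums_summable[OF geo]] sums_unique[OF geo] by simp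
  finally have bad: "measure white_noise (\<Union>m. A m) \<le> \<epsilon>" .
  have "path \<omega> \<in> K" if \<omega>: "\<omega> \<in> good" "\<omega> \<notin> (\<Union>m. A m)" for \<omega>
    unfolding K_def finite_rank_set_def
  proof (intro CollectI conjI allI ballI path_in)
    fix m f assume f: "f \<in> F"
    have sp: "\<omega> \<in> space white_noise" using \<omega>(1) by (simp add: good_def)
    have t: "tail (q m) \<omega> < 1 / (real m + 1)" and sr: "s m \<omega> < r m"
      using \<omega> sp by (auto simp: A_def not_le)
    show "\<bar>path \<omega> f - path \<omega> (proj (q m) f)\<bar> \<le> 2 / (real m + 1)"
      using path_proj[OF \<omega>(1) f, of "q m"] t by simp
    have "\<bar>noise (proj (q m) f) \<omega>\<bar> \<le> s m \<omega>"
      unfolding s_def using finite_proj f by (intro member_le_sum) auto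
    moreover have "\<bar>path \<omega> (proj (q m) f) - noise (proj (q m) f) \<omega>\<bar> \<le> tail (q m) \<omega>"
      using path_limit(2)[OF \<omega>(1) proj_in[OF f], of "q m" "q m"] proj_proj[of "q m" "q m" f] f by simp
    moreover have "1 / (real m + 1) \<le> 1" by simp
    ultimately show "\<bar>path \<omega> (proj (q m) f)\<bar> \<le> r m + 1" using t sr by linarith
  qed
  then have sub: "good - (\<Union>m. A m) \<subseteq> path -` K \<inter> space white_noise" by (auto simp: good_def)
  have Kc: "closedin (mtopology_of (linfty F)) K" unfolding K_def by (rule closedin_finite_rank_set)
  have Km: "K \<in> sets (borel_sigma (linfty F))"
  proof -
    have "mspace (linfty F) - K \<in> sets (borel_sigma (linfty F))"
      unfolding sets_borel_sigma using Kc by (intro sigma_sets.Basic) (simp add: closedin_def)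
    then have "space (borel_sigma (linfty F)) - (mspace (linfty F) - K) \<in> sets (borel_sigma (linfty F))" by (rule sets.compl_sets)
    moreover have "space (borel_sigma (linfty F)) - (mspace (linfty F) - K) = K"
      using closedin_subset[OF Kc] by (auto simp: space_borel_sigma simp del: mspace_funspace)
    ultimately show ?thesis by simp
  qed
  have "1 - \<epsilon> \<le> measure white_noise (good - (\<Union>m. A m))"
  proof -
    have g1: "measure white_noise good = 1"
      using AE_good white_noise.prob_eq_1[OF good_measurable] by simp
    have "measure white_noise good \<le> measure white_noise ((good - (\<Union>m. A m)) \<union> (\<Union>m. A m))"
      using A by (intro white_noise.finite_measure_mono) auto
    also have "\<dots> \<le> measure white_noise (good - (\<Union>m. A m)) + measure white_noise (\<Union>m. A m)"
      using A by (intro measure_Un_le) auto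
    finally show ?thesis using g1 bad by linarith
  qed
  also have "\<dots> \<le> measure white_noise (path -` K \<inter> space white_noise)"
    using sub measurable_sets[OF path_measurable Km] by (intro white_noise.finite_measure_mono) auto
  also have "\<dots> = measure law K" unfolding law_def by (rule measure_distr[OF path_measurable Km, symmetric])
  finally show "\<exists>K. compactin (mtopology_of (linfty F)) K \<and> 1 - \<epsilon> \<le> measure law K"
    using compactin_finite_rank_set unfolding K_def by blast
qed

theorem isonormal_law: "isonormal_gaussian_law P F law"
  unfolding isonormal_gaussian_law_def
proof (intro conjI allI impI ballI)
  show "prob_space law" by (rule prob_space_law)
  show "space law = mspace (linfty F)" by (rule space_law)
  show "sets law = sets (borel_sigma (linfty F))" by (rule sets_law)
  show "tight_law (linfty F) law" by (rule tight_law_law)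
  show "gaussian_law (distr law borel (\<lambda>w. \<Sum>f\<in>A. c f * w f))" if "finite A \<and> A \<subseteq> F" for A c
  proof -
    have "distr law borel (\<lambda>w. \<Sum>f\<in>A. c f * w f) = normal_law (sqrt (\<integral>y. (\<Sum>f\<in>A. c f * f y)\<^sup>2 \<partial>P))"
      by (rule distr_law) (use that in auto)
    then show ?thesis by (simp only: gaussian_normal_law)
  qed
  show "(\<integral>w. w f \<partial>law) = 0" if "f \<in> F" for f
    using law_moments(3)[of "{()}" "\<lambda>_. f" "\<lambda>_. 1"] that by simp
  show "(\<integral>w. w f * w g \<partial>law) = (\<integral>y. f y * g y \<partial>P)" if "f \<in> F" "g \<in> F" for f g
    by (rule law_covariance[OF that])
qed

end

section \<open>From the bracketing integral to a chain\<close>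

lemma bracket_covers_mono:
  assumes "\<epsilon> \<le> \<epsilon>'"
  shows "bracket_covers \<epsilon> F P \<subseteq> bracket_covers \<epsilon>' F P"
proof -
  have "L2_norm_less P f \<epsilon>'" if "L2_norm_less P f \<epsilon>" for f
    using that assms unfolding L2_norm_less_def by linarith
  then show ?thesis unfolding bracket_covers_def by blast
qed

lemma bracketing_number_antimono: "\<epsilon> \<le> \<epsilon>' \<Longrightarrow> bracketing_number \<epsilon>' F P \<le> bracketing_number \<epsilon> F P"
  unfolding bracketing_number_def by (rule INF_superset_mono[OF bracket_covers_mono]) auto

lemma bracketing_number_cover:
  assumes "bracketing_number \<epsilon> F P = enat k"
  obtains B where "B \<in> bracket_covers \<epsilon> F P" "card B = k"
proof -
  let ?A = "(\<lambda>B. enat (card B)) ` bracket_covers \<epsilon> F P"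
  have "?A \<noteq> {}"
  proof
    assume "?A = {}"
    then have "bracketing_number \<epsilon> F P = \<infinity>" unfolding bracketing_number_def by (simp add: Inf_enat_def)
    then show False using assms by simp
  qed
  then have "Inf ?A \<in> ?A" unfolding Inf_enat_def by (auto intro: LeastI)
  then show ?thesis using assms that unfolding bracketing_number_def by auto
qed

lemma sqrt_log_mono: "m \<le> n \<Longrightarrow> sqrt_log m \<le> sqrt_log n"
proof (cases m; cases n)
  fix k l assume "m \<le> n" "m = enat k" "n = enat l"
  then show ?thesis
    by (cases "k = 0"; cases "l = 0") (auto simp: sqrt_log_def intro!: ennreal_leI)
qed (auto simp: sqrt_log_def)

lemma bracketing_integral_top:
  "bracketing_integral \<infinity> F P = (\<integral>\<^sup>+\<epsilon>\<in>{0<..}. sqrt_log (bracketing_number \<epsilon> F P) \<partial>lborel)"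
  unfolding bracketing_integral_def by (simp add: greaterThan_def)

text \<open>An infinite bracketing number at one scale is infinite at all smaller scales, an interval of
  positive length.\<close>

lemma bracketing_number_finite:
  assumes J: "bracketing_integral \<infinity> F P < \<infinity>" and e: "\<epsilon> > 0"
  shows "bracketing_number \<epsilon> F P \<noteq> \<infinity>"
proof
  assume inf: "bracketing_number \<epsilon> F P = \<infinity>"
  have "(\<integral>\<^sup>+x. \<infinity> * indicator {0<..<\<epsilon>} x \<partial>lborel) \<le> bracketing_integral \<infinity> F P"
    unfolding bracketing_integral_top
  proof (rule nn_integral_mono)
    fix x :: real
    show "\<infinity> * indicator {0<..<\<epsilon>} x \<le> sqrt_log (bracketing_number x F P) * indicator {0<..} x"
    proof (cases "x \<in> {0<..<\<epsilon>}")
      case True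
      then have "bracketing_number x F P = \<infinity>" using bracketing_number_antimono[of x \<epsilon> F P] inf by simp
      then show ?thesis using True by (simp add: sqrt_log_def)
    qed simp
  qed
  moreover have "(\<integral>\<^sup>+x. \<infinity> * indicator {0<..<\<epsilon>} x \<partial>lborel) = \<infinity>"
    using e by (subst nn_integral_cmult_indicator) (auto simp: ennreal_top_mult)
  ultimately show False using J by simp
qed

text \<open>On the interval from \<open>(1/2)\<^sup>q\<^sup>+\<^sup>1\<close> to \<open>(1/2)\<^sup>q\<close>, the integrand is at least its value at the right
  end.\<close>

lemma dyadic_entropy_summable:
  assumes J: "bracketing_integral \<infinity> F P < \<infinity>"
    and k: "\<And>q. bracketing_number ((1/2)^q) F P = enat (k q)" "\<And>q. k q \<ge> 1"
  shows "summable (\<lambda>q. (1/2)^q * sqrt (ln (real (k q))))"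
proof -
  define s where "s q = sqrt (ln (real (k q)))" for q
  have s0: "s q \<ge> 0" for q using k(2)[of q] by (simp add: s_def)
  define A where "A q = {(1/2)^Suc q<..(1/2::real)^q}" for q :: nat
  have disj: "disjoint_family A"
    unfolding disjoint_family_on_def
  proof (intro ballI impI)
    have *: "A p \<inter> A q = {}" if "p < q" for p q
    proof -
      have "(1/2::real)^q \<le> (1/2)^Suc p" using that by (intro power_decreasing) auto
      then show ?thesis by (auto simp: A_def)
    qed
    fix p q :: nat assume "p \<noteq> q"
    then show "A p \<inter> A q = {}" using *[of p q] *[of q p] by (cases "p < q") auto
  qed
  have "(\<integral>\<^sup>+x. (\<Sum>q. ennreal (s q) * indicator (A q) x) \<partial>lborel) \<le> bracketing_integral \<infinity> F P"
    unfolding bracketing_integral_top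
  proof (rule nn_integral_mono)
    fix x :: real
    show "(\<Sum>q. ennreal (s q) * indicator (A q) x) \<le> sqrt_log (bracketing_number x F P) * indicator {0<..} x"
    proof (cases "\<exists>q. x \<in> A q")
      case True
      then obtain q where q: "x \<in> A q" by auto
      have "(\<Sum>q. ennreal (s q) * indicator (A q) x) = ennreal (s q)"
        by (rule suminf_cmult_indicator[OF disj q])
      also have "\<dots> = sqrt_log (bracketing_number ((1/2)^q) F P)" unfolding k by (simp add: sqrt_log_def s_def)
      also have "\<dots> \<le> sqrt_log (bracketing_number x F P)"
        using q by (intro sqrt_log_mono bracketing_number_antimono) (simp add: A_def)
      also have "x > 0"
      proof -
        have "(0::real) < (1/2)^Suc q" by simp
        also have "\<dots> < x" using q by (simp add: A_def)
        finally show ?thesis .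
      qed
      then have "sqrt_log (bracketing_number x F P) = sqrt_log (bracketing_number x F P) * indicator {0<..} x" by simp
      finally show ?thesis .
    next
      case False
      then show ?thesis by simp
    qed
  qed
  moreover have "(\<integral>\<^sup>+x. (\<Sum>q. ennreal (s q) * indicator (A q) x) \<partial>lborel) = (\<Sum>q. ennreal (s q * (1/2)^Suc q))"
  proof -
    have "(\<integral>\<^sup>+x. (\<Sum>q. ennreal (s q) * indicator (A q) x) \<partial>lborel) = (\<Sum>q. \<integral>\<^sup>+x. ennreal (s q) * indicator (A q) x \<partial>lborel)"
      by (rule nn_integral_suminf) (simp add: A_def)
    moreover have "(\<integral>\<^sup>+x. ennreal (s q) * indicator (A q) x \<partial>lborel) = ennreal (s q * (1/2)^Suc q)" for q
    proof -
      have "emeasure lborel (A q) = ennreal ((1/2)^Suc q)"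
        unfolding A_def by (subst emeasure_lborel_Ioc) auto
      moreover have "(\<integral>\<^sup>+x. ennreal (s q) * indicator (A q) x \<partial>lborel) = ennreal (s q) * emeasure lborel (A q)"
        by (rule nn_integral_cmult_indicator) (simp add: A_def)
      moreover have "ennreal (s q) * ennreal ((1/2)^Suc q) = ennreal (s q * (1/2)^Suc q)"
        by (rule ennreal_mult[symmetric]) (use s0 in auto)
      ultimately show ?thesis by simp
    qed
    ultimately show ?thesis by (simp only:)
  qed
  ultimately have "(\<Sum>q. ennreal (s q * (1/2)^Suc q)) \<noteq> top" using J by auto
  then have "summable (\<lambda>q. s q * (1/2)^Suc q)" using s0 by (intro summable_suminf_not_top) auto
  then have "summable (\<lambda>q. 2 * (s q * (1/2)^Suc q))" by (rule summable_mult)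
  then show ?thesis by (simp add: s_def mult.commute)
qed

lemma sqrt_sum_le:
  fixes a :: "'i \<Rightarrow> real"
  assumes "finite I" "\<And>i. i \<in> I \<Longrightarrow> 0 \<le> a i"
  shows "sqrt (\<Sum>i\<in>I. a i) \<le> (\<Sum>i\<in>I. sqrt (a i))"
  using assms
proof (induction I rule: finite_induct)
  case (insert x I)
  have "sqrt (a x + sum a I) \<le> sqrt (a x) + sqrt (sum a I)"
    using insert by (intro sqrt_add_le_add_sqrt sum_nonneg) auto
  also have "\<dots> \<le> sqrt (a x) + (\<Sum>i\<in>I. sqrt (a i))" using insert by simp
  finally show ?case using insert by simp
qed simp

text \<open>Intersecting the covers of all coarser levels multiplies their cardinalities, which is
  harmless: the square root of the logarithm of the product is at most the sum of the square roots,
  and convolution with a geometric sequence preserves summability.\<close>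

lemma product_entropy_summable:
  assumes s: "summable (\<lambda>q. (1/2)^q * sqrt (ln (real (k q))))" and k: "\<And>q. k q \<ge> (1::nat)"
  shows "summable (\<lambda>q. (1/2)^q * sqrt (ln (2 * (\<Prod>p\<le>q. real (k p)))))"
proof (rule summable_comparison_test')
  have nn: "0 \<le> ln (real (k q))" for q using k[of q] by simp
  let ?a = "\<lambda>p. (1/2)^p * sqrt (ln (real (k p)))" and ?b = "\<lambda>q. (1/2::real)^q"
  have "summable (\<lambda>q. \<Sum>p\<le>q. ?a p * ?b (q - p))"
    using s nn by (intro summable_Cauchy_product) auto
  moreover have "(\<Sum>p\<le>q. ?a p * ?b (q - p)) = (1/2)^q * (\<Sum>p\<le>q. sqrt (ln (real (k p))))" for q
  proof -
    have "?a p * ?b (q - p) = (1/2)^q * sqrt (ln (real (k p)))" if "p \<le> q" for p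
    proof -
      have "(1/2::real)^p * (1/2)^(q - p) = (1/2)^q" using that by (simp flip: power_add)
      then show ?thesis by (simp add: mult_ac)
    qed
    then show ?thesis unfolding sum_distrib_left by (intro sum.cong) auto
  qed
  ultimately have "summable (\<lambda>q. (1/2)^q * (\<Sum>p\<le>q. sqrt (ln (real (k p)))))" by simp
  then show "summable (\<lambda>q. (1/2)^q * sqrt (ln 2) + (1/2)^q * (\<Sum>p\<le>q. sqrt (ln (real (k p)))))"
    by (intro summable_add summable_mult2 summable_geometric) auto
  fix q :: nat
  have pos: "(\<Prod>p\<le>q. real (k p)) > 0" using k by (intro prod_pos) (metis of_nat_0_less_iff less_le_trans zero_less_one)
  have "ln (2 * (\<Prod>p\<le>q. real (k p))) = ln 2 + (\<Sum>p\<le>q. ln (real (k p)))"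
  proof -
    have "real (k p) > 0" for p using k[of p] by simp
    then have "ln (\<Prod>p\<le>q. real (k p)) = (\<Sum>p\<le>q. ln (real (k p)))" by (intro ln_prod) auto
    moreover have "ln (2 * (\<Prod>p\<le>q. real (k p))) = ln 2 + ln (\<Prod>p\<le>q. real (k p))"
      using pos by (intro ln_mult_pos) auto
    ultimately show ?thesis by simp
  qed
  then have "sqrt (ln (2 * (\<Prod>p\<le>q. real (k p)))) \<le> sqrt (ln 2) + sqrt (\<Sum>p\<le>q. ln (real (k p)))"
    using nn by (simp add: sqrt_add_le_add_sqrt sum_nonneg)
  also have "\<dots> \<le> sqrt (ln 2) + (\<Sum>p\<le>q. sqrt (ln (real (k p))))"
    using nn by (intro add_left_mono sqrt_sum_le) auto
  finally have "(1/2)^q * sqrt (ln (2 * (\<Prod>p\<le>q. real (k p)))) \<le> (1/2)^q * (sqrt (ln 2) + (\<Sum>p\<le>q. sqrt (ln (real (k p)))))"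
    by (intro mult_left_mono) auto
  moreover have "0 \<le> sqrt (ln (2 * (\<Prod>p\<le>q. real (k p))))"
  proof -
    have "(\<Prod>p\<le>q. real (k p)) \<ge> 1" using k by (intro prod_ge_1) (metis of_nat_1 of_nat_le_iff)
    then show ?thesis by simp
  qed
  ultimately show "norm ((1/2)^q * sqrt (ln (2 * (\<Prod>p\<le>q. real (k p))))) \<le>
      (1/2)^q * sqrt (ln 2) + (1/2)^q * (\<Sum>p\<le>q. sqrt (ln (real (k p))))"
    by (simp add: distrib_left)
qed

text \<open>Pointwise measurability replaces the supremum over the class by a countable one.\<close>

lemma envelope_borel:
  assumes "F \<subseteq> borel_measurable borel" "pointwise_measurable F"
  shows "envelope F \<in> borel_measurable borel"
proof -
  obtain F0 where F0: "countable F0" "F0 \<subseteq> F"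
    and lim: "\<And>f. f \<in> F \<Longrightarrow> \<exists>g :: nat \<Rightarrow> _. (\<forall>m. g m \<in> F0) \<and> (\<forall>y. (\<lambda>m. g m y) \<longlonglongrightarrow> f y)"
    using assms(2) unfolding pointwise_measurable_def by blast
  have "envelope F y = (SUP f\<in>F0. ennreal \<bar>f y\<bar>)" for y
    unfolding envelope_def
  proof (rule antisym)
    show "(SUP f\<in>F. ennreal \<bar>f y\<bar>) \<le> (SUP f\<in>F0. ennreal \<bar>f y\<bar>)"
    proof (rule SUP_least)
      fix f assume "f \<in> F"
      from lim[OF this] obtain g where g: "\<And>m. g m \<in> F0" "(\<lambda>m. g m y) \<longlonglongrightarrow> f y" by blast
      then have "(\<lambda>m. ennreal \<bar>g m y\<bar>) \<longlonglongrightarrow> ennreal \<bar>f y\<bar>" by (intro tendsto_intros)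
      then show "ennreal \<bar>f y\<bar> \<le> (SUP f\<in>F0. ennreal \<bar>f y\<bar>)"
        by (rule LIMSEQ_le_const2) (intro exI[of _ 0] allI impI SUP_upper g(1))
    qed
    show "(SUP f\<in>F0. ennreal \<bar>f y\<bar>) \<le> (SUP f\<in>F. ennreal \<bar>f y\<bar>)"
      by (rule SUP_subset_mono[OF F0(2)]) simp
  qed
  then have "envelope F = (\<lambda>y. SUP f\<in>F0. ennreal \<bar>f y\<bar>)" by auto
  moreover have "(\<lambda>y. SUP f\<in>F0. ennreal \<bar>f y\<bar>) \<in> borel_measurable borel"
    using F0 assms(1) by (intro borel_measurable_SUP) auto
  ultimately show ?thesis by simp
qed

text \<open>Every function is assigned a bracket at each scale \<open>(1/2)\<^sup>p\<close>; functions with the same brackets up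
  to \<open>p = q\<close> form a cell of level \<open>q\<close>.  The width is the least of the widths of these brackets, cut off
  outside \<open>S\<close>, where all functions of the class vanish, and at twice the envelope.\<close>

theorem bracketing_chain_exists:
  fixes F :: "('a::topological_space \<Rightarrow> real) set"
  assumes P: "prob_space P" "sets P = sets borel" and F: "F \<noteq> {}" "F \<subseteq> borel_measurable borel"
    and pm: "pointwise_measurable F" and S: "S \<in> sets borel" "\<And>f y. f \<in> F \<Longrightarrow> y \<notin> S \<Longrightarrow> f y = 0"
    and env2: "(\<integral>\<^sup>+y. (envelope F y)\<^sup>2 \<partial>P) < \<infinity>" and J: "bracketing_integral \<infinity> F P < \<infinity>"
  obtains proj width N where "bracketing_chain P F S (\<lambda>y. enn2real (envelope F y)) proj width N"
proof -
  interpret P: prob_space P by fact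
  have "\<exists>k. bracketing_number ((1/2)^q) F P = enat k" for q :: nat
    using bracketing_number_finite[OF J, of "(1/2)^q"] by auto
  then obtain k where k: "\<And>q::nat. bracketing_number ((1/2)^q) F P = enat (k q)" by metis
  have "\<exists>B. B \<in> bracket_covers ((1/2)^q) F P \<and> card B = k q" for q :: nat
    using bracketing_number_cover[OF k[of q]] by blast
  then obtain B where B: "\<And>q::nat. B q \<in> bracket_covers ((1/2)^q) F P" "\<And>q. card (B q) = k q" by metis
  have Bfin: "finite (B q)" for q using B(1)[of q] by (auto simp: bracket_covers_def)
  have Bcov: "\<exists>b\<in>B q. f \<in> bracket (fst b) (snd b)" if "f \<in> F" for f q
    using B(1)[of q] that by (auto simp: bracket_covers_def split_beta)
  have Bb: "fst b \<in> borel_measurable borel" "snd b \<in> borel_measurable borel" "L2_norm_less P (\<lambda>y. snd b y - fst b y) ((1/2)^q)"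
    if "b \<in> B q" for b q
    using B(1)[of q] that by (auto simp: bracket_covers_def split_beta)
  have k1: "k q \<ge> 1" for q
  proof -
    obtain f where "f \<in> F" using F by auto
    then have "B q \<noteq> {}" using Bcov[of f q] by auto
    then show ?thesis using Bfin[of q] B(2)[of q] by (metis One_nat_def Suc_le_eq card_gt_0_iff)
  qed
  define env where "env y = enn2real (envelope F y)" for y
  have upper: "ennreal \<bar>f y\<bar> \<le> envelope F y" if "f \<in> F" for f y
    unfolding envelope_def by (rule SUP_upper[OF that])
  \<comment> \<open>finitely many real-valued brackets cover the class, so the envelope is finite everywhere\<close>
  have fin: "envelope F y < \<infinity>" for y
  proof -
    have "envelope F y \<le> ennreal (\<Sum>b\<in>B 0. \<bar>fst b y\<bar> + \<bar>snd b y\<bar>)"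
      unfolding envelope_def
    proof (rule SUP_least, rule ennreal_leI)
      fix f assume "f \<in> F"
      then obtain b where b: "b \<in> B 0" "f \<in> bracket (fst b) (snd b)" using Bcov by blast
      then have "fst b y \<le> f y" "f y \<le> snd b y" by (auto simp: bracket_def)
      then have "\<bar>f y\<bar> \<le> \<bar>fst b y\<bar> + \<bar>snd b y\<bar>" by linarith
      also have "\<dots> \<le> (\<Sum>b\<in>B 0. \<bar>fst b y\<bar> + \<bar>snd b y\<bar>)"
        using Bfin b by (intro member_le_sum) auto
      finally show "\<bar>f y\<bar> \<le> (\<Sum>b\<in>B 0. \<bar>fst b y\<bar> + \<bar>snd b y\<bar>)" .
    qed
    then show ?thesis by (rule order.strict_trans1) simp
  qed
  have env_eq: "envelope F y = ennreal (env y)" for y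
    using fin[of y] by (simp add: env_def ennreal_enn2real)
  have env0: "env y \<ge> 0" for y by (simp add: env_def)
  have env_upper: "\<bar>f y\<bar> \<le> env y" if "f \<in> F" for f y
    using upper[OF that, of y] env0 unfolding env_eq by simp
  have env_b: "env \<in> borel_measurable borel"
    unfolding env_def[abs_def] using envelope_borel[OF F(2) pm] by measurable
  have env_S: "env y = 0" if "y \<notin> S" for y
  proof -
    have "envelope F y \<le> 0" unfolding envelope_def using S(2) that by (intro SUP_least) auto
    then show ?thesis by (simp add: env_def)
  qed
  have mP: "g \<in> borel_measurable P" if "g \<in> borel_measurable borel" for g :: "'a \<Rightarrow> real"
    using that P(2) measurable_cong_sets by blast
  have env_L2: "integrable P (\<lambda>y. (env y)\<^sup>2)"
  proof (rule integrableI_nonneg)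
    have "(\<integral>\<^sup>+y. ennreal ((env y)\<^sup>2) \<partial>P) = (\<integral>\<^sup>+y. (envelope F y)\<^sup>2 \<partial>P)"
      unfolding env_eq by (simp add: ennreal_power env0)
    then show "(\<integral>\<^sup>+y. ennreal ((env y)\<^sup>2) \<partial>P) < \<infinity>" using env2 by simp
  qed (use mP[OF env_b] in auto)
  define br where "br q f = (SOME b. b \<in> B q \<and> f \<in> bracket (fst b) (snd b))" for q f
  have br: "br q f \<in> B q" "f \<in> bracket (fst (br q f)) (snd (br q f))" if "f \<in> F" for q f
    using someI_ex[of "\<lambda>b. b \<in> B q \<and> f \<in> bracket (fst b) (snd b)"] Bcov[OF that, of q] unfolding br_def by blast+
  define key where "key q f = (\<lambda>p\<in>{..q}. br p f)" for q f
  have key_eq: "key q f = key q g \<longleftrightarrow> (\<forall>p\<le>q. br p f = br p g)" for q f g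
    unfolding key_def restrict_def fun_eq_iff by auto
  define proj where "proj q f = (SOME g. g \<in> F \<and> key q g = key q f)" for q f
  have proj: "proj q f \<in> F" "key q (proj q f) = key q f" if "f \<in> F" for q f
    using someI_ex[of "\<lambda>g. g \<in> F \<and> key q g = key q f"] that unfolding proj_def by blast+
  have br_proj: "br p (proj q f) = br p f" if "f \<in> F" "p \<le> q" for p q f
    using proj(2)[OF that(1), of q] that(2) unfolding key_eq by blast
  define gap where "gap p f y = (snd (br p f) y - fst (br p f) y) * indicator S y" for p f y
  define width where "width q f y = min (2 * env y) (Min ((\<lambda>p. gap p f y) ` {..q}))" for q f y
  define N where "N q = (\<Prod>p\<le>q. real (k p))" for q
  have gap_proj: "gap p (proj q f) = gap p f" if "f \<in> F" "p \<le> q" for p q f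
    unfolding gap_def br_proj[OF that] ..
  have gap_near: "\<bar>f y - g y\<bar> \<le> gap p f y" if "f \<in> F" "g \<in> F" "br p f = br p g" for f g p y
  proof (cases "y \<in> S")
    case True
    have "fst (br p f) y \<le> f y" "f y \<le> snd (br p f) y" using br(2)[OF that(1), of p] by (auto simp: bracket_def)
    moreover have "fst (br p f) y \<le> g y" "g y \<le> snd (br p f) y" using br(2)[OF that(2), of p] that(3) by (auto simp: bracket_def)
    ultimately show ?thesis using True by (simp add: gap_def abs_le_iff)
  next
    case False
    then show ?thesis using S(2)[OF that(1) False] S(2)[OF that(2) False] by (simp add: gap_def)
  qed
  have gap_b: "gap p f \<in> borel_measurable borel" if "f \<in> F" for p f
    unfolding gap_def[abs_def] using Bb(1,2)[OF br(1)[OF that]] S(1) by measurable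
  have width_b: "width q f \<in> borel_measurable borel" if "f \<in> F" for q f
    unfolding width_def[abs_def] using gap_b[OF that] env_b
    by (intro borel_measurable_min borel_measurable_Max borel_measurable_Min borel_measurable_times) auto
  have width_gap: "width q f y \<le> gap q f y" for q f y
    unfolding width_def by (rule min.coboundedI2, rule Min_le) auto
  have near: "\<bar>f y - proj q f y\<bar> \<le> width q f y" if f: "f \<in> F" for q f y
    unfolding width_def
  proof (rule min.boundedI)
    show "\<bar>f y - proj q f y\<bar> \<le> 2 * env y" using env_upper[OF f, of y] env_upper[OF proj(1)[OF f], of q y] by linarith
    show "\<bar>f y - proj q f y\<bar> \<le> Min ((\<lambda>p. gap p f y) ` {..q})"
      using gap_near[OF f proj(1)[OF f]] br_proj[OF f] by (intro Min.boundedI) auto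
  qed
  have "bracketing_chain P F S env proj width N"
  proof
    show "proj p (proj q f) = proj p f" if "p \<le> q" "f \<in> F" for p q f
    proof -
      have "key p (proj q f) = key p f" unfolding key_eq using br_proj[OF that(2)] that(1) by auto
      then show ?thesis unfolding proj_def[of p] by simp
    qed
    have sub: "key q ` F \<subseteq> PiE {..q} B" for q using br(1) unfolding key_def by (intro image_subsetI restrict_PiE_iff[THEN iffD2] ballI) auto
    have finkey: "finite (key q ` F)" for q
      by (rule finite_subset[OF sub]) (use Bfin in \<open>auto intro: finite_PiE\<close>)
    define pick where "pick q c = (SOME g. g \<in> F \<and> key q g = c)" for q c
    have img: "proj q ` F = pick q ` key q ` F" for q unfolding proj_def pick_def by auto
    show "finite (proj q ` F)" for q unfolding img using finkey by simp
    show "real (card (proj q ` F)) \<le> N q" for q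
    proof -
      have "card (proj q ` F) \<le> card (key q ` F)" unfolding img by (rule card_image_le[OF finkey])
      also have "\<dots> \<le> card (PiE {..q} B)"
        by (rule card_mono[OF _ sub]) (use Bfin in \<open>auto intro: finite_PiE\<close>)
      also have "\<dots> = (\<Prod>p\<le>q. k p)" by (simp add: card_PiE B(2))
      finally show ?thesis unfolding N_def by (metis of_nat_le_iff of_nat_prod)
    qed
    show "width q (proj q f) = width q f" if "f \<in> F" for q f
    proof
      fix y
      have "(\<lambda>p. gap p (proj q f) y) ` {..q} = (\<lambda>p. gap p f y) ` {..q}"
        using gap_proj[OF that] by (intro image_cong) auto
      then show "width q (proj q f) y = width q f y" by (simp only: width_def)
    qed
    show "width (Suc q) f y \<le> width q f y" for q f y
      unfolding width_def by (intro min.mono order_refl Min_antimono) auto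
    show "(\<integral>y. (width q f y)\<^sup>2 \<partial>P) \<le> (1/4)^q" if f: "f \<in> F" for q f
    proof -
      let ?d = "\<lambda>y. snd (br q f) y - fst (br q f) y"
      have d: "integrable P (\<lambda>y. (?d y)\<^sup>2)" "sqrt (\<integral>y. (?d y)\<^sup>2 \<partial>P) < (1/2)^q"
        using Bb(3)[OF br(1)[OF f]] by (auto simp: L2_norm_less_def)
      have le: "(width q f y)\<^sup>2 \<le> (?d y)\<^sup>2" for y
      proof (rule power_mono)
        have "0 \<le> width q f y" using near[OF f, of y q] by linarith
        then show "0 \<le> width q f y" .
        have "fst (br q f) y \<le> f y" "f y \<le> snd (br q f) y" using br(2)[OF f, of q] by (auto simp: bracket_def)
        then show "width q f y \<le> ?d y" using width_gap[of q f y]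
          by (cases "y \<in> S") (simp_all add: gap_def)
      qed
      have "(\<integral>y. (width q f y)\<^sup>2 \<partial>P) \<le> (\<integral>y. (?d y)\<^sup>2 \<partial>P)"
      proof (rule integral_mono[OF _ d(1) le])
        show "integrable P (\<lambda>y. (width q f y)\<^sup>2)"
          by (rule Bochner_Integration.integrable_bound[OF d(1)]) (use le mP[OF width_b[OF f]] in auto)
      qed
      also have "\<dots> = (sqrt (\<integral>y. (?d y)\<^sup>2 \<partial>P))\<^sup>2" by (simp add: integral_nonneg_AE)
      also have "\<dots> \<le> ((1/2)^q)\<^sup>2" using d(2) by (intro power_mono) (auto simp: integral_nonneg_AE)
      also have "((1/2::real)^q)\<^sup>2 = (1/4)^q" by (simp add: power2_eq_square flip: power_mult_distrib)
      finally show ?thesis .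
    qed
    show "summable (\<lambda>q. (1/2)^q * sqrt (ln (2 * N q)))"
      unfolding N_def by (rule product_entropy_summable[OF dyadic_entropy_summable[OF J k k1] k1])
    show "width q f y \<le> 2 * env y" for q f y by (simp add: width_def)
  qed (use P F env_b env_S env_upper env_L2 proj(1) width_b near in auto)
  then show ?thesis using that unfolding env_def[abs_def] by blast
qed

section \<open>A central limit theorem for rows\<close>

lemma (in prob_space) second_moment_independent_sum:
  fixes X :: "'i \<Rightarrow> 'a \<Rightarrow> real"
  assumes I: "finite I" and ind: "indep_vars (\<lambda>_. borel) X I"
    and X1: "\<And>i. i \<in> I \<Longrightarrow> integrable M (X i)" and X0: "\<And>i. i \<in> I \<Longrightarrow> expectation (X i) = 0"
    and X2: "\<And>i. i \<in> I \<Longrightarrow> integrable M (\<lambda>\<omega>. (X i \<omega>)\<^sup>2)"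
  shows "integrable M (\<lambda>\<omega>. (\<Sum>i\<in>I. X i \<omega>)\<^sup>2)"
    "expectation (\<lambda>\<omega>. (\<Sum>i\<in>I. X i \<omega>)\<^sup>2) = (\<Sum>i\<in>I. expectation (\<lambda>\<omega>. (X i \<omega>)\<^sup>2))"
proof -
  have pair: "integrable M (\<lambda>\<omega>. X i \<omega> * X j \<omega>) \<and>
      expectation (\<lambda>\<omega>. X i \<omega> * X j \<omega>) = (if i = j then expectation (\<lambda>\<omega>. (X i \<omega>)\<^sup>2) else 0)"
    if "i \<in> I" "j \<in> I" for i j
  proof (cases "i = j")
    case True
    have "(\<lambda>\<omega>. X i \<omega> * X j \<omega>) = (\<lambda>\<omega>. (X i \<omega>)\<^sup>2)" using True by (simp add: power2_eq_square)
    then show ?thesis using X2[OF that(1)] True by (simp only: if_True simp_thms)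
  next
    case False
    have ij: "indep_vars (\<lambda>_. borel) X {i, j}" using that by (intro indep_vars_subset[OF ind]) auto
    have p: "(\<Prod>k\<in>{i, j}. X k \<omega>) = X i \<omega> * X j \<omega>" for \<omega> using False by simp
    have "integrable M (\<lambda>\<omega>. \<Prod>k\<in>{i, j}. X k \<omega>)"
      by (rule indep_vars_integrable[OF _ ij]) (use X1 that in auto)
    moreover have "expectation (\<lambda>\<omega>. \<Prod>k\<in>{i, j}. X k \<omega>) = (\<Prod>k\<in>{i, j}. expectation (X k))"
      by (rule indep_vars_lebesgue_integral[OF _ ij]) (use X1 that in auto)
    ultimately show ?thesis unfolding p using False X0 that by simp
  qed
  have sq: "(\<Sum>i\<in>I. X i \<omega>)\<^sup>2 = (\<Sum>i\<in>I. \<Sum>j\<in>I. X i \<omega> * X j \<omega>)" for \<omega>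
    by (simp add: power2_eq_square sum_product)
  show "integrable M (\<lambda>\<omega>. (\<Sum>i\<in>I. X i \<omega>)\<^sup>2)"
    unfolding sq using pair by (intro Bochner_Integration.integrable_sum) auto
  have "expectation (\<lambda>\<omega>. (\<Sum>i\<in>I. X i \<omega>)\<^sup>2) = (\<Sum>i\<in>I. \<Sum>j\<in>I. expectation (\<lambda>\<omega>. X i \<omega> * X j \<omega>))"
    unfolding sq using pair
    by (subst Bochner_Integration.integral_sum) (auto intro!: sum.cong Bochner_Integration.integral_sum Bochner_Integration.integrable_sum)
  also have "\<dots> = (\<Sum>i\<in>I. \<Sum>j\<in>I. if i = j then expectation (\<lambda>\<omega>. (X i \<omega>)\<^sup>2) else 0)"
    using pair by (intro sum.cong) auto
  also have "\<dots> = (\<Sum>i\<in>I. expectation (\<lambda>\<omega>. (X i \<omega>)\<^sup>2))" using I by simp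
  finally show "expectation (\<lambda>\<omega>. (\<Sum>i\<in>I. X i \<omega>)\<^sup>2) = (\<Sum>i\<in>I. expectation (\<lambda>\<omega>. (X i \<omega>)\<^sup>2))" .
qed

context independent_row
begin

lemma T_second_moment:
  assumes g: "test g" "test (\<lambda>y. (g y)\<^sup>2)"
  shows "integrable M (\<lambda>\<omega>. (T g \<omega>)\<^sup>2)" "expectation (\<lambda>\<omega>. (T g \<omega>)\<^sup>2) \<le> C * (\<integral>y. (g y)\<^sup>2 \<partial>P)"
proof -
  let ?m = "\<lambda>i. expectation (\<lambda>\<omega>. g (Y i \<omega>))"
  let ?X = "\<lambda>i \<omega>. g (Y i \<omega>) - ?m i"
  note i1 = test_integrable[OF g(1)] and i2 = test_integrable[OF g(2)]
  have ind: "indep_vars (\<lambda>_. borel) ?X {1..n}"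
    by (rule indep_vars_compose2[OF indep, where Y="\<lambda>i y. g y - ?m i"]) (use g in \<open>auto simp: test_def\<close>)
  have X2: "integrable M (\<lambda>\<omega>. (?X i \<omega>)\<^sup>2)" if "i \<in> {1..n}" for i
  proof -
    have "(?X i \<omega>)\<^sup>2 = (g (Y i \<omega>))\<^sup>2 - 2 * ?m i * g (Y i \<omega>) + (?m i)\<^sup>2" for \<omega>
      by (simp add: power2_eq_square algebra_simps)
    then show ?thesis using i1[OF that] i2[OF that] by simp
  qed
  have X1: "integrable M (?X i)" "expectation (?X i) = 0" if "i \<in> {1..n}" for i
    using i1[OF that] by (auto simp: prob_space)
  have T2: "(T g \<omega>)\<^sup>2 = 1 / r * (\<Sum>i=1..n. ?X i \<omega>)\<^sup>2" for \<omega>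
    unfolding T_def using r_pos by (simp add: power_mult_distrib power_divide)
  note sm = second_moment_independent_sum[OF finite_atLeastAtMost ind X1 X2]
  show "integrable M (\<lambda>\<omega>. (T g \<omega>)\<^sup>2)" unfolding T2 using sm(1) by (intro integrable_mult_right) auto
  have "expectation (\<lambda>\<omega>. (T g \<omega>)\<^sup>2) = 1 / r * (\<Sum>i=1..n. expectation (\<lambda>\<omega>. (?X i \<omega>)\<^sup>2))"
    unfolding T2 using sm(2) by simp
  also have "\<dots> \<le> 1 / r * (\<Sum>i=1..n. expectation (\<lambda>\<omega>. (g (Y i \<omega>))\<^sup>2))"
  proof (intro mult_left_mono sum_mono)
    fix i assume i: "i \<in> {1..n}"
    show "expectation (\<lambda>\<omega>. (?X i \<omega>)\<^sup>2) \<le> expectation (\<lambda>\<omega>. (g (Y i \<omega>))\<^sup>2)"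
      using variance_eq[OF i1[OF i] i2[OF i]] by simp
  qed (use r_pos in auto)
  also have "\<dots> \<le> 1 / r * (C * r * (\<integral>y. (g y)\<^sup>2 \<partial>P))"
    using sum_expectation_le[OF g(2)] r_pos by (intro mult_left_mono) auto
  finally show "expectation (\<lambda>\<omega>. (T g \<omega>)\<^sup>2) \<le> C * (\<integral>y. (g y)\<^sup>2 \<partial>P)" using r_pos by simp
qed

text \<open>The error of the Gaussian approximation of the characteristic function in one row.  Since the
  observations miss \<open>S\<close> with probability close to 1, the remainder is estimated separately off \<open>S\<close>,
  where the centred summand equals minus its mean.\<close>

lemma char_T_approximation:
  fixes m s2 :: real
  assumes g: "test g" "test (\<lambda>y. (g y)\<^sup>2)" and S: "S \<in> sets borel" and P: "prob_space P"
    and ident: "\<And>i. i \<in> {1..n} \<Longrightarrow> distr M borel (Y i) = distr M borel (Y 1)"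
    and n: "n \<ge> 1" and m: "m = expectation (\<lambda>\<omega>. g (Y 1 \<omega>))" "\<bar>m\<bar> \<le> 1"
    and s2: "s2 = expectation (\<lambda>\<omega>. (g (Y 1 \<omega>))\<^sup>2) - m\<^sup>2" and small: "s2 / (2 * r) \<le> 1"
    and G: "G = (\<lambda>y. (\<bar>g y\<bar> + 1) * indicator S y)"
  shows "norm ((\<integral>\<omega>. iexp (T g \<omega>) \<partial>M) - exp (- (n * s2 / (2 * r))))
    \<le> C / 6 * (\<integral>y. min (6 * (G y)\<^sup>2) ((G y)^3 / sqrt r) \<partial>P) + n / r * m\<^sup>2 + n * (s2 / (2 * r))\<^sup>2"
proof -
  interpret P: prob_space P by fact
  have 1: "1 \<in> {1..n}" using n by auto
  note i1 = test_integrable[OF g(1)] and i2 = test_integrable[OF g(2)]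
  have gb: "g \<in> borel_measurable borel" using g by (simp add: test_def)
  define X where "X \<omega> = g (Y 1 \<omega>) - m" for \<omega>
  define t where "t = 1 / sqrt r"
  have t: "t > 0" "t\<^sup>2 = 1 / r" using r_pos by (auto simp: t_def power_divide)
  have Y1 [measurable]: "Y 1 \<in> measurable M borel" by (rule Y_measurable[OF 1])
  have Xm [measurable]: "X \<in> borel_measurable M" unfolding X_def using measurable_compose[OF Y1 gb] by simp
  have X1: "integrable M X" "expectation X = 0"
    unfolding X_def using i1[OF 1] by (auto simp: prob_space m)
  have X2: "integrable M (\<lambda>\<omega>. (X \<omega>)\<^sup>2)"
  proof -
    have "(X \<omega>)\<^sup>2 = (g (Y 1 \<omega>))\<^sup>2 - 2 * m * g (Y 1 \<omega>) + m\<^sup>2" for \<omega>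
      by (simp add: X_def power2_eq_square algebra_simps)
    then show ?thesis using i1[OF 1] i2[OF 1] by simp
  qed
  have var: "variance X = s2"
  proof -
    have "variance X = expectation (\<lambda>\<omega>. (g (Y 1 \<omega>) - expectation (\<lambda>\<omega>. g (Y 1 \<omega>)))\<^sup>2)"
      unfolding X1(2) by (simp add: X_def m)
    also have "\<dots> = s2" using variance_eq[OF i1[OF 1] i2[OF 1]] by (simp add: s2 m)
    finally show ?thesis .
  qed
  have s20: "s2 \<ge> 0" unfolding var[symmetric] by simp
  define \<phi> where "\<phi> = char (distr M borel X) t"
  have \<phi>: "(\<integral>\<omega>. iexp (T g \<omega>) \<partial>M) = \<phi> ^ n"
  proof -
    let ?k = "\<lambda>y. t * (g y - m)"
    have kb: "?k \<in> borel_measurable borel" using gb by simp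
    have mi: "expectation (\<lambda>\<omega>. g (Y i \<omega>)) = m" if i: "i \<in> {1..n}" for i
      using integral_distr[OF Y_measurable[OF i] gb] integral_distr[OF Y1 gb] ident[OF i] m by simp
    have T: "T g = (\<lambda>\<omega>. \<Sum>i=1..n. ?k (Y i \<omega>))"
      unfolding T_def t_def using mi by (auto simp: sum_distrib_left sum_divide_distrib intro!: sum.cong)
    have ind: "indep_vars (\<lambda>_. borel) (\<lambda>i \<omega>. ?k (Y i \<omega>)) {1..n}"
      by (rule indep_vars_compose2[OF indep, where Y="\<lambda>i. ?k"]) (use kb in auto)
    have ck: "char (distr M borel (\<lambda>\<omega>. ?k (Y i \<omega>))) 1 = \<phi>" if i: "i \<in> {1..n}" for i
    proof -
      have e: "(\<lambda>y. iexp (?k y)) \<in> borel_measurable borel" using gb by measurable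
      have km: "(\<lambda>\<omega>. ?k (Y i \<omega>)) \<in> borel_measurable M" using measurable_compose[OF Y_measurable[OF i] kb] .
      have "char (distr M borel (\<lambda>\<omega>. ?k (Y i \<omega>))) 1 = (\<integral>\<omega>. iexp (?k (Y i \<omega>)) \<partial>M)"
        unfolding char_def by (subst integral_distr[OF km]) simp_all
      also have "\<dots> = (\<integral>y. iexp (?k y) \<partial>distr M borel (Y i))" by (rule integral_distr[OF Y_measurable[OF i] e, symmetric])
      also have "\<dots> = (\<integral>\<omega>. iexp (?k (Y 1 \<omega>)) \<partial>M)" unfolding ident[OF i] by (rule integral_distr[OF Y1 e])
      also have "\<dots> = \<phi>" unfolding \<phi>_def char_def by (subst integral_distr[OF Xm]) (simp_all add: X_def)
      finally show ?thesis .
    qed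
    have Tm: "T g \<in> borel_measurable M" by (rule T_measurable[OF g(1)])
    have "(\<integral>\<omega>. iexp (T g \<omega>) \<partial>M) = char (distr M borel (T g)) 1"
      unfolding char_def by (subst integral_distr[OF Tm]) simp_all
    also have "\<dots> = (\<Prod>i\<in>{1..n}. char (distr M borel (\<lambda>\<omega>. ?k (Y i \<omega>))) 1)"
      unfolding T by (rule char_distr_sum[OF ind])
    also have "\<dots> = \<phi> ^ n" using ck by simp
    finally show ?thesis .
  qed
  define D where "D = (\<integral>y. min (6 * (G y)\<^sup>2) ((G y)^3 / sqrt r) \<partial>P)"
  define x where "x = s2 / (2 * r)"
  have x: "0 \<le> x" "x \<le> 1" using s20 r_pos small by (auto simp: x_def)
  have G0: "G y \<ge> 0" for y by (simp add: G)
  have Gt: "test (\<lambda>y. min (6 * (G y)\<^sup>2) ((G y)^3 / sqrt r))"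
  proof -
    have Gb: "G \<in> borel_measurable borel" unfolding G using gb S by measurable
    have i6: "integrable P (\<lambda>y. 6 * (G y)\<^sup>2)"
    proof (rule Bochner_Integration.integrable_bound)
      show "integrable P (\<lambda>y. 12 * (g y)\<^sup>2 + 12)" using g by (auto simp: test_def)
      show "(\<lambda>y. 6 * (G y)\<^sup>2) \<in> borel_measurable P" using Gb sets_P measurable_cong_sets by (auto cong: measurable_cong_sets)
      have "6 * (G y)\<^sup>2 \<le> 12 * (g y)\<^sup>2 + 12" for y
      proof -
        have "0 \<le> (\<bar>g y\<bar> - 1)\<^sup>2" by simp
        then have "(\<bar>g y\<bar> + 1)\<^sup>2 \<le> 2 * (g y)\<^sup>2 + 2" by (simp add: power2_eq_square algebra_simps)
        then show ?thesis unfolding G by (cases "y \<in> S") auto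
      qed
      then show "AE y in P. norm (6 * (G y)\<^sup>2) \<le> norm (12 * (g y)\<^sup>2 + 12)" by auto
    qed
    have mb: "(\<lambda>y. min (6 * (G y)\<^sup>2) ((G y)^3 / sqrt r)) \<in> borel_measurable borel" using Gb by measurable
    have "integrable P (\<lambda>y. min (6 * (G y)\<^sup>2) ((G y)^3 / sqrt r))"
    proof (rule Bochner_Integration.integrable_bound[OF i6])
      show "(\<lambda>y. min (6 * (G y)\<^sup>2) ((G y)^3 / sqrt r)) \<in> borel_measurable P" using mb sets_P measurable_cong_sets by blast
      show "AE y in P. norm (min (6 * (G y)\<^sup>2) ((G y)^3 / sqrt r)) \<le> norm (6 * (G y)\<^sup>2)"
        using G0 r_pos by (auto simp: min_def)
    qed
    then show ?thesis using mb by (auto simp: test_def G)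
  qed
  have EX: "expectation (\<lambda>\<omega>. min (6 * (X \<omega>)\<^sup>2) (\<bar>t\<bar> * \<bar>X \<omega>\<bar>^3)) \<le> C * r * D / n + 6 * m\<^sup>2"
  proof -
    have pt: "min (6 * (X \<omega>)\<^sup>2) (\<bar>t\<bar> * \<bar>X \<omega>\<bar>^3) \<le> min (6 * (G (Y 1 \<omega>))\<^sup>2) ((G (Y 1 \<omega>))^3 / sqrt r) + 6 * m\<^sup>2" for \<omega>
    proof (cases "Y 1 \<omega> \<in> S")
      case True
      then have XG: "\<bar>X \<omega>\<bar> \<le> G (Y 1 \<omega>)" using m(2) by (simp add: X_def G)
      have "(X \<omega>)\<^sup>2 \<le> (G (Y 1 \<omega>))\<^sup>2" using power_mono[OF XG, of 2] by simp
      moreover have "\<bar>t\<bar> * \<bar>X \<omega>\<bar>^3 \<le> (G (Y 1 \<omega>))^3 / sqrt r"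
        using power_mono[OF XG, of 3] t(1) mult_left_mono[of "\<bar>X \<omega>\<bar>^3" "(G (Y 1 \<omega>))^3" t] by (simp add: t_def)
      ultimately have "min (6 * (X \<omega>)\<^sup>2) (\<bar>t\<bar> * \<bar>X \<omega>\<bar>^3) \<le> min (6 * (G (Y 1 \<omega>))\<^sup>2) ((G (Y 1 \<omega>))^3 / sqrt r)"
        by (intro min.mono) auto
      moreover have "0 \<le> 6 * m\<^sup>2" by simp
      ultimately show ?thesis by linarith
    next
      case False
      then have "g (Y 1 \<omega>) = 0" using g by (simp add: test_def)
      then have "6 * (X \<omega>)\<^sup>2 = 6 * m\<^sup>2" by (simp add: X_def)
      moreover have "min (6 * (G (Y 1 \<omega>))\<^sup>2) ((G (Y 1 \<omega>))^3 / sqrt r) = 0" using False by (simp add: G)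
      ultimately show ?thesis by linarith
    qed
    have iG: "integrable M (\<lambda>\<omega>. min (6 * (G (Y 1 \<omega>))\<^sup>2) ((G (Y 1 \<omega>))^3 / sqrt r))" by (rule test_integrable[OF Gt 1])
    have iX: "integrable M (\<lambda>\<omega>. min (6 * (X \<omega>)\<^sup>2) (\<bar>t\<bar> * \<bar>X \<omega>\<bar>^3))"
      by (rule Bochner_Integration.integrable_bound[of _ "\<lambda>\<omega>. 6 * (X \<omega>)\<^sup>2"]) (use X2 in auto)
    have "expectation (\<lambda>\<omega>. min (6 * (X \<omega>)\<^sup>2) (\<bar>t\<bar> * \<bar>X \<omega>\<bar>^3))
        \<le> expectation (\<lambda>\<omega>. min (6 * (G (Y 1 \<omega>))\<^sup>2) ((G (Y 1 \<omega>))^3 / sqrt r) + 6 * m\<^sup>2)"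
      using iG by (intro integral_mono[OF iX _ pt]) auto
    also have "\<dots> = expectation (\<lambda>\<omega>. min (6 * (G (Y 1 \<omega>))\<^sup>2) ((G (Y 1 \<omega>))^3 / sqrt r)) + 6 * m\<^sup>2"
      using iG by (simp add: prob_space)
    also have "expectation (\<lambda>\<omega>. min (6 * (G (Y 1 \<omega>))\<^sup>2) ((G (Y 1 \<omega>))^3 / sqrt r)) \<le> C * r * D / n"
    proof -
      have nn: "0 \<le> min (6 * (G y)\<^sup>2) ((G y)^3 / sqrt r)" for y using G0[of y] r_pos by simp
      have "n * expectation (\<lambda>\<omega>. min (6 * (G (Y 1 \<omega>))\<^sup>2) ((G (Y 1 \<omega>))^3 / sqrt r)) \<le> C * r * D"
        unfolding D_def using Gt nn 1 by (intro dominated[THEN conjunct2]) (auto simp: test_def)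
      then show ?thesis using n by (simp add: field_simps)
    qed
    finally show ?thesis by simp
  qed
  have "norm (\<phi> - (1 - t\<^sup>2 * s2 / 2)) \<le> (t\<^sup>2 / 6) * expectation (\<lambda>\<omega>. min (6 * (X \<omega>)\<^sup>2) (\<bar>t\<bar> * \<bar>X \<omega>\<bar>^3))"
    unfolding \<phi>_def using char_approx3'[OF Xm X1(1) X2 X1(2) var refl, of t] .
  also have "\<dots> \<le> (t\<^sup>2 / 6) * (C * r * D / n + 6 * m\<^sup>2)" by (rule mult_left_mono[OF EX]) simp
  also have "\<dots> = C / 6 * D / n + m\<^sup>2 / r" using r_pos n by (simp add: t(2) field_simps)
  finally have "norm (\<phi> - (1 - t\<^sup>2 * s2 / 2)) \<le> C / 6 * D / n + m\<^sup>2 / r" .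
  moreover have "t\<^sup>2 * s2 / 2 = x" by (simp add: t(2) x_def)
  ultimately have a1: "norm (\<phi> - of_real (1 - x)) \<le> C / 6 * D / n + m\<^sup>2 / r"
    by (simp only: of_real_diff of_real_1)
  have "\<bar>(1 - x) - exp (- x)\<bar> \<le> x\<^sup>2"
    using exp_ge_add_one_self[of "- x"] exp_le_quadratic[of "- x"] x by simp
  then have a2: "norm (complex_of_real (1 - x) - of_real (exp (- x))) \<le> x\<^sup>2"
    unfolding of_real_diff[symmetric] norm_of_real .
  have "norm (\<phi> ^ n - (of_real (exp (- x))) ^ n) \<le> n * norm (\<phi> - of_real (exp (- x)))"
  proof (rule norm_power_diff)
    interpret rd: real_distribution "distr M borel X" by (rule real_distribution_distr) simp
    show "norm \<phi> \<le> 1" unfolding \<phi>_def by (rule rd.cmod_char_le_1)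
    show "norm (complex_of_real (exp (- x))) \<le> 1" unfolding norm_of_real using x(1) by simp
  qed
  also have "\<dots> \<le> n * ((C / 6 * D / n + m\<^sup>2 / r) + x\<^sup>2)"
    using norm_triangle_mono[OF a1 a2] by (intro mult_left_mono) auto
  also have "\<dots> = C / 6 * D + n / r * m\<^sup>2 + n * x\<^sup>2" using n by (simp add: field_simps)
  finally have "norm (\<phi> ^ n - of_real (exp (- x) ^ n)) \<le> C / 6 * D + n / r * m\<^sup>2 + n * x\<^sup>2" by simp
  moreover have "exp (- x) ^ n = exp (- (n * s2 / (2 * r)))"
    unfolding x_def exp_of_nat_mult[symmetric] by simp
  ultimately show ?thesis unfolding \<phi> D_def x_def by simp
qed

lemma mean_bound:
  assumes g: "test g" and i: "i \<in> {1..n}"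
  shows "\<bar>expectation (\<lambda>\<omega>. g (Y i \<omega>))\<bar> \<le> C * (\<integral>y. \<bar>g y\<bar> \<partial>P) * (r / n)"
proof -
  have abs: "\<bar>expectation (\<lambda>\<omega>. g (Y i \<omega>))\<bar> \<le> expectation (\<lambda>\<omega>. \<bar>g (Y i \<omega>)\<bar>)" by (rule integral_abs_bound)
  have "n * expectation (\<lambda>\<omega>. \<bar>g (Y i \<omega>)\<bar>) \<le> C * r * (\<integral>y. \<bar>g y\<bar> \<partial>P)"
    using test_abs[OF g] i by (intro dominated[THEN conjunct2]) (auto simp: test_def)
  moreover have "n > 0" using i by auto
  ultimately have "expectation (\<lambda>\<omega>. \<bar>g (Y i \<omega>)\<bar>) \<le> C * r * (\<integral>y. \<bar>g y\<bar> \<partial>P) / n"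
    by (simp add: pos_le_divide_eq mult.commute)
  from order_trans[OF abs this] show ?thesis by (simp add: mult_ac)
qed

end

text \<open>The characteristic function of the row sum is an \<open>n\<close>-th power, which \<open>char_T_approximation\<close> compares
  with a Gaussian one.  In the error bound, the integral of the minimum tends to 0 by dominated
  convergence, which is Lindeberg's condition, and the squared means are of the order \<open>(r n / n)\<^sup>2\<close>.\<close>

lemma row_clt:
  fixes Y :: "nat \<Rightarrow> nat \<Rightarrow> 'w \<Rightarrow> 'a::topological_space" and r :: "nat \<Rightarrow> real" and g :: "'a \<Rightarrow> real"
  assumes rows: "\<And>n. n \<ge> n0 \<Longrightarrow> independent_row M (Y n) n (r n) C S P"
    and P: "prob_space P" "sets P = sets borel" and S: "S \<in> sets borel"
    and ident: "\<And>n i. n \<ge> n0 \<Longrightarrow> i \<in> {1..n} \<Longrightarrow> distr M borel (Y n i) = distr M borel (Y n 1)"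
    and r: "filterlim r at_top sequentially" and ratio: "(\<lambda>n. r n / n) \<longlonglongrightarrow> 0"
    and g: "g \<in> borel_measurable borel" "\<And>y. y \<notin> S \<Longrightarrow> g y = 0" "integrable P (\<lambda>y. (g y)\<^sup>2)"
    and v: "(\<lambda>n. n / r n * (\<integral>\<omega>. (g (Y n 1 \<omega>))\<^sup>2 \<partial>M)) \<longlonglongrightarrow> v"
  shows "(\<lambda>n. \<integral>\<omega>. iexp (independent_row.T M (Y n) n (r n) g \<omega>) \<partial>M) \<longlonglongrightarrow> complex_of_real (exp (- v / 2))"
proof -
  interpret P: prob_space P by fact
  have gP: "g \<in> borel_measurable P" using g(1) P(2) measurable_cong_sets by blast
  have g1: "integrable P g" by (rule P.square_integrable_imp_integrable[OF gP g(3)])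
  define m where "m n = (\<integral>\<omega>. g (Y n 1 \<omega>) \<partial>M)" for n
  define s2 where "s2 n = (\<integral>\<omega>. (g (Y n 1 \<omega>))\<^sup>2 \<partial>M) - (m n)\<^sup>2" for n
  define G where "G y = (\<bar>g y\<bar> + 1) * indicator S y" for y
  define D where "D n = (\<integral>y. min (6 * (G y)\<^sup>2) ((G y)^3 / sqrt (r n)) \<partial>P)" for n
  define B where "B = C * (\<integral>y. \<bar>g y\<bar> \<partial>P)"
  have rpos: "\<forall>\<^sub>F n in sequentially. r n > 0" using r by (simp add: filterlim_at_top_dense)
  have big: "\<forall>\<^sub>F n in sequentially. n \<ge> max n0 1" by (rule eventually_ge_at_top)
  have mb: "\<forall>\<^sub>F n in sequentially. \<bar>m n\<bar> \<le> B * (r n / n)"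
    using big
  proof eventually_elim
    case (elim n)
    interpret R: independent_row M "Y n" n "r n" C S P using rows elim by simp
    have "R.test g" using g g1 by (simp add: R.test_def)
    from R.mean_bound[OF this, of 1] elim show ?case by (simp add: m_def B_def)
  qed
  have m0: "m \<longlonglongrightarrow> 0"
  proof (rule Lim_null_comparison)
    show "\<forall>\<^sub>F n in sequentially. norm (m n) \<le> B * (r n / n)" using mb by (simp only: real_norm_def)
    show "(\<lambda>n. B * (r n / n)) \<longlonglongrightarrow> 0" using tendsto_mult_left[OF ratio, of B] by (simp only: mult_zero_right)
  qed
  have nm0: "(\<lambda>n. n / r n * (m n)\<^sup>2) \<longlonglongrightarrow> 0"
  proof (rule Lim_null_comparison[of _ "\<lambda>n. B\<^sup>2 * (r n / n)"])
    show "\<forall>\<^sub>F n in sequentially. norm (n / r n * (m n)\<^sup>2) \<le> B\<^sup>2 * (r n / n)"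
      using mb rpos big
    proof eventually_elim
      case (elim n)
      have "(m n)\<^sup>2 \<le> (B * (r n / n))\<^sup>2" using power_mono[OF elim(1), of 2] by simp
      then have "n / r n * (m n)\<^sup>2 \<le> n / r n * (B * (r n / n))\<^sup>2" using elim by (intro mult_left_mono) auto
      also have "\<dots> = B\<^sup>2 * (r n / n)" using elim by (simp add: power2_eq_square field_simps)
      finally show ?case using elim by simp
    qed
    show "(\<lambda>n. B\<^sup>2 * (r n / n)) \<longlonglongrightarrow> 0" using tendsto_mult_left[OF ratio, of "B\<^sup>2"] by simp
  qed
  have ns: "(\<lambda>n. n * s2 n / (2 * r n)) \<longlonglongrightarrow> v / 2"
  proof -
    have "(\<lambda>n. (n / r n * (\<integral>\<omega>. (g (Y n 1 \<omega>))\<^sup>2 \<partial>M) - n / r n * (m n)\<^sup>2) / 2) \<longlonglongrightarrow> (v - 0) / 2"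
      by (intro tendsto_intros v nm0) simp
    moreover have "(n / r n * (\<integral>\<omega>. (g (Y n 1 \<omega>))\<^sup>2 \<partial>M) - n / r n * (m n)\<^sup>2) / 2 = n * s2 n / (2 * r n)" for n
      by (simp add: s2_def right_diff_distrib diff_divide_distrib)
    ultimately show ?thesis by (simp only: diff_zero)
  qed
  have inv_n: "(\<lambda>n. 1 / real n) \<longlonglongrightarrow> 0" by (rule lim_1_over_n)
  have x0: "(\<lambda>n. n * (s2 n / (2 * r n))\<^sup>2) \<longlonglongrightarrow> 0"
  proof -
    have "(\<lambda>n. (n * s2 n / (2 * r n))\<^sup>2 * (1 / real n)) \<longlonglongrightarrow> (v / 2)\<^sup>2 * 0"
      by (intro tendsto_intros ns inv_n)
    moreover have "\<forall>\<^sub>F n in sequentially. (n * s2 n / (2 * r n))\<^sup>2 * (1 / real n) = n * (s2 n / (2 * r n))\<^sup>2"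
      using big by eventually_elim (simp add: power2_eq_square)
    ultimately show ?thesis by (simp add: Lim_transform_eventually)
  qed
  have xs: "(\<lambda>n. s2 n / (2 * r n)) \<longlonglongrightarrow> 0"
  proof -
    have "(\<lambda>n. (n * s2 n / (2 * r n)) * (1 / real n)) \<longlonglongrightarrow> (v / 2) * 0"
      by (intro tendsto_intros ns inv_n)
    moreover have "\<forall>\<^sub>F n in sequentially. (n * s2 n / (2 * r n)) * (1 / real n) = s2 n / (2 * r n)"
      using big by eventually_elim simp
    ultimately show ?thesis by (simp add: Lim_transform_eventually)
  qed
  have Gb: "G \<in> borel_measurable borel" unfolding G_def[abs_def] using g(1) S by measurable
  have GP: "G \<in> borel_measurable P" using Gb P(2) measurable_cong_sets by blast
  have G0: "G y \<ge> 0" for y by (simp add: G_def)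
  have iG: "integrable P (\<lambda>y. 6 * (G y)\<^sup>2)"
  proof (rule Bochner_Integration.integrable_bound)
    show "integrable P (\<lambda>y. 12 * (g y)\<^sup>2 + 12)" using g by auto
    show "(\<lambda>y. 6 * (G y)\<^sup>2) \<in> borel_measurable P" using GP by measurable
    have "6 * (G y)\<^sup>2 \<le> 12 * (g y)\<^sup>2 + 12" for y
    proof -
      have "0 \<le> (\<bar>g y\<bar> - 1)\<^sup>2" by simp
      then have "(\<bar>g y\<bar> + 1)\<^sup>2 \<le> 2 * (g y)\<^sup>2 + 2" by (simp add: power2_eq_square algebra_simps)
      then show ?thesis unfolding G_def by (cases "y \<in> S") auto
    qed
    then show "AE y in P. norm (6 * (G y)\<^sup>2) \<le> norm (12 * (g y)\<^sup>2 + 12)" by auto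
  qed
  have D0: "D \<longlonglongrightarrow> 0"
  proof -
    have "(\<lambda>n. \<integral>y. min (6 * (G y)\<^sup>2) ((G y)^3 / sqrt \<bar>r n\<bar>) \<partial>P) \<longlonglongrightarrow> (\<integral>y. 0 \<partial>P)"
    proof (rule integral_dominated_convergence[OF _ _ iG])
      show "AE y in P. (\<lambda>n. min (6 * (G y)\<^sup>2) ((G y)^3 / sqrt \<bar>r n\<bar>)) \<longlonglongrightarrow> 0"
      proof (intro AE_I2)
        fix y
        have "filterlim (\<lambda>n. sqrt (r n)) at_top sequentially" using filterlim_compose[OF sqrt_at_top r] .
        then have "(\<lambda>n. (G y)^3 / sqrt (r n)) \<longlonglongrightarrow> 0"
          by (intro tendsto_divide_0[OF tendsto_const] filterlim_at_top_imp_at_infinity)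
        moreover have "\<forall>\<^sub>F n in sequentially. (G y)^3 / sqrt (r n) = (G y)^3 / sqrt \<bar>r n\<bar>"
          using rpos by eventually_elim simp
        ultimately have "(\<lambda>n. (G y)^3 / sqrt \<bar>r n\<bar>) \<longlonglongrightarrow> 0" by (rule Lim_transform_eventually)
        then have "(\<lambda>n. min (6 * (G y)\<^sup>2) ((G y)^3 / sqrt \<bar>r n\<bar>)) \<longlonglongrightarrow> min (6 * (G y)\<^sup>2) 0"
          by (intro tendsto_intros)
        then show "(\<lambda>n. min (6 * (G y)\<^sup>2) ((G y)^3 / sqrt \<bar>r n\<bar>)) \<longlonglongrightarrow> 0" by (simp add: min_absorb2)
      qed
      show "AE y in P. norm (min (6 * (G y)\<^sup>2) ((G y)^3 / sqrt \<bar>r n\<bar>)) \<le> 6 * (G y)\<^sup>2" for n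
        using G0 by (auto simp: min_def)
    qed (use GP in measurable)
    moreover have "\<forall>\<^sub>F n in sequentially. (\<integral>y. min (6 * (G y)\<^sup>2) ((G y)^3 / sqrt \<bar>r n\<bar>) \<partial>P) = D n"
      using rpos by eventually_elim (simp add: D_def)
    ultimately show ?thesis by (simp add: Lim_transform_eventually)
  qed
  have approx: "\<forall>\<^sub>F n in sequentially. norm ((\<integral>\<omega>. iexp (independent_row.T M (Y n) n (r n) g \<omega>) \<partial>M) - exp (- (n * s2 n / (2 * r n))))
      \<le> C / 6 * D n + n / r n * (m n)\<^sup>2 + n * (s2 n / (2 * r n))\<^sup>2"
  proof -
    have "\<forall>\<^sub>F n in sequentially. \<bar>m n\<bar> < 1" using tendstoD[OF m0, of 1] by simp
    moreover have "\<forall>\<^sub>F n in sequentially. s2 n / (2 * r n) < 1" using order_tendstoD(2)[OF xs, of 1] by simp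
    ultimately show ?thesis using big
    proof eventually_elim
      case (elim n)
      interpret R: independent_row M "Y n" n "r n" C S P using rows elim by simp
      have t: "R.test g" "R.test (\<lambda>y. (g y)\<^sup>2)" using g g1 by (simp_all add: R.test_def)
      show ?case
        unfolding D_def
      proof (rule R.char_T_approximation[OF t S P(1)])
        show "distr M borel (Y n i) = distr M borel (Y n 1)" if "i \<in> {1..n}" for i
          by (rule ident[OF _ that]) (use elim in simp)
        show "G = (\<lambda>y. (\<bar>g y\<bar> + 1) * indicator S y)" by (simp add: fun_eq_iff G_def)
        show "m n = R.expectation (\<lambda>\<omega>. g (Y n 1 \<omega>))" by (rule m_def)
        show "s2 n = R.expectation (\<lambda>\<omega>. (g (Y n 1 \<omega>))\<^sup>2) - (m n)\<^sup>2" by (rule s2_def)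
      qed (use elim in auto)
    qed
  qed
  have "(\<lambda>n. C / 6 * D n + n / r n * (m n)\<^sup>2 + n * (s2 n / (2 * r n))\<^sup>2) \<longlonglongrightarrow> C / 6 * 0 + 0 + 0"
    by (intro tendsto_intros D0 nm0 x0)
  then have "(\<lambda>n. C / 6 * D n + n / r n * (m n)\<^sup>2 + n * (s2 n / (2 * r n))\<^sup>2) \<longlonglongrightarrow> 0"
    by (simp only: mult_zero_right add_0_right)
  from Lim_null_comparison[OF approx this] have "(\<lambda>n. (\<integral>\<omega>. iexp (independent_row.T M (Y n) n (r n) g \<omega>) \<partial>M) - exp (- (n * s2 n / (2 * r n)))) \<longlonglongrightarrow> 0" .
  from tendsto_add[OF this, of "\<lambda>n. complex_of_real (exp (- (n * s2 n / (2 * r n))))" "of_real (exp (- (v / 2)))"]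
  show ?thesis using tendsto_of_real[OF tendsto_exp[OF tendsto_minus[OF ns]], where 'a=complex] by simp
qed

section \<open>Local behaviour of a density\<close>

text \<open>On functions supported in a bounded set, the law of \<open>(X - z) / h\<close> is up to a factor close to 1
  the multiple \<open>p z h\<^sup>d\<close> of Lebesgue measure, because the density is nearly constant at scale \<open>h\<close>.\<close>

lemma nn_integral_rescaled_density:
  fixes X :: "'w \<Rightarrow> 'a::euclidean_space"
  assumes X: "X \<in> measurable M borel" and p: "has_density_on M X U p" and U: "open U" "z \<in> U"
    and cont: "isCont p z" and S: "bounded S" and e: "e > 0"
  obtains \<delta> where "\<delta> > 0" "\<And>h g. 0 < h \<Longrightarrow> h < \<delta> \<Longrightarrow> g \<in> borel_measurable borel \<Longrightarrow> (\<And>y. y \<notin> S \<Longrightarrow> g y = 0) \<Longrightarrow>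
     ennreal (p z - e) * (ennreal (h ^ DIM('a)) * (\<integral>\<^sup>+y. g y \<partial>lborel)) \<le> (\<integral>\<^sup>+\<omega>. g (inverse h *\<^sub>R (X \<omega> - z)) \<partial>M) \<and>
     (\<integral>\<^sup>+\<omega>. g (inverse h *\<^sub>R (X \<omega> - z)) \<partial>M) \<le> ennreal (p z + e) * (ennreal (h ^ DIM('a)) * (\<integral>\<^sup>+y. g y \<partial>lborel))"
proof -
  let ?\<mu> = "distr M borel X"
  have Ub: "U \<in> sets borel" using U(1) by simp
  define q where "q y = p y * indicator U y" for y
  have qb: "q \<in> borel_measurable borel"
  proof -
    have "p \<in> borel_measurable (restrict_space borel U)" using p by (simp add: has_density_on_def)
    then have "(\<lambda>y. indicator U y *\<^sub>R p y) \<in> borel_measurable borel"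
      using Ub by (subst (asm) borel_measurable_restrict_space_iff) auto
    then show ?thesis unfolding q_def[abs_def] by (simp add: mult.commute)
  qed
  have dens: "density ?\<mu> (indicator U) = density lborel (\<lambda>y. ennreal (q y))"
  proof (rule measure_eqI)
    fix B assume "B \<in> sets (density ?\<mu> (indicator U))"
    then have B: "B \<in> sets borel" by simp
    have "emeasure (density ?\<mu> (indicator U)) B = (\<integral>\<^sup>+y. indicator U y * indicator B y \<partial>?\<mu>)"
      using B Ub by (subst emeasure_density) auto
    also have "\<dots> = (\<integral>\<^sup>+y. indicator (B \<inter> U) y \<partial>?\<mu>)" by (intro nn_integral_cong) (simp split: split_indicator)
    also have "\<dots> = emeasure ?\<mu> (B \<inter> U)" using B Ub by (subst nn_integral_indicator) auto
    also have "\<dots> = (\<integral>\<^sup>+y\<in>B \<inter> U. ennreal (p y) \<partial>lborel)"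
    proof -
      have "B \<inter> U \<in> sets borel" "B \<inter> U \<subseteq> U" using B Ub by auto
      then show ?thesis using p unfolding has_density_on_def by blast
    qed
    also have "\<dots> = (\<integral>\<^sup>+y. ennreal (q y) * indicator B y \<partial>lborel)"
      by (intro nn_integral_cong) (simp add: q_def split: split_indicator)
    also have "\<dots> = emeasure (density lborel (\<lambda>y. ennreal (q y))) B"
      using B qb by (subst emeasure_density) auto
    finally show "emeasure (density ?\<mu> (indicator U)) B = emeasure (density lborel (\<lambda>y. ennreal (q y))) B" .
  qed simp
  have change: "(\<integral>\<^sup>+y. k y \<partial>?\<mu>) = (\<integral>\<^sup>+y. ennreal (q y) * k y \<partial>lborel)"
    if k: "k \<in> borel_measurable borel" "\<And>y. y \<notin> U \<Longrightarrow> k y = 0" for k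
  proof -
    have "(\<integral>\<^sup>+y. k y \<partial>?\<mu>) = (\<integral>\<^sup>+y. indicator U y * k y \<partial>?\<mu>)"
      using k(2) by (intro nn_integral_cong) (auto split: split_indicator)
    also have "\<dots> = (\<integral>\<^sup>+y. k y \<partial>density ?\<mu> (indicator U))"
      using k(1) Ub by (subst nn_integral_density) auto
    also have "\<dots> = (\<integral>\<^sup>+y. ennreal (q y) * k y \<partial>lborel)"
      unfolding dens using k(1) qb by (subst nn_integral_density) auto
    finally show ?thesis .
  qed
  obtain d where d: "d > 0" "\<And>y. dist y z < d \<Longrightarrow> y \<in> U \<and> dist (p y) (p z) < e"
  proof -
    obtain d1 where d1: "d1 > 0" "\<And>y. dist y z < d1 \<Longrightarrow> y \<in> U"
      using U unfolding open_dist by blast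
    obtain d2 where d2: "d2 > 0" "\<And>y. dist y z < d2 \<Longrightarrow> dist (p y) (p z) < e"
      using cont e unfolding continuous_at_eps_delta by blast
    show ?thesis by (rule that[of "min d1 d2"]) (use d1 d2 in auto)
  qed
  obtain b where b: "b > 0" "\<And>y. y \<in> S \<Longrightarrow> norm y \<le> b" using S bounded_pos by metis
  show ?thesis
  proof (rule that[of "d / b"])
    show "d / b > 0" using d b by simp
    fix h :: real and g :: "'a \<Rightarrow> ennreal"
    assume h: "0 < h" "h < d / b" and g: "g \<in> borel_measurable borel" "\<And>y. y \<notin> S \<Longrightarrow> g y = 0"
    define k where "k y = g (inverse h *\<^sub>R (y - z))" for y
    have kb: "k \<in> borel_measurable borel" unfolding k_def[abs_def] using g(1) by measurable
    have near: "y \<in> U \<and> \<bar>p y - p z\<bar> < e" if "k y \<noteq> 0" for y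
    proof -
      have "inverse h *\<^sub>R (y - z) \<in> S" using that g(2) unfolding k_def by blast
      then have "norm (inverse h *\<^sub>R (y - z)) \<le> b" using b(2) by blast
      moreover have "norm (inverse h *\<^sub>R (y - z)) = norm (y - z) / h" using h by (simp add: divide_inverse mult.commute)
      ultimately have "norm (y - z) / h \<le> b" by (simp only:)
      then have "norm (y - z) \<le> h * b" using h by (simp add: pos_divide_le_eq mult.commute)
      also have "\<dots> < d" using h b by (simp add: field_simps)
      finally show ?thesis using d(2)[of y] by (simp add: dist_norm dist_real_def)
    qed
    have M: "(\<integral>\<^sup>+\<omega>. g (inverse h *\<^sub>R (X \<omega> - z)) \<partial>M) = (\<integral>\<^sup>+y. ennreal (q y) * k y \<partial>lborel)"
    proof -
      have "(\<integral>\<^sup>+\<omega>. g (inverse h *\<^sub>R (X \<omega> - z)) \<partial>M) = (\<integral>\<^sup>+y. k y \<partial>?\<mu>)"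
        using X kb by (subst nn_integral_distr) (auto simp: k_def)
      also have "\<dots> = (\<integral>\<^sup>+y. ennreal (q y) * k y \<partial>lborel)"
        by (rule change[OF kb]) (use near in blast)
      finally show ?thesis .
    qed
    have scale: "(\<integral>\<^sup>+y. k y \<partial>lborel) = ennreal (h ^ DIM('a)) * (\<integral>\<^sup>+y. g y \<partial>lborel)"
    proof -
      have kz: "k (z + h *\<^sub>R x) = g x" for x using h by (simp add: k_def)
      have "(\<integral>\<^sup>+y. k y \<partial>lborel) = (\<integral>\<^sup>+y. k y \<partial>density (distr lborel borel (\<lambda>x. z + h *\<^sub>R x)) (\<lambda>_. \<bar>h\<bar> ^ DIM('a)))"
        using lborel_affine[of h z] h by simp
      also have "\<dots> = (\<integral>\<^sup>+x. ennreal (h ^ DIM('a)) * k (z + h *\<^sub>R x) \<partial>lborel)"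
        using kb h by (simp add: nn_integral_density nn_integral_distr)
      also have "\<dots> = ennreal (h ^ DIM('a)) * (\<integral>\<^sup>+y. g y \<partial>lborel)"
        unfolding kz using g(1) by (intro nn_integral_cmult) simp
      finally show ?thesis .
    qed
    have lower: "ennreal (p z - e) * k y \<le> ennreal (q y) * k y" for y
    proof (cases "k y = 0")
      case False
      then show ?thesis using near[OF False] by (intro mult_right_mono ennreal_leI) (auto simp: q_def)
    qed simp
    have upper: "ennreal (q y) * k y \<le> ennreal (p z + e) * k y" for y
    proof (cases "k y = 0")
      case False
      then show ?thesis using near[OF False] by (intro mult_right_mono ennreal_leI) (auto simp: q_def)
    qed simp
    have "ennreal (p z - e) * (\<integral>\<^sup>+y. k y \<partial>lborel) \<le> (\<integral>\<^sup>+y. ennreal (q y) * k y \<partial>lborel)"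
      using kb lower by (subst nn_integral_cmult[symmetric]) (auto intro: nn_integral_mono)
    moreover have "(\<integral>\<^sup>+y. ennreal (q y) * k y \<partial>lborel) \<le> ennreal (p z + e) * (\<integral>\<^sup>+y. k y \<partial>lborel)"
      using kb upper by (subst nn_integral_cmult[symmetric]) (auto intro: nn_integral_mono)
    ultimately show "ennreal (p z - e) * (ennreal (h ^ DIM('a)) * (\<integral>\<^sup>+y. g y \<partial>lborel)) \<le> (\<integral>\<^sup>+\<omega>. g (inverse h *\<^sub>R (X \<omega> - z)) \<partial>M) \<and>
     (\<integral>\<^sup>+\<omega>. g (inverse h *\<^sub>R (X \<omega> - z)) \<partial>M) \<le> ennreal (p z + e) * (ennreal (h ^ DIM('a)) * (\<integral>\<^sup>+y. g y \<partial>lborel))"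
      unfolding M scale by simp
  qed
qed

lemma expectation_rescaled_density:
  fixes X :: "'w \<Rightarrow> 'a::euclidean_space"
  assumes X: "X \<in> measurable M borel" and p: "has_density_on M X U p" and U: "open U" "z \<in> U"
    and cont: "isCont p z" and S: "bounded S" "S \<in> sets borel" "emeasure lborel S > 0" and e: "0 < e" "e \<le> p z"
  obtains \<delta> where "\<delta> > 0" "\<And>h g. 0 < h \<Longrightarrow> h < \<delta> \<Longrightarrow> g \<in> borel_measurable borel \<Longrightarrow> (\<And>y. 0 \<le> g y) \<Longrightarrow>
     (\<And>y. y \<notin> S \<Longrightarrow> g y = 0) \<Longrightarrow> integrable (uniform_measure lborel S) g \<Longrightarrow>
     integrable M (\<lambda>\<omega>. g (inverse h *\<^sub>R (X \<omega> - z))) \<and>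
     \<bar>(\<integral>\<omega>. g (inverse h *\<^sub>R (X \<omega> - z)) \<partial>M) - p z * measure lborel S * h ^ DIM('a) * (\<integral>y. g y \<partial>uniform_measure lborel S)\<bar>
       \<le> e * measure lborel S * h ^ DIM('a) * (\<integral>y. g y \<partial>uniform_measure lborel S)"
proof -
  let ?P = "uniform_measure lborel S" and ?s = "measure lborel S"
  have fin: "emeasure lborel S < \<infinity>" using S(1) by (rule emeasure_bounded_finite)
  then have s: "emeasure lborel S = ennreal ?s" by (simp add: emeasure_eq_ennreal_measure)
  have spos: "?s > 0" using S(3) unfolding s by simp
  from nn_integral_rescaled_density[OF X p U cont S(1) e(1)] obtain \<delta> where \<delta>: "\<delta> > 0"
    "\<And>h g. 0 < h \<Longrightarrow> h < \<delta> \<Longrightarrow> g \<in> borel_measurable borel \<Longrightarrow> (\<And>y. y \<notin> S \<Longrightarrow> g y = 0) \<Longrightarrow>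
     ennreal (p z - e) * (ennreal (h ^ DIM('a)) * (\<integral>\<^sup>+y. g y \<partial>lborel)) \<le> (\<integral>\<^sup>+\<omega>. g (inverse h *\<^sub>R (X \<omega> - z)) \<partial>M) \<and>
     (\<integral>\<^sup>+\<omega>. g (inverse h *\<^sub>R (X \<omega> - z)) \<partial>M) \<le> ennreal (p z + e) * (ennreal (h ^ DIM('a)) * (\<integral>\<^sup>+y. g y \<partial>lborel))"
    by blast
  show ?thesis
  proof (rule that[OF \<delta>(1)])
    fix h :: real and g :: "'a \<Rightarrow> real"
    assume h: "0 < h" "h < \<delta>" and g: "g \<in> borel_measurable borel" "\<And>y. 0 \<le> g y" "\<And>y. y \<notin> S \<Longrightarrow> g y = 0" "integrable ?P g"
    define I where "I = (\<integral>y. g y \<partial>?P)"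
    have I0: "I \<ge> 0" unfolding I_def using g(2) by (simp add: integral_nonneg_AE)
    have "(\<integral>\<^sup>+y. ennreal (g y) \<partial>lborel) = ennreal (?s * I)"
    proof -
      have "ennreal I = (\<integral>\<^sup>+y. ennreal (g y) \<partial>?P)"
        unfolding I_def using nn_integral_eq_integral[OF g(4)] g(2) by simp
      also have "\<dots> = (\<integral>\<^sup>+y\<in>S. ennreal (g y) \<partial>lborel) / emeasure lborel S"
        using g(1) S(2) by (intro nn_integral_uniform_measure) auto
      also have "(\<integral>\<^sup>+y\<in>S. ennreal (g y) \<partial>lborel) = (\<integral>\<^sup>+y. ennreal (g y) \<partial>lborel)"
        using g(3) by (intro nn_integral_cong) (auto split: split_indicator)
      finally have "ennreal I * ennreal ?s = (\<integral>\<^sup>+y. ennreal (g y) \<partial>lborel) / ennreal ?s * ennreal ?s" unfolding s by simp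
      also have "\<dots> = (\<integral>\<^sup>+y. ennreal (g y) \<partial>lborel)"
        using spos by (subst ennreal_divide_times) (simp add: ennreal_mult_divide_eq divide_ennreal mult.commute)
      finally show ?thesis using I0 spos by (simp add: ennreal_mult mult.commute)
    qed
    moreover have "(\<lambda>y. ennreal (g y)) \<in> borel_measurable borel" "\<And>y. y \<notin> S \<Longrightarrow> ennreal (g y) = 0" using g by auto
    ultimately have b: "ennreal (p z - e) * (ennreal (h ^ DIM('a)) * ennreal (?s * I)) \<le> (\<integral>\<^sup>+\<omega>. ennreal (g (inverse h *\<^sub>R (X \<omega> - z))) \<partial>M)"
      "(\<integral>\<^sup>+\<omega>. ennreal (g (inverse h *\<^sub>R (X \<omega> - z))) \<partial>M) \<le> ennreal (p z + e) * (ennreal (h ^ DIM('a)) * ennreal (?s * I))"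
      using \<delta>(2)[OF h, of "\<lambda>y. ennreal (g y)"] by auto
    have gX: "(\<lambda>\<omega>. g (inverse h *\<^sub>R (X \<omega> - z))) \<in> borel_measurable M"
      using X g(1) by measurable
    have "(\<integral>\<^sup>+\<omega>. ennreal (g (inverse h *\<^sub>R (X \<omega> - z))) \<partial>M) < \<infinity>"
      by (rule order.strict_trans1[OF b(2)]) (simp add: ennreal_mult_less_top)
    then have int: "integrable M (\<lambda>\<omega>. g (inverse h *\<^sub>R (X \<omega> - z)))"
      using gX g(2) by (intro integrableI_nonneg) auto
    let ?E = "\<integral>\<omega>. g (inverse h *\<^sub>R (X \<omega> - z)) \<partial>M"
    have E0: "?E \<ge> 0" using g(2) by (simp add: integral_nonneg_AE)
    have nE: "(\<integral>\<^sup>+\<omega>. ennreal (g (inverse h *\<^sub>R (X \<omega> - z))) \<partial>M) = ennreal ?E"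
      using nn_integral_eq_integral[OF int] g(2) by simp
    have hp: "h ^ DIM('a) > 0" using h by simp
    have "ennreal ((p z - e) * (h ^ DIM('a) * (?s * I))) \<le> ennreal ?E" "ennreal ?E \<le> ennreal ((p z + e) * (h ^ DIM('a) * (?s * I)))"
      using b unfolding nE using hp I0 spos e
      by (simp_all add: ennreal_mult[symmetric] ennreal_mult'[symmetric] del: ennreal_plus)
    then have "(p z - e) * (h ^ DIM('a) * (?s * I)) \<le> ?E" "?E \<le> (p z + e) * (h ^ DIM('a) * (?s * I))"
      using E0 hp I0 spos e by (simp_all add: ennreal_le_iff del: ennreal_plus)
    then show "integrable M (\<lambda>\<omega>. g (inverse h *\<^sub>R (X \<omega> - z))) \<and>
     \<bar>?E - p z * ?s * h ^ DIM('a) * (\<integral>y. g y \<partial>?P)\<bar> \<le> e * ?s * h ^ DIM('a) * (\<integral>y. g y \<partial>?P)"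
      using int unfolding I_def[symmetric] by (simp add: abs_le_iff algebra_simps)
  qed
qed

section \<open>Weak convergence of the rows\<close>

lemma cos_integral_from_char:
  assumes "prob_space M" "u \<in> borel_measurable M" "(\<integral>\<omega>. iexp (u \<omega>) \<partial>M) = c"
  shows "(\<integral>\<omega>. cos (u \<omega> + b) \<partial>M) = Re (iexp b * c)"
proof -
  interpret prob_space M by fact
  have um: "u \<in> borel_measurable M" by fact
  have i: "integrable M (\<lambda>\<omega>. iexp (u \<omega>))" using um by (intro integrable_iexp) auto
  have "(\<integral>\<omega>. cos (u \<omega> + b) \<partial>M) = (\<integral>\<omega>. Re (iexp b * iexp (u \<omega>)) \<partial>M)"
    by (simp add: exp_add[symmetric] Re_exp distrib_left[symmetric] add.commute flip: of_real_add)
  also have "\<dots> = Re (\<integral>\<omega>. iexp b * iexp (u \<omega>) \<partial>M)" using i by (intro integral_Re) auto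
  also have "(\<integral>\<omega>. iexp b * iexp (u \<omega>) \<partial>M) = iexp b * c" using i assms(3) by simp
  finally show ?thesis .
qed

context bracketing_chain
begin

text \<open>Where the truncation is active, \<open>sqrt (r n) * l\<close> is below \<open>2 * env y\<close>, so the factor \<open>sqrt (r n)\<close> can be
  traded for another factor \<open>env y\<close>; the rest is dominated convergence.\<close>

lemma truncated_envelope_tendsto:
  assumes r: "filterlim r at_top sequentially" and l: "l > 0"
  shows "(\<lambda>n. sqrt (r n) * (\<integral>y. 2 * env y * of_bool (sqrt (r n) * l < 2 * env y) \<partial>P)) \<longlonglongrightarrow> 0"
proof -
  have rpos: "\<forall>\<^sub>F n in sequentially. r n > 0" using r by (simp add: filterlim_at_top_dense)
  have envP [measurable]: "env \<in> borel_measurable P" by (rule measurable_P[OF env_borel])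
  have sr: "filterlim (\<lambda>n. sqrt (r n)) at_top sequentially" using filterlim_compose[OF sqrt_at_top r] .
  have i4: "integrable P (\<lambda>y. 4 * (env y)\<^sup>2 / l)" using env_L2 by auto
  have "(\<lambda>n. \<integral>y. 4 * (env y)\<^sup>2 / l * of_bool (sqrt (r n) * l < 2 * env y) \<partial>P) \<longlonglongrightarrow> (\<integral>y. 0 \<partial>P)"
  proof (rule integral_dominated_convergence[OF _ _ i4])
    show "AE y in P. (\<lambda>n. 4 * (env y)\<^sup>2 / l * of_bool (sqrt (r n) * l < 2 * env y)) \<longlonglongrightarrow> 0"
    proof (intro AE_I2)
      fix y
      have "\<forall>\<^sub>F n in sequentially. sqrt (r n) \<ge> 2 * env y / l" using sr by (simp add: filterlim_at_top)
      then have "\<forall>\<^sub>F n in sequentially. 4 * (env y)\<^sup>2 / l * of_bool (sqrt (r n) * l < 2 * env y) = 0"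
        by eventually_elim (use l in \<open>simp add: field_simps\<close>)
      then show "(\<lambda>n. 4 * (env y)\<^sup>2 / l * of_bool (sqrt (r n) * l < 2 * env y)) \<longlonglongrightarrow> 0"
        by (rule tendsto_eventually)
    qed
    show "AE y in P. norm (4 * (env y)\<^sup>2 / l * of_bool (sqrt (r n) * l < 2 * env y)) \<le> 4 * (env y)\<^sup>2 / l" for n
      using l by auto
  qed (measurable)
  then have lim: "(\<lambda>n. \<integral>y. 4 * (env y)\<^sup>2 / l * of_bool (sqrt (r n) * l < 2 * env y) \<partial>P) \<longlonglongrightarrow> 0" by simp
  show ?thesis
  proof (rule Lim_null_comparison[OF _ lim])
    show "\<forall>\<^sub>F n in sequentially. norm (sqrt (r n) * (\<integral>y. 2 * env y * of_bool (sqrt (r n) * l < 2 * env y) \<partial>P))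
        \<le> (\<integral>y. 4 * (env y)\<^sup>2 / l * of_bool (sqrt (r n) * l < 2 * env y) \<partial>P)"
      using rpos
    proof eventually_elim
      case (elim n)
      let ?A = "\<lambda>y. of_bool (sqrt (r n) * l < 2 * env y) :: real"
      have pt: "sqrt (r n) * (2 * env y * ?A y) \<le> 4 * (env y)\<^sup>2 / l * ?A y" for y
      proof (cases "sqrt (r n) * l < 2 * env y")
        case True
        have "sqrt (r n) * (2 * env y) * l \<le> 2 * env y * (2 * env y)"
          using mult_right_mono[of "sqrt (r n) * l" "2 * env y" "2 * env y"] True env_nonneg[of y] by (simp add: mult_ac)
        then show ?thesis using True l by (simp add: field_simps power2_eq_square)
      qed simp
      have b1: "(\<lambda>y. 2 * env y * ?A y) \<in> borel_measurable borel" using env_borel by measurable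
      have i1: "integrable P (\<lambda>y. 2 * env y * ?A y)"
        by (rule L2_bounded(2)[OF b1, of 2]) (use env_nonneg in auto)
      have i2: "integrable P (\<lambda>y. 4 * (env y)\<^sup>2 / l * ?A y)"
        by (rule Bochner_Integration.integrable_bound[OF i4]) (use l in auto)
      have "sqrt (r n) * (\<integral>y. 2 * env y * ?A y \<partial>P) = (\<integral>y. sqrt (r n) * (2 * env y * ?A y) \<partial>P)" by simp
      also have "\<dots> \<le> (\<integral>y. 4 * (env y)\<^sup>2 / l * ?A y \<partial>P)"
        using i1 i2 pt by (intro integral_mono) auto
      finally have "sqrt (r n) * (\<integral>y. 2 * env y * ?A y \<partial>P) \<le> (\<integral>y. 4 * (env y)\<^sup>2 / l * ?A y \<partial>P)" .
      moreover have "0 \<le> (\<integral>y. 2 * env y * ?A y \<partial>P)" using env_nonneg by (intro integral_nonneg_AE) auto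
      ultimately show ?case using elim by simp
    qed
  qed
qed

text \<open>For each level \<open>q\<close>, the outer expectation of \<open>H\<close> at the process differs from the expectation of \<open>H\<close>
  at its projection to level \<open>q\<close> by at most a multiple of the mean of the majorant from
  \<open>chaining_bound\<close>; the projections converge in law, and their limits are close to the limit law.\<close>

theorem rows_converge_weakly:
  fixes Y :: "nat \<Rightarrow> nat \<Rightarrow> 'w \<Rightarrow> 'a" and r :: "nat \<Rightarrow> real"
  assumes M: "prob_space M" and rows: "\<And>n. n \<ge> n0 \<Longrightarrow> independent_row M (Y n) n (r n) C S P"
    and S: "S \<in> sets borel"
    and ident: "\<And>n i. n \<ge> n0 \<Longrightarrow> i \<in> {1..n} \<Longrightarrow> distr M borel (Y n i) = distr M borel (Y n 1)"
    and r: "filterlim r at_top sequentially" and ratio: "(\<lambda>n. r n / n) \<longlonglongrightarrow> 0"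
    and var: "\<And>g. g \<in> borel_measurable borel \<Longrightarrow> (\<And>y. 0 \<le> g y) \<Longrightarrow> (\<And>y. y \<notin> S \<Longrightarrow> g y = 0) \<Longrightarrow> integrable P g \<Longrightarrow>
        (\<lambda>n. n / r n * (\<integral>\<omega>. g (Y n 1 \<omega>) \<partial>M)) \<longlonglongrightarrow> v * (\<integral>y. g y \<partial>P)"
    and \<kappa>: "\<kappa> > 0" "\<kappa>\<^sup>2 * v = 1"
  shows "HJ_weakly_converges M (\<lambda>n \<omega>. \<lambda>f\<in>F. \<kappa> * independent_row.T M (Y n) n (r n) f \<omega>) (linfty F) law"
proof (rule HJ_weakly_converges_lipschitzI[OF M prob_space_law sets_law space_law])
  interpret M: prob_space M by fact
  define T where "T n = independent_row.T M (Y n) n (r n)" for n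
  let ?X = "\<lambda>n \<omega>. \<lambda>f\<in>F. \<kappa> * T n f \<omega>"
  have chained: "chained_row P F S env proj width N M (Y n) n (r n) C" if "n \<ge> n0" for n
    using rows[OF that] bracketing_chain_axioms by (simp add: chained_row_def)
  have Fb: "f \<in> borel_measurable borel" if "f \<in> F" for f using F_borel that by auto
  have X_in: "?X n \<omega> \<in> mspace (linfty F)" if n: "n \<ge> n0" for n \<omega>
  proof -
    interpret R: chained_row P F S env proj width N M "Y n" n "r n" C by (rule chained[OF n])
    have te: "R.test env" by (rule R.test_envelope[OF env_borel, of 1]) (use env_nonneg in simp)
    have "\<bar>\<kappa> * T n f \<omega>\<bar> \<le> \<kappa> * (\<bar>R.T env \<omega>\<bar> + 2 * C * sqrt (r n) * (\<integral>y. env y \<partial>P))" if "f \<in> F" for f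
      using R.T_abs_le[OF te Fb[OF that] env[OF that]] \<kappa>(1) by (simp add: T_def abs_mult mult_left_mono)
    then have "\<forall>f\<in>F. \<bar>?X n \<omega> f\<bar> \<le> \<kappa> * (\<bar>R.T env \<omega>\<bar> + 2 * C * sqrt (r n) * (\<integral>y. env y \<partial>P))" by simp
    then show ?thesis unfolding mspace_linfty_iff by (intro conjI exI restrict_extensional)
  qed
  then show "\<forall>\<^sub>F n in sequentially. \<forall>\<omega>\<in>space M. (\<lambda>f\<in>F. \<kappa> * independent_row.T M (Y n) n (r n) f \<omega>) \<in> mspace (linfty F)"
    unfolding T_def[symmetric] by (intro eventually_sequentiallyI[of n0]) blast
  fix H B m assume H: "bounded_lipschitz (linfty F) B m H"
  have m: "m \<ge> 0" using H by (simp add: bounded_lipschitz_def)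
  have HB: "\<bar>H x\<bar> \<le> B" if "x \<in> mspace (linfty F)" for x using H that unfolding bounded_lipschitz_def by blast
  have C: "C > 0" using rows[of n0] by (simp add: independent_row_def independent_row_axioms_def)

  \<comment> \<open>for a fixed level, only finitely many coordinates matter\<close>
  have fidi: "(\<lambda>n. \<integral>\<omega>. H (\<lambda>f\<in>F. \<kappa> * T n (proj q f) \<omega>) \<partial>M) \<longlonglongrightarrow> (\<integral>w. H (\<lambda>f\<in>F. w (proj q f)) \<partial>law)"
    and fidi_measurable: "n \<ge> n0 \<Longrightarrow> (\<lambda>\<omega>. H (\<lambda>f\<in>F. \<kappa> * T n (proj q f) \<omega>)) \<in> borel_measurable M" for q n
  proof -
    from finite_rank_coords[OF H, of q] obtain k e G where G: "lipschitz_coords k m G" "\<And>x. \<bar>G x\<bar> \<le> B"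
      "\<And>i. e i \<in> proj q ` F" "\<And>v. H (\<lambda>f\<in>F. v (proj q f)) = G (\<lambda>i. v (e i))" by metis
    have eF: "e i \<in> F" for i using G(3)[of i] proj_in by auto
    define V where "V n i \<omega> = (if n \<ge> n0 then \<kappa> * T n (e i) \<omega> else 0)" for n i \<omega>
    have Fsq: "integrable P (\<lambda>y. (e i y)\<^sup>2)" for i using F_square_integrable[OF eF] by (simp add: square_integrable_def)
    have test: "independent_row.test S P (e i)" "independent_row.test S P (\<lambda>y. (e i y)\<^sup>2)" if "n \<ge> n0" for n i
    proof -
      interpret R: chained_row P F S env proj width N M "Y n" n "r n" C by (rule chained[OF that])
      show t: "R.test (e i)" by (rule R.test_envelope[OF Fb[OF eF], where c=1]) (use env[OF eF] in simp)
      show "R.test (\<lambda>y. (e i y)\<^sup>2)" using t Fsq by (auto simp: R.test_def intro: borel_measurable_power)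
    qed
    have Tm: "T n (e i) \<in> borel_measurable M" if "n \<ge> n0" for n i
    proof -
      interpret R: chained_row P F S env proj width N M "Y n" n "r n" C by (rule chained[OF that])
      show ?thesis unfolding T_def by (rule R.T_measurable[OF test(1)[OF that]])
    qed
    have Vm: "V n i \<in> borel_measurable M" for n i
      using Tm[of n i] unfolding V_def by (cases "n \<ge> n0") auto
    have VG: "H (\<lambda>f\<in>F. \<kappa> * T n (proj q f) \<omega>) = G (\<lambda>i. V n i \<omega>)" if "n \<ge> n0" for n \<omega>
      using G(4)[of "\<lambda>f. \<kappa> * T n f \<omega>"] that by (simp add: V_def)
    have Gm: "(\<lambda>\<omega>. G (\<lambda>i. V n i \<omega>)) \<in> borel_measurable M" for n
      by (rule lipschitz_coords_measurable[OF G(1)]) (rule Vm)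
    then show "(\<lambda>\<omega>. H (\<lambda>f\<in>F. \<kappa> * T n (proj q f) \<omega>)) \<in> borel_measurable M" if "n \<ge> n0" for n
      using Gm[of n] VG[OF that] by simp
    define b where "b = (\<Sum>i<k. \<kappa>\<^sup>2 * (C * (\<integral>y. (e i y)\<^sup>2 \<partial>P)) + (\<integral>y. (e i y)\<^sup>2 \<partial>P))"
    have bi: "\<kappa>\<^sup>2 * (C * (\<integral>y. (e i y)\<^sup>2 \<partial>P)) \<le> b" "(\<integral>y. (e i y)\<^sup>2 \<partial>P) \<le> b" if "i < k" for i
    proof -
      have nn: "0 \<le> (\<integral>y. (e i y)\<^sup>2 \<partial>P)" "0 \<le> \<kappa>\<^sup>2 * (C * (\<integral>y. (e i y)\<^sup>2 \<partial>P))" for i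
        using C by (simp_all add: integral_nonneg_AE)
      have "\<kappa>\<^sup>2 * (C * (\<integral>y. (e i y)\<^sup>2 \<partial>P)) + (\<integral>y. (e i y)\<^sup>2 \<partial>P) \<le> b"
        unfolding b_def using that nn
        by (intro member_le_sum[where f="\<lambda>i. \<kappa>\<^sup>2 * (C * (\<integral>y. (e i y)\<^sup>2 \<partial>P)) + (\<integral>y. (e i y)\<^sup>2 \<partial>P)"]) (auto intro: add_nonneg_nonneg)
      then show "\<kappa>\<^sup>2 * (C * (\<integral>y. (e i y)\<^sup>2 \<partial>P)) \<le> b" "(\<integral>y. (e i y)\<^sup>2 \<partial>P) \<le> b" using nn[of i] by linarith+
    qed
    have "(\<lambda>n. \<integral>\<omega>. G (\<lambda>i. V n i \<omega>) \<partial>M) \<longlonglongrightarrow> (\<integral>w. G (\<lambda>i. w (e i)) \<partial>law)"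
    proof (rule fidi_convergence[OF M prob_space_law Vm law_coordinate[OF eF] _ _ _ G(1,2), where B=b])
      show "\<forall>\<^sub>F n in sequentially. \<forall>i<k. integrable M (\<lambda>\<omega>. (V n i \<omega>)\<^sup>2) \<and> (\<integral>\<omega>. (V n i \<omega>)\<^sup>2 \<partial>M) \<le> b"
      proof (intro eventually_sequentiallyI[of n0] allI impI)
        fix n i assume n: "n \<ge> n0" and i: "i < k"
        interpret R: chained_row P F S env proj width N M "Y n" n "r n" C by (rule chained[OF n])
        note sm = R.T_second_moment[OF test[OF n], of i]
        have V2: "(V n i \<omega>)\<^sup>2 = \<kappa>\<^sup>2 * (R.T (e i) \<omega>)\<^sup>2" for \<omega> using n by (simp add: V_def T_def power_mult_distrib)
        have "(\<integral>\<omega>. (V n i \<omega>)\<^sup>2 \<partial>M) = \<kappa>\<^sup>2 * (\<integral>\<omega>. (R.T (e i) \<omega>)\<^sup>2 \<partial>M)" unfolding V2 by simp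
        also have "\<dots> \<le> \<kappa>\<^sup>2 * (C * (\<integral>y. (e i y)\<^sup>2 \<partial>P))" by (rule mult_left_mono[OF sm(2)]) simp
        also have "\<dots> \<le> b" by (rule bi(1)[OF i])
        finally show "integrable M (\<lambda>\<omega>. (V n i \<omega>)\<^sup>2) \<and> (\<integral>\<omega>. (V n i \<omega>)\<^sup>2 \<partial>M) \<le> b"
          using sm(1) unfolding V2 by simp
      qed
      show "\<forall>i<k. integrable law (\<lambda>w. (w (e i))\<^sup>2) \<and> (\<integral>w. (w (e i))\<^sup>2 \<partial>law) \<le> b"
        using law_moments(1,2)[of "{()}" "\<lambda>_. e i" "\<lambda>_. 1" for i] eF bi(2) by simp
      fix c :: "nat \<Rightarrow> real" and a :: real
      define g where "g y = (\<Sum>i<k. c i * \<kappa> * e i y)" for y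
      have gb: "g \<in> borel_measurable borel" unfolding g_def[abs_def] using Fb[OF eF] by (intro borel_measurable_sum borel_measurable_times) auto
      have g2: "integrable P (\<lambda>y. (g y)\<^sup>2)"
        using square_integrable_lincomb[of "{..<k}" P e "\<lambda>i. c i * \<kappa>"] F_square_integrable[OF eF]
        by (simp add: g_def square_integrable_def)
      have gS: "g y = 0" if "y \<notin> S" for y
        unfolding g_def using env[OF eF, of _ y] env_S[OF that] by (intro sum.neutral) auto
      have Tg: "(\<Sum>i<k. c i * V n i \<omega>) = T n g \<omega>" if n: "n \<ge> n0" for n \<omega>
      proof -
        interpret R: chained_row P F S env proj width N M "Y n" n "r n" C by (rule chained[OF n])
        have sc: "R.T (\<lambda>y. a * f y) \<omega> = a * R.T f \<omega>" for a f
          unfolding R.T_def by (simp add: right_diff_distrib[symmetric] sum_distrib_left mult_ac)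
        have ts: "R.test (\<lambda>y. c i * \<kappa> * e i y)" for i using test(1)[OF n, of i] by (auto simp: R.test_def)
        have "R.T g \<omega> = (\<Sum>i<k. R.T (\<lambda>y. c i * \<kappa> * e i y) \<omega>)"
          unfolding g_def by (rule R.T_sum) (use ts in auto)
        then show ?thesis using n by (simp add: sc V_def T_def mult.assoc)
      qed
      have Tgm: "T n g \<in> borel_measurable M" if "n \<ge> n0" for n
      proof -
        have "(\<lambda>\<omega>. \<Sum>i<k. c i * V n i \<omega>) \<in> borel_measurable M" using Vm by (intro borel_measurable_sum borel_measurable_times) auto
        then show ?thesis using Tg[OF that] by simp
      qed
      have vlim: "(\<lambda>n. n / r n * (\<integral>\<omega>. (g (Y n 1 \<omega>))\<^sup>2 \<partial>M)) \<longlonglongrightarrow> v * (\<integral>y. (g y)\<^sup>2 \<partial>P)"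
        by (rule var) (use gb g2 gS in auto)
      have clt: "(\<lambda>n. \<integral>\<omega>. iexp (T n g \<omega>) \<partial>M) \<longlonglongrightarrow> complex_of_real (exp (- (v * (\<integral>y. (g y)\<^sup>2 \<partial>P)) / 2))"
        unfolding T_def by (rule row_clt[OF rows prob_P sets_P S ident r ratio gb gS g2 vlim])
      have vg: "v * (\<integral>y. (g y)\<^sup>2 \<partial>P) = (\<integral>y. (\<Sum>i<k. c i * e i y)\<^sup>2 \<partial>P)"
      proof -
        have "(g y)\<^sup>2 = \<kappa>\<^sup>2 * (\<Sum>i<k. c i * e i y)\<^sup>2" for y
        proof -
          have "g y = \<kappa> * (\<Sum>i<k. c i * e i y)" by (simp add: g_def sum_distrib_left mult_ac)
          then show ?thesis by (simp add: power_mult_distrib)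
        qed
        then have "v * (\<integral>y. (g y)\<^sup>2 \<partial>P) = (\<kappa>\<^sup>2 * v) * (\<integral>y. (\<Sum>i<k. c i * e i y)\<^sup>2 \<partial>P)" by simp
        then show ?thesis by (simp add: \<kappa>(2))
      qed
      have lc: "(\<integral>w. iexp (\<Sum>i<k. c i * w (e i)) \<partial>law) = complex_of_real (exp (- (\<integral>y. (\<Sum>i<k. c i * e i y)\<^sup>2 \<partial>P) / 2))"
        using law_char[of "{..<k}" e c] eF by (simp add: exp_of_real[symmetric])
      have wm: "(\<lambda>w. \<Sum>i<k. c i * w (e i)) \<in> borel_measurable law"
        using law_coordinate[OF eF] by (intro borel_measurable_sum borel_measurable_times) auto
      have W: "(\<integral>w. cos ((\<Sum>i<k. c i * w (e i)) + a) \<partial>law) = Re (iexp a * complex_of_real (exp (- (\<integral>y. (\<Sum>i<k. c i * e i y)\<^sup>2 \<partial>P) / 2)))"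
        by (rule cos_integral_from_char[OF prob_space_law wm lc])
      have "(\<lambda>n. Re (iexp a * (\<integral>\<omega>. iexp (T n g \<omega>) \<partial>M))) \<longlonglongrightarrow> (\<integral>w. cos ((\<Sum>i<k. c i * w (e i)) + a) \<partial>law)"
        unfolding W by (intro tendsto_Re tendsto_mult_left) (use clt in \<open>simp only: vg\<close>)
      moreover have "\<forall>\<^sub>F n in sequentially. Re (iexp a * (\<integral>\<omega>. iexp (T n g \<omega>) \<partial>M)) = (\<integral>\<omega>. cos ((\<Sum>i<k. c i * V n i \<omega>) + a) \<partial>M)"
      proof (rule eventually_sequentiallyI[of n0])
        fix n assume n: "n \<ge> n0"
        show "Re (iexp a * (\<integral>\<omega>. iexp (T n g \<omega>) \<partial>M)) = (\<integral>\<omega>. cos ((\<Sum>i<k. c i * V n i \<omega>) + a) \<partial>M)"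
          unfolding Tg[OF n] by (rule cos_integral_from_char[OF M Tgm[OF n] refl, symmetric])
      qed
      ultimately show "(\<lambda>n. \<integral>\<omega>. cos ((\<Sum>i<k. c i * V n i \<omega>) + a) \<partial>M) \<longlonglongrightarrow> (\<integral>w. cos ((\<Sum>i<k. c i * w (e i)) + a) \<partial>law)"
        by (rule Lim_transform_eventually)
    qed
    moreover have "(\<integral>w. G (\<lambda>i. w (e i)) \<partial>law) = (\<integral>w. H (\<lambda>f\<in>F. w (proj q f)) \<partial>law)"
      by (simp only: G(4))
    moreover have "\<forall>\<^sub>F n in sequentially. (\<integral>\<omega>. G (\<lambda>i. V n i \<omega>) \<partial>M) = (\<integral>\<omega>. H (\<lambda>f\<in>F. \<kappa> * T n (proj q f) \<omega>) \<partial>M)"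
      by (rule eventually_sequentiallyI[of n0]) (simp only: VG)
    ultimately show "(\<lambda>n. \<integral>\<omega>. H (\<lambda>f\<in>F. \<kappa> * T n (proj q f) \<omega>) \<partial>M) \<longlonglongrightarrow> (\<integral>w. H (\<lambda>f\<in>F. w (proj q f)) \<partial>law)"
      using Lim_transform_eventually by force
  qed

  \<comment> \<open>the price of the reduction to level \<open>q\<close>: its first summand vanishes for large \<open>n\<close>, the second one for large \<open>q\<close>\<close>
  define err where "err q n = m * \<kappa> * (4 * C * (sqrt (r n) * (\<integral>y. 2 * env y * of_bool (sqrt (r n) * level q < 2 * env y) \<partial>P)))
      + m * \<kappa> * ((6 + 6 * sqrt C + 2 * C) * (\<Sum>i. entropy_term (i + q)) + 2 * C * (1/2)^q)" for q n
  have close: "\<bar>outer_expectation M (\<lambda>\<omega>. H (?X n \<omega>)) - (\<integral>\<omega>. H (\<lambda>f\<in>F. \<kappa> * T n (proj q f) \<omega>) \<partial>M)\<bar> \<le> err q n"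
    if n: "n \<ge> n0" for n q
  proof -
    interpret R: chained_row P F S env proj width N M "Y n" n "r n" C by (rule chained[OF n])
    obtain U where U: "integrable M U" "\<And>f \<omega>. f \<in> F \<Longrightarrow> \<bar>R.T f \<omega> - R.T (proj q f) \<omega>\<bar> \<le> U \<omega>"
      "(\<integral>\<omega>. U \<omega> \<partial>M) \<le> 4 * C * sqrt (r n) * (\<integral>y. 2 * env y * of_bool (sqrt (r n) * level q < 2 * env y) \<partial>P)
       + (6 + 6 * sqrt C + 2 * C) * (\<Sum>i. entropy_term (i + q)) + 2 * C * (1/2)^q"
      using R.chaining_bound[of q] by blast
    let ?Hq = "\<lambda>\<omega>. H (\<lambda>f\<in>F. \<kappa> * T n (proj q f) \<omega>)"
    have Xq: "(\<lambda>f\<in>F. \<kappa> * T n (proj q f) \<omega>) \<in> mspace (linfty F)" for \<omega>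
    proof -
      have "(\<lambda>f\<in>F. ?X n \<omega> (proj q f)) = (\<lambda>f\<in>F. \<kappa> * T n (proj q f) \<omega>)"
        using proj_in by (intro restrict_ext) simp
      then show ?thesis using proj_comp_in[OF X_in[OF n, of \<omega>], of q] by simp
    qed
    have d: "\<bar>H (?X n \<omega>) - ?Hq \<omega>\<bar> \<le> m * (\<kappa> * U \<omega>)" for \<omega>
    proof -
      have "\<bar>H (?X n \<omega>) - ?Hq \<omega>\<bar> \<le> m * mdist (linfty F) (?X n \<omega>) (\<lambda>f\<in>F. \<kappa> * T n (proj q f) \<omega>)"
        using H X_in[OF n] Xq unfolding bounded_lipschitz_def by blast
      also have "mdist (linfty F) (?X n \<omega>) (\<lambda>f\<in>F. \<kappa> * T n (proj q f) \<omega>) \<le> \<kappa> * U \<omega>"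
        unfolding mdist_linfty_le_iff[OF X_in[OF n] Xq F_nonempty]
      proof
        fix f assume f: "f \<in> F"
        have "\<bar>\<kappa> * R.T f \<omega> - \<kappa> * R.T (proj q f) \<omega>\<bar> = \<kappa> * \<bar>R.T f \<omega> - R.T (proj q f) \<omega>\<bar>"
          using \<kappa>(1) by (simp add: right_diff_distrib[symmetric] abs_mult)
        then show "\<bar>?X n \<omega> f - (\<lambda>f\<in>F. \<kappa> * T n (proj q f) \<omega>) f\<bar> \<le> \<kappa> * U \<omega>"
          using U(2)[OF f, of \<omega>] f \<kappa>(1) by (simp add: T_def)
      qed
      finally show ?thesis using m by (simp add: mult_left_mono)
    qed
    have iH: "integrable M ?Hq"
      using fidi_measurable[OF n] HB[OF Xq] by (intro M.integrable_const_bound[where B=B]) auto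
    have iU: "integrable M (\<lambda>\<omega>. m * (\<kappa> * U \<omega>))" using U(1) by simp
    have "outer_expectation M (\<lambda>\<omega>. H (?X n \<omega>)) \<le> (\<integral>\<omega>. ?Hq \<omega> + m * (\<kappa> * U \<omega>) \<partial>M)"
    proof (rule outer_expectation_le[OF M, where c="- B"])
      show "integrable M (\<lambda>\<omega>. ?Hq \<omega> + m * (\<kappa> * U \<omega>))" using iH iU by simp
      show "H (?X n \<omega>) \<le> ?Hq \<omega> + m * (\<kappa> * U \<omega>)" for \<omega> using d[of \<omega>] by linarith
      show "- B \<le> H (?X n \<omega>)" for \<omega> using HB[OF X_in[OF n, of \<omega>]] by linarith
    qed
    moreover have "(\<integral>\<omega>. ?Hq \<omega> - m * (\<kappa> * U \<omega>) \<partial>M) \<le> outer_expectation M (\<lambda>\<omega>. H (?X n \<omega>))"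
    proof (rule outer_expectation_ge[OF M, where c="B"])
      show "integrable M (\<lambda>\<omega>. ?Hq \<omega> - m * (\<kappa> * U \<omega>))" using iH iU by simp
      show "?Hq \<omega> - m * (\<kappa> * U \<omega>) \<le> H (?X n \<omega>)" for \<omega> using d[of \<omega>] by linarith
      show "H (?X n \<omega>) \<le> B" for \<omega> using HB[OF X_in[OF n, of \<omega>]] by linarith
    qed
    moreover have "(\<integral>\<omega>. ?Hq \<omega> + m * (\<kappa> * U \<omega>) \<partial>M) = (\<integral>\<omega>. ?Hq \<omega> \<partial>M) + m * \<kappa> * (\<integral>\<omega>. U \<omega> \<partial>M)"
      "(\<integral>\<omega>. ?Hq \<omega> - m * (\<kappa> * U \<omega>) \<partial>M) = (\<integral>\<omega>. ?Hq \<omega> \<partial>M) - m * \<kappa> * (\<integral>\<omega>. U \<omega> \<partial>M)"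
      using iH iU by (simp_all add: mult.assoc)
    moreover have "m * \<kappa> * (\<integral>\<omega>. U \<omega> \<partial>M) \<le> err q n"
    proof -
      have "m * \<kappa> \<ge> 0" using m \<kappa>(1) by simp
      from mult_left_mono[OF U(3) this] show ?thesis by (simp add: err_def algebra_simps)
    qed
    ultimately show ?thesis by linarith
  qed
  have small: "(\<lambda>q. m * \<kappa> * ((6 + 6 * sqrt C + 2 * C) * (\<Sum>i. entropy_term (i + q)) + 2 * C * (1/2)^q)) \<longlonglongrightarrow> 0"
  proof -
    have "(\<lambda>q. m * \<kappa> * ((6 + 6 * sqrt C + 2 * C) * (\<Sum>i. entropy_term (i + q)) + 2 * C * (1/2)^q))
        \<longlonglongrightarrow> m * \<kappa> * ((6 + 6 * sqrt C + 2 * C) * 0 + 2 * C * 0)"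
      by (intro tendsto_intros entropy_tail_tendsto LIMSEQ_power_zero) auto
    then show ?thesis by (simp only: mult_zero_right add_0_right)
  qed
  have "(\<lambda>n. outer_expectation M (\<lambda>\<omega>. H (?X n \<omega>))) \<longlonglongrightarrow> (\<integral>w. H w \<partial>law)"
  proof (rule tendstoI)
    fix \<epsilon> :: real assume \<epsilon>: "\<epsilon> > 0"
    have e4: "\<epsilon> / 4 > 0" using \<epsilon> by simp
    have "\<forall>\<^sub>F q in sequentially. dist (\<integral>w. H (\<lambda>f\<in>F. w (proj q f)) \<partial>law) (\<integral>w. H w \<partial>law) < \<epsilon> / 4"
      by (rule tendstoD[OF law_finite_rank_limit[OF H] e4])
    then have "\<forall>\<^sub>F q in sequentially. dist (\<integral>w. H (\<lambda>f\<in>F. w (proj q f)) \<partial>law) (\<integral>w. H w \<partial>law) < \<epsilon> / 4 \<and>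
        m * \<kappa> * ((6 + 6 * sqrt C + 2 * C) * (\<Sum>i. entropy_term (i + q)) + 2 * C * (1/2)^q) < \<epsilon> / 4"
      using order_tendstoD(2)[OF small e4] by (rule eventually_conj)
    then obtain q where q: "dist (\<integral>w. H (\<lambda>f\<in>F. w (proj q f)) \<partial>law) (\<integral>w. H w \<partial>law) < \<epsilon> / 4"
        "m * \<kappa> * ((6 + 6 * sqrt C + 2 * C) * (\<Sum>i. entropy_term (i + q)) + 2 * C * (1/2)^q) < \<epsilon> / 4"
      using eventually_happens'[OF sequentially_bot] by blast
    have "(\<lambda>n. m * \<kappa> * (4 * C * (sqrt (r n) * (\<integral>y. 2 * env y * of_bool (sqrt (r n) * level q < 2 * env y) \<partial>P)))) \<longlonglongrightarrow> m * \<kappa> * (4 * C * 0)"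
      by (intro tendsto_intros truncated_envelope_tendsto[OF r level_pos])
    then have "\<forall>\<^sub>F n in sequentially. m * \<kappa> * (4 * C * (sqrt (r n) * (\<integral>y. 2 * env y * of_bool (sqrt (r n) * level q < 2 * env y) \<partial>P))) < \<epsilon> / 4"
      by (rule order_tendstoD(2)) (use e4 in simp)
    moreover have "\<forall>\<^sub>F n in sequentially. dist (\<integral>\<omega>. H (\<lambda>f\<in>F. \<kappa> * T n (proj q f) \<omega>) \<partial>M) (\<integral>w. H (\<lambda>f\<in>F. w (proj q f)) \<partial>law) < \<epsilon> / 4"
      by (rule tendstoD[OF fidi e4])
    moreover have "\<forall>\<^sub>F n in sequentially. n \<ge> n0" by (rule eventually_ge_at_top)
    ultimately show "\<forall>\<^sub>F n in sequentially. dist (outer_expectation M (\<lambda>\<omega>. H (?X n \<omega>))) (\<integral>w. H w \<partial>law) < \<epsilon>"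
    proof eventually_elim
      case (elim n)
      have "err q n < \<epsilon> / 4 + \<epsilon> / 4" unfolding err_def using elim(1) q(2) by linarith
      then show ?case using close[OF elim(3), of q] elim(2) q(1) unfolding dist_real_def by linarith
    qed
  qed
  then show "(\<lambda>n. outer_expectation M (\<lambda>\<omega>. H (\<lambda>f\<in>F. \<kappa> * independent_row.T M (Y n) n (r n) f \<omega>))) \<longlonglongrightarrow> (\<integral>w. H w \<partial>law)"
    unfolding T_def .
qed

end

section \<open>The local empirical process\<close>

lemma HJ_weakly_converges_eventually_cong:
  assumes "HJ_weakly_converges M X D L" "\<forall>\<^sub>F n in sequentially. X n = X' n"
  shows "HJ_weakly_converges M X' D L"
proof -
  have "\<forall>\<^sub>F n in sequentially. \<forall>\<omega>\<in>space M. X' n \<omega> \<in> mspace D"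
    using assms unfolding HJ_weakly_converges_def by (auto elim: eventually_elim2)
  moreover have "(\<lambda>n. outer_expectation M (\<lambda>\<omega>. H (X' n \<omega>))) \<longlonglongrightarrow> a"
    if "(\<lambda>n. outer_expectation M (\<lambda>\<omega>. H (X n \<omega>))) \<longlonglongrightarrow> a" for H a
    by (rule Lim_transform_eventually[OF that]) (use assms(2) in \<open>auto elim: eventually_mono\<close>)
  ultimately show ?thesis using assms(1) unfolding HJ_weakly_converges_def by blast
qed

theorem corollary3:
  fixes M :: "'w measure"
    and Z :: "nat \<Rightarrow> 'w \<Rightarrow> real^'d"
    and z :: "real^'d"
    and \<F> :: "(real^'d \<Rightarrow> real) set"
    and h :: "nat \<Rightarrow> real"
    and S U :: "(real^'d) set"
    and dens :: "real^'d \<Rightarrow> real"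
    and P\<^sub>0 :: "(real^'d) measure"
  assumes "prob_space M"
    and "prob_space.indep_vars M (\<lambda>_. borel) Z {1..}"
    and "\<forall>i\<ge>1. distr M borel (Z i) = distr M borel (Z 1)"
    and "\<F> \<subseteq> borel_measurable borel"
    and "pointwise_measurable \<F>"
    and "\<forall>n\<ge>1. 0 \<le> h n"
    and "h \<longlonglongrightarrow> 0"
    and "filterlim (\<lambda>n. real n * h n ^ CARD('d)) at_top sequentially"
    and "S = envelope_support \<F>"
    and "bounded S"
    and "emeasure lborel S > 0"
    and "open U" and "z \<in> U"
    and "has_density_on M (Z 1) U dens"
    and "isCont dens z"
    and "dens z > 0"
    and "P\<^sub>0 = uniform_measure lborel S"
    and "(\<integral>\<^sup>+y. (envelope \<F> y)\<^sup>2 \<partial>P\<^sub>0) < \<infinity>"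
    and "bracketing_integral \<infinity> \<F> P\<^sub>0 < \<infinity>"
  shows "\<exists>W. isonormal_gaussian_law P\<^sub>0 \<F> W \<and>
    HJ_weakly_converges M
      (\<lambda>n \<omega>. \<lambda>f\<in>\<F>. 1 / sqrt (measure lborel S * dens z) *
        local_empirical_process M Z z n (h n) \<omega> f)
      (linfty \<F>) W"
proof -
  interpret M: prob_space M by fact
  note indep = assms(2) and same_law = assms(3) and F_borel = assms(4)
  have support: "f y = 0" if "f \<in> \<F>" "y \<notin> S" for f y
  proof -
    have "envelope \<F> y = 0"
      using that(2) closure_subset[of "{y. envelope \<F> y \<noteq> 0}"] unfolding assms(9) envelope_support_def by auto
    moreover have "ennreal \<bar>f y\<bar> \<le> envelope \<F> y" unfolding envelope_def by (rule SUP_upper[OF that(1)])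
    ultimately show ?thesis by simp
  qed
  have S: "S \<in> sets borel" unfolding assms(9) envelope_support_def by simp
  have F_ne: "\<F> \<noteq> {}"
  proof
    assume "\<F> = {}"
    then have "S = {}" unfolding assms(9) envelope_support_def envelope_def by (simp add: bot_ennreal)
    then show False using assms(11) by simp
  qed
  define s where "s = measure lborel S"
  have fin: "emeasure lborel S < \<infinity>" using assms(10) by (rule emeasure_bounded_finite)
  have s: "s > 0" using assms(11) fin unfolding s_def by (simp add: measure_def enn2real_positive_iff)
  have P0: "prob_space P\<^sub>0"
    unfolding assms(17) using assms(11) fin by (intro prob_space_uniform_measure) auto
  have sets_P0: "sets P\<^sub>0 = sets borel" unfolding assms(17) by simp
  obtain proj width N where "bracketing_chain P\<^sub>0 \<F> S (\<lambda>y. enn2real (envelope \<F> y)) proj width N"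
    by (rule bracketing_chain_exists[OF P0 sets_P0 F_ne F_borel assms(5) S _ assms(18,19)])
      (erule (1) support, blast)
  then interpret chain: bracketing_chain P\<^sub>0 \<F> S "\<lambda>y. enn2real (envelope \<F> y)" proj width N .

  let ?d = "CARD('d)"
  define Y where "Y n i \<omega> = inverse (h n) *\<^sub>R (Z i \<omega> - z)" for n i \<omega>
  define r where "r n = real n * h n ^ ?d" for n
  define C where "C = 2 * dens z * s"
  have C: "C > 0" using s assms(16) by (simp add: C_def)
  have Z: "Z i \<in> measurable M borel" if "i \<ge> 1" for i
    using indep that unfolding M.indep_vars_def by auto
  have Y: "Y n i \<in> measurable M borel" if "i \<ge> 1" for n i
    unfolding Y_def[abs_def] using Z[OF that] by measurable
  have law_Y: "distr M borel (Y n i) = distr M borel (Y n 1)" if "i \<ge> 1" for n i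
  proof -
    let ?a = "\<lambda>x. inverse (h n) *\<^sub>R (x - z)"
    have a: "?a \<in> borel_measurable borel" by measurable
    have "distr M borel (Y n j) = distr (distr M borel (Z j)) borel ?a" if "j \<ge> 1" for j
      unfolding distr_distr[OF a Z[OF that]] by (simp add: Y_def[abs_def] comp_def)
    moreover have "distr M borel (Z i) = distr M borel (Z 1)" using same_law that by blast
    ultimately show ?thesis using that by (metis order_refl)
  qed
  have mean_Y: "(\<integral>\<omega>. g (Y n i \<omega>) \<partial>M) = (\<integral>\<omega>. g (Y n 1 \<omega>) \<partial>M)"
      "integrable M (\<lambda>\<omega>. g (Y n 1 \<omega>)) \<Longrightarrow> integrable M (\<lambda>\<omega>. g (Y n i \<omega>))"
    if g: "g \<in> borel_measurable borel" and i: "i \<ge> 1" for g :: "real^'d \<Rightarrow> real" and n i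
    using integral_distr[OF Y[OF i, of n] g] integral_distr[OF Y[of 1 n] g] law_Y[OF i, of n]
      integrable_distr_eq[OF Y[OF i, of n] g] integrable_distr_eq[OF Y[of 1 n] g] by simp_all

  have rescaled: "\<exists>\<delta>>0. \<forall>h g. 0 < h \<longrightarrow> h < \<delta> \<longrightarrow> g \<in> borel_measurable borel \<longrightarrow> (\<forall>y. 0 \<le> g y) \<longrightarrow>
      (\<forall>y. y \<notin> S \<longrightarrow> g y = 0) \<longrightarrow> integrable P\<^sub>0 g \<longrightarrow>
      integrable M (\<lambda>\<omega>. g (inverse h *\<^sub>R (Z 1 \<omega> - z))) \<and>
      \<bar>(\<integral>\<omega>. g (inverse h *\<^sub>R (Z 1 \<omega> - z)) \<partial>M) - dens z * s * h ^ ?d * (\<integral>y. g y \<partial>P\<^sub>0)\<bar>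
        \<le> e * s * h ^ ?d * (\<integral>y. g y \<partial>P\<^sub>0)" if e: "0 < e" "e \<le> dens z" for e
  proof -
    have Z1: "Z 1 \<in> measurable M borel" by (rule Z) simp
    obtain \<delta> where "\<delta> > 0" "\<And>h g. 0 < h \<Longrightarrow> h < \<delta> \<Longrightarrow> g \<in> borel_measurable borel \<Longrightarrow> (\<And>y. 0 \<le> g y) \<Longrightarrow>
     (\<And>y. y \<notin> S \<Longrightarrow> g y = 0) \<Longrightarrow> integrable (uniform_measure lborel S) g \<Longrightarrow>
     integrable M (\<lambda>\<omega>. g (inverse h *\<^sub>R (Z 1 \<omega> - z))) \<and>
     \<bar>(\<integral>\<omega>. g (inverse h *\<^sub>R (Z 1 \<omega> - z)) \<partial>M) - dens z * measure lborel S * h ^ DIM(real^'d) * (\<integral>y. g y \<partial>uniform_measure lborel S)\<bar>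
       \<le> e * measure lborel S * h ^ DIM(real^'d) * (\<integral>y. g y \<partial>uniform_measure lborel S)"
      by (rule expectation_rescaled_density[OF Z1 assms(14,12,13,15,10) S assms(11) e]) blast
    then show ?thesis unfolding assms(17) s_def by (intro exI[of _ \<delta>]) (simp add: DIM_cart)
  qed

  have r_lim: "filterlim r at_top sequentially" using assms(8) by (simp add: r_def[abs_def])
  have r_pos: "\<forall>\<^sub>F n in sequentially. r n > 0" using r_lim by (simp add: filterlim_at_top_dense)
  have h_pos: "\<forall>\<^sub>F n in sequentially. h n > 0"
    using r_pos eventually_ge_at_top[of 1]
  proof eventually_elim
    case (elim n)
    have "h n \<noteq> 0" using elim(1) by (auto simp: r_def zero_power)
    then show ?case using assms(6) elim(2) by (simp add: less_le)
  qed
  have h_small: "\<forall>\<^sub>F n in sequentially. h n < \<delta>" if "\<delta> > 0" for \<delta>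
    by (rule order_tendstoD(2)[OF assms(7) that])
  have ratio: "(\<lambda>n. r n / n) \<longlonglongrightarrow> 0"
  proof (rule Lim_transform_eventually)
    show "(\<lambda>n. h n ^ ?d) \<longlonglongrightarrow> 0" using tendsto_power[OF assms(7), of ?d] by (simp add: zero_power)
    show "\<forall>\<^sub>F n in sequentially. h n ^ ?d = r n / n"
      using eventually_ge_at_top[of 1] by eventually_elim (simp add: r_def)
  qed

  \<comment> \<open>with \<open>e = dens z\<close>, the relative error of the rescaled density is at most 1, hence the factor 2 in \<open>C\<close>\<close>
  obtain n0 where n0: "\<And>n. n \<ge> n0 \<Longrightarrow> independent_row M (Y n) n (r n) C S P\<^sub>0"
  proof -
    obtain \<delta> where \<delta>: "\<delta> > 0" "\<And>h g. 0 < h \<Longrightarrow> h < \<delta> \<Longrightarrow> g \<in> borel_measurable borel \<Longrightarrow> (\<forall>y. 0 \<le> g y) \<Longrightarrow>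
      (\<forall>y. y \<notin> S \<longrightarrow> g y = 0) \<Longrightarrow> integrable P\<^sub>0 g \<Longrightarrow>
      integrable M (\<lambda>\<omega>. g (inverse h *\<^sub>R (Z 1 \<omega> - z))) \<and>
      \<bar>(\<integral>\<omega>. g (inverse h *\<^sub>R (Z 1 \<omega> - z)) \<partial>M) - dens z * s * h ^ ?d * (\<integral>y. g y \<partial>P\<^sub>0)\<bar>
        \<le> dens z * s * h ^ ?d * (\<integral>y. g y \<partial>P\<^sub>0)"
      using rescaled[OF assms(16) order_refl] by blast
    have "\<forall>\<^sub>F n in sequentially. n \<ge> 1 \<and> 0 < r n \<and> 0 < h n \<and> h n < \<delta>"
      by (intro eventually_conj eventually_ge_at_top r_pos h_pos h_small \<delta>(1))
    then obtain n0 where n0: "\<And>n. n \<ge> n0 \<Longrightarrow> n \<ge> 1 \<and> 0 < r n \<and> 0 < h n \<and> h n < \<delta>"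
      unfolding eventually_sequentially by blast
    show ?thesis
    proof (rule that[of n0])
      fix n assume "n \<ge> n0"
      note n = n0[OF this]
      show "independent_row M (Y n) n (r n) C S P\<^sub>0"
      proof (unfold_locales)
        show "M.indep_vars (\<lambda>_. borel) (Y n) {1..n}"
          unfolding Y_def[abs_def]
          by (rule M.indep_vars_compose2[OF M.indep_vars_subset[OF indep], where Y="\<lambda>i x. inverse (h n) *\<^sub>R (x - z)"]) auto
        show "r n > 0" "C > 0" "sets P\<^sub>0 = sets borel" using n C sets_P0 by auto
        fix g :: "real^'d \<Rightarrow> real" and i
        assume g: "g \<in> borel_measurable borel" "\<And>y. 0 \<le> g y" "\<And>y. y \<notin> S \<Longrightarrow> g y = 0" "integrable P\<^sub>0 g" and i: "i \<in> {1..n}"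
        have b: "integrable M (\<lambda>\<omega>. g (Y n 1 \<omega>))"
          "\<bar>(\<integral>\<omega>. g (Y n 1 \<omega>) \<partial>M) - dens z * s * h n ^ ?d * (\<integral>y. g y \<partial>P\<^sub>0)\<bar> \<le> dens z * s * h n ^ ?d * (\<integral>y. g y \<partial>P\<^sub>0)"
          using \<delta>(2)[of "h n" g] n g by (simp_all add: Y_def)
        have "(\<integral>\<omega>. g (Y n 1 \<omega>) \<partial>M) \<le> 2 * (dens z * s * h n ^ ?d * (\<integral>y. g y \<partial>P\<^sub>0))" using b(2) by linarith
        then have "n * (\<integral>\<omega>. g (Y n 1 \<omega>) \<partial>M) \<le> n * (2 * (dens z * s * h n ^ ?d * (\<integral>y. g y \<partial>P\<^sub>0)))"
          by (intro mult_left_mono) auto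
        also have "\<dots> = C * r n * (\<integral>y. g y \<partial>P\<^sub>0)" by (simp add: C_def r_def)
        finally show "integrable M (\<lambda>\<omega>. g (Y n i \<omega>)) \<and> n * (\<integral>\<omega>. g (Y n i \<omega>) \<partial>M) \<le> C * r n * (\<integral>y. g y \<partial>P\<^sub>0)"
          using mean_Y[OF g(1), of i n] b(1) i by simp
      qed
    qed
  qed

  have var: "(\<lambda>n. n / r n * (\<integral>\<omega>. g (Y n 1 \<omega>) \<partial>M)) \<longlonglongrightarrow> dens z * s * (\<integral>y. g y \<partial>P\<^sub>0)"
    if g: "g \<in> borel_measurable borel" "\<And>y. 0 \<le> g y" "\<And>y. y \<notin> S \<Longrightarrow> g y = 0" "integrable P\<^sub>0 g" for g
  proof (rule tendstoI)
    fix \<epsilon> :: real assume \<epsilon>: "\<epsilon> > 0"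
    define I where "I = (\<integral>y. g y \<partial>P\<^sub>0)"
    have I: "I \<ge> 0" unfolding I_def using g(2) by (simp add: integral_nonneg_AE)
    \<comment> \<open>admissible in \<open>rescaled\<close> and such that \<open>e * s * I < \<epsilon>\<close>\<close>
    define e where "e = min (dens z) (\<epsilon> / 2 / (s * (I + 1)))"
    have e: "0 < e" "e \<le> dens z" using assms(16) s I \<epsilon> by (simp_all add: e_def add_nonneg_pos)
    have sI: "s * (I + 1) > 0" using s I by (simp add: add_nonneg_pos)
    have "e * s * I \<le> e * (s * (I + 1))" using s I e by (simp add: algebra_simps)
    also have "\<dots> \<le> \<epsilon> / 2"
      using sI min.cobounded2[of "dens z" "\<epsilon> / 2 / (s * (I + 1))"] by (simp only: e_def pos_le_divide_eq)
    also have "\<dots> < \<epsilon>" using \<epsilon> by simp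
    finally have eI: "e * s * I < \<epsilon>" .
    obtain \<delta> where \<delta>: "\<delta> > 0" "\<And>h. 0 < h \<Longrightarrow> h < \<delta> \<Longrightarrow>
      \<bar>(\<integral>\<omega>. g (inverse h *\<^sub>R (Z 1 \<omega> - z)) \<partial>M) - dens z * s * h ^ ?d * I\<bar> \<le> e * s * h ^ ?d * I"
      using rescaled[OF e] g unfolding I_def by blast
    show "\<forall>\<^sub>F n in sequentially. dist (n / r n * (\<integral>\<omega>. g (Y n 1 \<omega>) \<partial>M)) (dens z * s * (\<integral>y. g y \<partial>P\<^sub>0)) < \<epsilon>"
      using h_pos h_small[OF \<delta>(1)] eventually_ge_at_top[of 1]
    proof eventually_elim
      case (elim n)
      let ?E = "\<integral>\<omega>. g (Y n 1 \<omega>) \<partial>M" and ?H = "h n ^ ?d"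
      have H: "?H > 0" using elim by simp
      have nr: "n / r n = 1 / ?H" using elim by (simp add: r_def)
      have "\<bar>?E - dens z * s * ?H * I\<bar> \<le> e * s * ?H * I" using \<delta>(2)[of "h n"] elim by (simp add: Y_def)
      then have "\<bar>?E - dens z * s * ?H * I\<bar> / ?H \<le> e * s * ?H * I / ?H" using H by (intro divide_right_mono) auto
      moreover have "\<bar>?E - dens z * s * ?H * I\<bar> / ?H = \<bar>1 / ?H * ?E - dens z * s * I\<bar>"
      proof -
        have "(?E - dens z * s * ?H * I) / ?H = 1 / ?H * ?E - dens z * s * I"
          using H elim(1) by (simp add: diff_divide_distrib)
        then show ?thesis using H by (metis abs_divide abs_of_pos)
      qed
      moreover have "e * s * ?H * I / ?H = e * s * I" using H elim(1) by simp
      ultimately show ?case using eI unfolding nr I_def dist_real_def by linarith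
    qed
  qed

  \<comment> \<open>the normalisation that turns the limiting variance \<open>dens z * s * P\<^sub>0(g\<^sup>2)\<close> into \<open>P\<^sub>0(g\<^sup>2)\<close>\<close>
  define \<kappa> where "\<kappa> = 1 / sqrt (s * dens z)"
  have \<kappa>: "\<kappa> > 0" "\<kappa>\<^sup>2 * (dens z * s) = 1" using s assms(16) by (auto simp: \<kappa>_def power_divide)
  have process: "independent_row.T M (Y n) n (r n) f \<omega> = local_empirical_process M Z z n (h n) \<omega> f" if n: "n \<ge> n0" for n f \<omega>
  proof -
    interpret R: independent_row M "Y n" n "r n" C S P\<^sub>0 by (rule n0[OF n])
    show ?thesis by (simp only: R.T_def local_empirical_process_def) (simp only: r_def Y_def)
  qed
  have "HJ_weakly_converges M (\<lambda>n \<omega>. \<lambda>f\<in>\<F>. \<kappa> * independent_row.T M (Y n) n (r n) f \<omega>) (linfty \<F>) chain.law"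
    by (rule chain.rows_converge_weakly[OF assms(1) n0 S law_Y r_lim ratio var \<kappa>]) auto
  then have "HJ_weakly_converges M (\<lambda>n \<omega>. \<lambda>f\<in>\<F>. 1 / sqrt (measure lborel S * dens z) * local_empirical_process M Z z n (h n) \<omega> f)
      (linfty \<F>) chain.law"
    by (rule HJ_weakly_converges_eventually_cong)
      (rule eventually_sequentiallyI[of n0], simp add: process \<kappa>_def s_def)
  then show ?thesis using chain.isonormal_law by blast
qed

end
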